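(* Let $P_{S^1\times S^1}$ be the bounded operator on $L^2_{\mathbb{C}}(S^1\times S^1)$, where $S^1\times S^1=(\mathbb{R}/2\pi\mathbb{Z})^2$ is the flat torus, that is the unique bounded extension of $d^\ast\circ D^{-1}_{S^1\times S^1}$ from the span $\Lambda$ of the exponentials $e^{ik\theta_1}e^{im\theta_2}$, $(k,m)\in\mathbb{Z}^2$, with $d^\ast=\frac{\partial}{\partial\theta_1}+\frac{\partial}{\partial\theta_2}$ and $D^{-1}_{S^1\times S^1}$ the inverse Laplace operator. Then the operator $P^2_{S^1\times S^1}=P_{S^1\times S^1}\circ P_{S^1\times S^1}$ is not trace class.
   Context: The torus $S^1\times S^1=(\mathbb{R}/2\pi\mathbb{Z})^2$ carries the flat metric descended from $\mathbb{R}^2$ (so $g_{ij}=\delta_{ij}$ in the angular coordinates $\theta_1,\theta_2$). Inverse Laplace operator. Let $(M,g)$ be a smooth, oriented, closed, connected Riemannian manifold. The Laplacian is $\Delta=\mathrm{div}\circ\mathrm{grad}$ on real-valued functions in $C^\infty(M)$; on the flat torus, $\Delta=\partial^2/\partial\theta_1^2+\partial^2/\partial\theta_2^2$. $H^1(M)$ is the real Sobolev space obtained by completing $C^\infty(M)$ with respect to $\langle u,v\rangle_{H^1}=\int_M uv+\int_M\langle \mathrm{grad}\,u,\mathrm{grad}\,v\rangle_g$, identified with a subspace of $L^2_{\mathbb{R}}(M)$. $B:H^1(M)\times H^1(M)\to\mathbb{R}$ is the continuous bilinear extension of $B(u,v)=\int_M \Delta u\cdot v$, $u,v\in C^\infty(M)$.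 Let $K=\{u\in H^1(M): B(u,v)=0 \text{ for all } v\in H^1(M)\}$ and let $K^\perp$ be its orthogonal complement in $H^1(M)$. For $h\in L^2_{\mathbb{R}}(M)$, $D^{-1}(h)$ is the unique element of $K^\perp$ satisfying $B(D^{-1}(h),v)=\int_M h\cdot v$ for all $v\in K^\perp$. The inverse Laplace operator $D^{-1}:L^2_{\mathbb{C}}(M)\to L^2_{\mathbb{C}}(M)$ is the $\mathbb{C}$-linear extension $D^{-1}(f_0+if_1)=D^{-1}(f_0)+iD^{-1}(f_1)$, a bounded operator. The operator $P_{S^1\times S^1}$. Let $\Lambda\subset L^2_{\mathbb{C}}(S^1\times S^1)$ be the finite $\mathbb{C}$-span of $\{\frac{1}{2\pi}e^{ik\theta_1}e^{im\theta_2}\}_{(k,m)\in\mathbb{Z}^2}$ (an orthonormal basis of $L^2_{\mathbb{C}}(S^1\times S^1)$), and let $d^\ast=\frac{\partial}{\partial\theta_1}+\frac{\partial}{\partial\theta_2}$ on $\Lambda$. The operator $d^\ast\circ D^{-1}_{S^1\times S^1}:\Lambda\to\Lambda$ is bounded in the $L^2$ norm, and $P_{S^1\times S^1}$ denotes its unique bounded linear extension to $L^2_{\mathbb{C}}(S^1\times S^1)$. Trace class. A bounded operator $A$ on a separable complex Hilbert space is trace class if $\sum_j\langle\varphi_j,|A|\varphi_j\rangle<\infty$ for some orthonormal basis $\{\varphi_j\}$, where $|A|=\sqrt{A^*A}$. *)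

theory Defs
  imports "HOL-Analysis.Analysis"
begin

section \<open>Functions on the flat torus\<close>

text \<open>
  A function on the torus is a function on the plane that is \<open>2\<pi>\<close>-periodic in both angular
  coordinates; integration over the torus is integration over the fundamental domain
  \<open>[0, 2\<pi>) \<times> [0, 2\<pi>)\<close>.
\<close>

definition torus_measure :: "(real \<times> real) measure" where
  "torus_measure = restrict_space lborel ({0..<2 * pi} \<times> {0..<2 * pi})"

definition doubly_periodic :: "(real \<times> real \<Rightarrow> 'b) \<Rightarrow> bool" where
  "doubly_periodic f \<longleftrightarrow> (\<forall>s t. f (s + 2 * pi, t) = f (s, t) \<and> f (s, t + 2 * pi) = f (s, t))"

definition partial1 :: "(real \<times> real \<Rightarrow> 'b::real_normed_vector) \<Rightarrow> real \<times> real \<Rightarrow> 'b" where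
  "partial1 f = (\<lambda>(s, t). vector_derivative (\<lambda>x. f (x, t)) (at s))"

definition partial2 :: "(real \<times> real \<Rightarrow> 'b::real_normed_vector) \<Rightarrow> real \<times> real \<Rightarrow> 'b" where
  "partial2 f = (\<lambda>(s, t). vector_derivative (\<lambda>y. f (s, y)) (at t))"

primrec Ck :: "nat \<Rightarrow> (real \<times> real \<Rightarrow> 'b::real_normed_vector) \<Rightarrow> bool" where
  "Ck 0 f \<longleftrightarrow> continuous_on UNIV f"
| "Ck (Suc k) f \<longleftrightarrow> (\<forall>z. f differentiable (at z)) \<and> Ck k (partial1 f) \<and> Ck k (partial2 f)"

definition torus_smooth :: "(real \<times> real \<Rightarrow> 'b::real_normed_vector) set" where
  "torus_smooth = {f. doubly_periodic f \<and> (\<forall>k. Ck k f)}"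

definition laplacian :: "(real \<times> real \<Rightarrow> 'b::real_normed_vector) \<Rightarrow> real \<times> real \<Rightarrow> 'b" where
  "laplacian f = (\<lambda>z. partial1 (partial1 f) z + partial2 (partial2 f) z)"

section \<open>The spaces of square-integrable functions\<close>

definition square_integrable :: "(real \<times> real \<Rightarrow> 'b::euclidean_space) \<Rightarrow> bool" where
  "square_integrable f \<longleftrightarrow>
     f \<in> borel_measurable torus_measure \<and> integrable torus_measure (\<lambda>z. (norm (f z))\<^sup>2)"

definition l2_eq :: "(real \<times> real \<Rightarrow> 'b::euclidean_space) \<Rightarrow> (real \<times> real \<Rightarrow> 'b) \<Rightarrow> bool" where
  "l2_eq f g \<longleftrightarrow> square_integrable f \<and> square_integrable g \<and> (AE z in torus_measure. f z = g z)"

lemma square_integrable_measurable [measurable_dest]: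
  "square_integrable f \<Longrightarrow> f \<in> borel_measurable torus_measure"
  by (simp add: square_integrable_def)

lemma square_integrable_0: "square_integrable (\<lambda>_. 0)"
  by (simp add: square_integrable_def)

lemma square_integrable_add:
  assumes f: "square_integrable f" and g: "square_integrable g"
  shows "square_integrable (\<lambda>z. f z + g z)"
proof -
  have [measurable]: "f \<in> borel_measurable torus_measure" "g \<in> borel_measurable torus_measure"
    using f g by (auto simp: square_integrable_def)
  have le: "(norm (a + b))\<^sup>2 \<le> 2 * (norm a)\<^sup>2 + 2 * (norm b)\<^sup>2" for a b :: 'a
  proof -
    have "(norm (a + b))\<^sup>2 \<le> (norm a + norm b)\<^sup>2"
      by (intro power_mono norm_triangle_ineq) auto
    also have "\<dots> \<le> 2 * (norm a)\<^sup>2 + 2 * (norm b)\<^sup>2"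
      using sum_squares_bound[of "norm a" "norm b"] by (simp add: power2_sum)
    finally show ?thesis .
  qed
  have "integrable torus_measure (\<lambda>z. 2 * (norm (f z))\<^sup>2 + 2 * (norm (g z))\<^sup>2)"
    using f g by (auto simp: square_integrable_def)
  then have "integrable torus_measure (\<lambda>z. (norm (f z + g z))\<^sup>2)"
    by (rule Bochner_Integration.integrable_bound) (auto intro!: AE_I2 order_trans[OF le])
  then show ?thesis
    by (simp add: square_integrable_def)
qed

lemma square_integrable_scaleR:
  "square_integrable f \<Longrightarrow> square_integrable (\<lambda>z. r *\<^sub>R f z)"
  by (auto simp: square_integrable_def power_mult_distrib)

lemma square_integrable_uminus:
  "square_integrable f \<Longrightarrow> square_integrable (\<lambda>z. - f z)"
  by (auto simp: square_integrable_def)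

lemma square_integrable_minus:
  "square_integrable f \<Longrightarrow> square_integrable g \<Longrightarrow> square_integrable (\<lambda>z. f z - g z)"
  using square_integrable_add[OF _ square_integrable_uminus, of f g] by simp

lemma square_integrable_mult_left:
  fixes f :: "real \<times> real \<Rightarrow> complex"
  shows "square_integrable f \<Longrightarrow> square_integrable (\<lambda>z. c * f z)"
  by (auto simp: square_integrable_def norm_mult power_mult_distrib)

lemma integrable_inner_square_integrable:
  assumes f: "square_integrable f" and g: "square_integrable g"
  shows "integrable torus_measure (\<lambda>z. f z \<bullet> g z)"
proof -
  have [measurable]: "f \<in> borel_measurable torus_measure" "g \<in> borel_measurable torus_measure"
    using f g by (auto simp: square_integrable_def)
  have le: "\<bar>a \<bullet> b\<bar> \<le> (norm a)\<^sup>2 + (norm b)\<^sup>2" for a b :: 'a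
  proof -
    have "\<bar>a \<bullet> b\<bar> \<le> norm a * norm b"
      by (rule Cauchy_Schwarz_ineq2)
    also have "\<dots> \<le> (norm a)\<^sup>2 + (norm b)\<^sup>2"
    proof -
      have "0 \<le> norm a * norm b" by simp
      then show ?thesis
        using sum_squares_bound[of "norm a" "norm b"] by linarith
    qed
    finally show ?thesis .
  qed
  have "integrable torus_measure (\<lambda>z. (norm (f z))\<^sup>2 + (norm (g z))\<^sup>2)"
    using f g by (auto simp: square_integrable_def)
  then show ?thesis
    by (rule Bochner_Integration.integrable_bound) (auto intro!: AE_I2 order_trans[OF le])
qed

lemma l2_eq_part_equivp: "part_equivp l2_eq"
proof (rule part_equivpI)
  show "\<exists>f. l2_eq f f"
    by (rule exI[of _ "\<lambda>_. 0"]) (simp add: l2_eq_def square_integrable_0)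
  show "symp l2_eq"
    by (auto simp: symp_def l2_eq_def elim: AE_mp)
  show "transp l2_eq"
    by (auto simp: transp_def l2_eq_def)
qed

quotient_type (overloaded) 'b torus_l2 = "real \<times> real \<Rightarrow> 'b::euclidean_space" / partial: l2_eq
  by (rule l2_eq_part_equivp)

abbreviation l2_class :: "(real \<times> real \<Rightarrow> 'b) \<Rightarrow> 'b::euclidean_space torus_l2" where
  "l2_class \<equiv> abs_torus_l2"

instantiation torus_l2 :: (euclidean_space) real_inner
begin

lift_definition zero_torus_l2 :: "'a torus_l2" is "\<lambda>_. 0"
  by (simp add: l2_eq_def square_integrable_0)

lift_definition plus_torus_l2 :: "'a torus_l2 \<Rightarrow> 'a torus_l2 \<Rightarrow> 'a torus_l2"
  is "\<lambda>f g z. f z + g z"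
  by (auto simp: l2_eq_def square_integrable_add)

lift_definition minus_torus_l2 :: "'a torus_l2 \<Rightarrow> 'a torus_l2 \<Rightarrow> 'a torus_l2"
  is "\<lambda>f g z. f z - g z"
  by (auto simp: l2_eq_def square_integrable_minus)

lift_definition uminus_torus_l2 :: "'a torus_l2 \<Rightarrow> 'a torus_l2" is "\<lambda>f z. - f z"
  by (auto simp: l2_eq_def square_integrable_uminus)

lift_definition scaleR_torus_l2 :: "real \<Rightarrow> 'a torus_l2 \<Rightarrow> 'a torus_l2" is "\<lambda>r f z. r *\<^sub>R f z"
  by (auto simp: l2_eq_def square_integrable_scaleR)

lift_definition inner_torus_l2 :: "'a torus_l2 \<Rightarrow> 'a torus_l2 \<Rightarrow> real"
  is "\<lambda>f g. \<integral>z. f z \<bullet> g z \<partial>torus_measure"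
proof -
  fix f f' g g' :: "real \<times> real \<Rightarrow> 'a"
  assume "l2_eq f f'" "l2_eq g g'"
  then show "(\<integral>z. f z \<bullet> g z \<partial>torus_measure) = (\<integral>z. f' z \<bullet> g' z \<partial>torus_measure)"
    by (intro integral_cong_AE) (auto simp: l2_eq_def square_integrable_def)
qed

definition norm_torus_l2 :: "'a torus_l2 \<Rightarrow> real" where
  "norm_torus_l2 f = sqrt (f \<bullet> f)"

definition dist_torus_l2 :: "'a torus_l2 \<Rightarrow> 'a torus_l2 \<Rightarrow> real" where
  "dist_torus_l2 f g = norm (f - g)"

definition sgn_torus_l2 :: "'a torus_l2 \<Rightarrow> 'a torus_l2" where
  "sgn_torus_l2 f = inverse (norm f) *\<^sub>R f"

definition uniformity_torus_l2 :: "('a torus_l2 \<times> 'a torus_l2) filter" where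
  "uniformity_torus_l2 = (INF e\<in>{0<..}. principal {(x, y). dist x y < e})"

definition open_torus_l2 :: "'a torus_l2 set \<Rightarrow> bool" where
  "open_torus_l2 U \<longleftrightarrow> (\<forall>x\<in>U. eventually (\<lambda>(x', y). x' = x \<longrightarrow> y \<in> U) uniformity)"

instance
proof
  fix f g h :: "'a torus_l2" and r s :: real
  show "f + g + h = f + (g + h)"
    by transfer (auto simp: l2_eq_def square_integrable_add add.assoc)
  show "f + g = g + f"
    by transfer (auto simp: l2_eq_def square_integrable_add add.commute)
  show "0 + f = f"
    by transfer (auto simp: l2_eq_def)
  show "- f + f = 0"
    by transfer (auto simp: l2_eq_def square_integrable_0)
  show "f - g = f + - g"
    by transfer (auto simp: l2_eq_def square_integrable_minus)
  show "r *\<^sub>R (f + g) = r *\<^sub>R f + r *\<^sub>R g"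
    by transfer (auto simp: l2_eq_def square_integrable_add square_integrable_scaleR scaleR_add_right
        simp del: scaleR_add_right[symmetric])
  show "(r + s) *\<^sub>R f = r *\<^sub>R f + s *\<^sub>R f"
    by transfer (use square_integrable_add square_integrable_scaleR in
        \<open>auto simp: l2_eq_def scaleR_add_left\<close>)
  show "r *\<^sub>R s *\<^sub>R f = (r * s) *\<^sub>R f"
    by transfer (auto simp: l2_eq_def square_integrable_scaleR)
  show "1 *\<^sub>R f = f"
    by transfer (auto simp: l2_eq_def)
  show "dist f g = norm (f - g)"
    by (simp add: dist_torus_l2_def)
  show "sgn f = inverse (norm f) *\<^sub>R f"
    by (simp add: sgn_torus_l2_def)
  show "(uniformity :: ('a torus_l2 \<times> 'a torus_l2) filter) =
      (INF e\<in>{0<..}. principal {(x, y). dist x y < e})"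
    by (simp add: uniformity_torus_l2_def)
  show "open U \<longleftrightarrow> (\<forall>x\<in>U. eventually (\<lambda>(x', y). x' = x \<longrightarrow> y \<in> U) uniformity)"
    for U :: "'a torus_l2 set"
    by (simp add: open_torus_l2_def)
  show "norm f = sqrt (f \<bullet> f)"
    by (simp add: norm_torus_l2_def)
  show "f \<bullet> g = g \<bullet> f"
    by transfer (simp add: inner_commute)
  show "(f + g) \<bullet> h = f \<bullet> h + g \<bullet> h"
    by transfer (auto simp: l2_eq_def inner_add_left integrable_inner_square_integrable)
  show "(r *\<^sub>R f) \<bullet> g = r * (f \<bullet> g)"
    by transfer simp
  show "0 \<le> f \<bullet> f"
    by transfer simp
  show "f \<bullet> f = 0 \<longleftrightarrow> f = 0"
  proof transfer
    fix f :: "real \<times> real \<Rightarrow> 'a"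
    assume "l2_eq f f"
    then have f: "square_integrable f"
      by (simp add: l2_eq_def)
    have "(\<integral>z. f z \<bullet> f z \<partial>torus_measure) = 0 \<longleftrightarrow> (AE z in torus_measure. f z \<bullet> f z = 0)"
      using integrable_inner_square_integrable[OF f f] by (intro integral_nonneg_eq_0_iff_AE) auto
    then show "(\<integral>z. f z \<bullet> f z \<partial>torus_measure) = 0 \<longleftrightarrow> l2_eq f (\<lambda>_. 0)"
      using f by (simp add: l2_eq_def square_integrable_0)
  qed
qed

end

subsection \<open>Complex structure\<close>

lift_definition cscale :: "complex \<Rightarrow> complex torus_l2 \<Rightarrow> complex torus_l2" (infixr "*\<^sub>C" 75)
  is "\<lambda>c f z. c * f z"
  by (auto simp: l2_eq_def square_integrable_mult_left)

text \<open>Conjugate-linear in the first argument.\<close>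

lift_definition cinner :: "complex torus_l2 \<Rightarrow> complex torus_l2 \<Rightarrow> complex"
  is "\<lambda>f g. \<integral>z. cnj (f z) * g z \<partial>torus_measure"
proof -
  fix f f' g g' :: "real \<times> real \<Rightarrow> complex"
  assume *: "l2_eq f f'" "l2_eq g g'"
  then have [measurable]: "f \<in> borel_measurable torus_measure" "f' \<in> borel_measurable torus_measure"
    "g \<in> borel_measurable torus_measure" "g' \<in> borel_measurable torus_measure"
    by (auto simp: l2_eq_def square_integrable_def)
  have [measurable]: "cnj \<in> borel_measurable borel"
    by (intro borel_measurable_continuous_onI continuous_intros)
  show "(\<integral>z. cnj (f z) * g z \<partial>torus_measure) = (\<integral>z. cnj (f' z) * g' z \<partial>torus_measure)"
    using * by (intro integral_cong_AE) (measurable, auto simp: l2_eq_def)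
qed

global_interpretation cvs: vector_space cscale
  defines cspan = cvs.span
proof
  fix a b :: complex and f g :: "complex torus_l2"
  show "a *\<^sub>C (f + g) = a *\<^sub>C f + a *\<^sub>C g"
    by transfer (use square_integrable_add square_integrable_mult_left in
        \<open>auto simp: l2_eq_def distrib_left\<close>)
  show "(a + b) *\<^sub>C f = a *\<^sub>C f + b *\<^sub>C f"
    by transfer (use square_integrable_add square_integrable_mult_left in
        \<open>auto simp: l2_eq_def distrib_right\<close>)
  show "a *\<^sub>C b *\<^sub>C f = (a * b) *\<^sub>C f"
    by transfer (auto simp: l2_eq_def square_integrable_mult_left mult.assoc)
  show "1 *\<^sub>C f = f"
    by transfer (auto simp: l2_eq_def)
qed

lift_definition l2_Re :: "complex torus_l2 \<Rightarrow> real torus_l2" is "\<lambda>f z. Re (f z)"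
proof -
  have "square_integrable (\<lambda>z. Re (f z))" if "square_integrable f" for f :: "real \<times> real \<Rightarrow> complex"
  proof -
    have [measurable]: "f \<in> borel_measurable torus_measure"
      using that by (simp add: square_integrable_def)
    have "integrable torus_measure (\<lambda>z. (Re (f z))\<^sup>2)"
      using that unfolding square_integrable_def
      by (elim conjE Bochner_Integration.integrable_bound) (auto simp: cmod_power2)
    then show ?thesis
      by (simp add: square_integrable_def)
  qed
  then show "l2_eq f g \<Longrightarrow> l2_eq (\<lambda>z. Re (f z)) (\<lambda>z. Re (g z))" for f g
    by (auto simp: l2_eq_def)
qed

lift_definition l2_Im :: "complex torus_l2 \<Rightarrow> real torus_l2" is "\<lambda>f z. Im (f z)"
proof -
  have "square_integrable (\<lambda>z. Im (f z))" if "square_integrable f" for f :: "real \<times> real \<Rightarrow> complex"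
  proof -
    have [measurable]: "f \<in> borel_measurable torus_measure"
      using that by (simp add: square_integrable_def)
    have "integrable torus_measure (\<lambda>z. (Im (f z))\<^sup>2)"
      using that unfolding square_integrable_def
      by (elim conjE Bochner_Integration.integrable_bound) (auto simp: cmod_power2)
    then show ?thesis
      by (simp add: square_integrable_def)
  qed
  then show "l2_eq f g \<Longrightarrow> l2_eq (\<lambda>z. Im (f z)) (\<lambda>z. Im (g z))" for f g
    by (auto simp: l2_eq_def)
qed

lift_definition l2_complex :: "real torus_l2 \<Rightarrow> complex torus_l2" is "\<lambda>f z. complex_of_real (f z)"
  by (auto simp: l2_eq_def square_integrable_def)

section \<open>Trace class operators\<close>

definition bounded_clinear :: "(complex torus_l2 \<Rightarrow> complex torus_l2) \<Rightarrow> bool" where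
  "bounded_clinear A \<longleftrightarrow> bounded_linear A \<and> (\<forall>c f. A (c *\<^sub>C f) = c *\<^sub>C A f)"

definition cadjoint :: "(complex torus_l2 \<Rightarrow> complex torus_l2) \<Rightarrow> complex torus_l2 \<Rightarrow> complex torus_l2" where
  "cadjoint A = (THE B. bounded_clinear B \<and> (\<forall>f g. cinner (A f) g = cinner f (B g)))"

definition positive_op :: "(complex torus_l2 \<Rightarrow> complex torus_l2) \<Rightarrow> bool" where
  "positive_op A \<longleftrightarrow> bounded_clinear A \<and> (\<forall>f. cinner f (A f) \<in> \<real> \<and> 0 \<le> Re (cinner f (A f)))"

definition op_sqrt :: "(complex torus_l2 \<Rightarrow> complex torus_l2) \<Rightarrow> complex torus_l2 \<Rightarrow> complex torus_l2" where
  "op_sqrt A = (THE S. positive_op S \<and> S \<circ> S = A)"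

definition op_abs :: "(complex torus_l2 \<Rightarrow> complex torus_l2) \<Rightarrow> complex torus_l2 \<Rightarrow> complex torus_l2" where
  "op_abs A = op_sqrt (cadjoint A \<circ> A)"

definition orthonormal_basis :: "complex torus_l2 set \<Rightarrow> bool" where
  "orthonormal_basis S \<longleftrightarrow>
     (\<forall>f\<in>S. \<forall>g\<in>S. cinner f g = (if f = g then 1 else 0)) \<and> closure (cspan S) = UNIV"

definition trace_class :: "(complex torus_l2 \<Rightarrow> complex torus_l2) \<Rightarrow> bool" where
  "trace_class A \<longleftrightarrow> bounded_clinear A \<and>
     (\<exists>S. orthonormal_basis S \<and> (\<lambda>f. cinner f (op_abs A f)) summable_on S)"

section \<open>The Sobolev space and the inverse Laplace operator\<close>

definition h1_inner_smooth :: "(real \<times> real \<Rightarrow> real) \<Rightarrow> (real \<times> real \<Rightarrow> real) \<Rightarrow> real" where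
  "h1_inner_smooth f g = (\<integral>z. f z * g z \<partial>torus_measure) +
     (\<integral>z. partial1 f z * partial1 g z + partial2 f z * partial2 g z \<partial>torus_measure)"

definition h1_norm_smooth :: "(real \<times> real \<Rightarrow> real) \<Rightarrow> real" where
  "h1_norm_smooth f = sqrt (h1_inner_smooth f f)"

text \<open>
  An element of the completion of the smooth functions is represented by a sequence that is Cauchy
  in the \<open>H\<^sup>1\<close> norm; it is identified with the limit of that sequence in \<open>L\<^sup>2\<close>.
\<close>

definition h1_approx :: "(nat \<Rightarrow> real \<times> real \<Rightarrow> real) \<Rightarrow> real torus_l2 \<Rightarrow> bool" where
  "h1_approx U u \<longleftrightarrow> range U \<subseteq> torus_smooth \<and>
     (\<forall>e>0. \<exists>N. \<forall>m\<ge>N. \<forall>n\<ge>N. h1_norm_smooth (\<lambda>z. U m z - U n z) < e) \<and>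
     (\<lambda>n. l2_class (U n)) \<longlonglongrightarrow> u"

definition H1 :: "real torus_l2 set" where
  "H1 = {u. \<exists>U. h1_approx U u}"

definition h1_inner :: "real torus_l2 \<Rightarrow> real torus_l2 \<Rightarrow> real" where
  "h1_inner u v = (THE c. \<forall>U V. h1_approx U u \<and> h1_approx V v \<longrightarrow>
     (\<lambda>n. h1_inner_smooth (U n) (V n)) \<longlonglongrightarrow> c)"

definition h1_norm :: "real torus_l2 \<Rightarrow> real" where
  "h1_norm u = sqrt (h1_inner u u)"

text \<open>
  The last conjunct only fixes the values of the total function \<open>b\<close> outside its intended domain
  \<open>H1 \<times> H1\<close>, which makes the extension unique.
\<close>

definition extends_laplace_form :: "(real torus_l2 \<Rightarrow> real torus_l2 \<Rightarrow> real) \<Rightarrow> bool" where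
  "extends_laplace_form b \<longleftrightarrow>
     (\<forall>u\<in>H1. \<forall>v\<in>H1. \<forall>w\<in>H1. b (u + v) w = b u w + b v w \<and> b w (u + v) = b w u + b w v) \<and>
     (\<forall>u\<in>H1. \<forall>v\<in>H1. \<forall>r. b (r *\<^sub>R u) v = r * b u v \<and> b u (r *\<^sub>R v) = r * b u v) \<and>
     (\<exists>C. \<forall>u\<in>H1. \<forall>v\<in>H1. \<bar>b u v\<bar> \<le> C * h1_norm u * h1_norm v) \<and>
     (\<forall>f\<in>torus_smooth. \<forall>g\<in>torus_smooth.
        b (l2_class f) (l2_class g) = (\<integral>z. laplacian f z * g z \<partial>torus_measure)) \<and>
     (\<forall>u v. u \<notin> H1 \<or> v \<notin> H1 \<longrightarrow> b u v = 0)"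

definition laplace_form :: "real torus_l2 \<Rightarrow> real torus_l2 \<Rightarrow> real" where
  "laplace_form = (THE b. extends_laplace_form b)"

definition laplace_kernel :: "real torus_l2 set" where
  "laplace_kernel = {u \<in> H1. \<forall>v\<in>H1. laplace_form u v = 0}"

definition laplace_kernel_perp :: "real torus_l2 set" where
  "laplace_kernel_perp = {u \<in> H1. \<forall>w\<in>laplace_kernel. h1_inner u w = 0}"

definition inv_laplace_real :: "real torus_l2 \<Rightarrow> real torus_l2" where
  "inv_laplace_real h = (THE u. u \<in> laplace_kernel_perp \<and>
     (\<forall>v\<in>laplace_kernel_perp. laplace_form u v = h \<bullet> v))"

definition inv_laplace :: "complex torus_l2 \<Rightarrow> complex torus_l2" where
  "inv_laplace f = l2_complex (inv_laplace_real (l2_Re f)) +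
     \<i> *\<^sub>C l2_complex (inv_laplace_real (l2_Im f))"

section \<open>The operator\<close>

definition torus_exp :: "int \<Rightarrow> int \<Rightarrow> complex torus_l2" where
  "torus_exp k m = l2_class (\<lambda>(s, t).
     1 / (2 * pi) * exp (\<i> * of_int k * of_real s) * exp (\<i> * of_int m * of_real t))"

definition trig_span :: "complex torus_l2 set" where
  "trig_span = cspan {torus_exp k m | k m. True}"

text \<open>Applied to a class that has a smooth representative, such as an element of \<open>trig_span\<close>.\<close>

definition d_star :: "complex torus_l2 \<Rightarrow> complex torus_l2" where
  "d_star f = l2_class (let p = (THE p. p \<in> torus_smooth \<and> l2_class p = f)
     in (\<lambda>z. partial1 p z + partial2 p z))"

definition P_torus :: "complex torus_l2 \<Rightarrow> complex torus_l2" where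
  "P_torus = (THE T. bounded_clinear T \<and> (\<forall>f\<in>trig_span. T f = d_star (inv_laplace f)))"

end

theory Submission
  imports Defs
begin

text \<open>
  On the exponential with frequency \<open>(k, m)\<close> the operator \<open>P = d\<^sup>* \<circ> D\<^sup>-\<^sup>1\<close> acts as multiplication by
  \<open>- \<i> (k + m) / (k\<^sup>2 + m\<^sup>2)\<close>, and it kills the constants. So \<open>P\<close> is a bounded, skew-adjoint Fourier
  multiplier, \<open>|P\<^sup>2| = P\<^sup>* P\<close> has the eigenvalues \<open>(k + m)\<^sup>2 / (k\<^sup>2 + m\<^sup>2)\<^sup>2\<close>, and their sum over the lattice
  diverges like the harmonic series (\<open>P_symbol_not_square_summable\<close>): \<open>P\<close> just fails to be
  Hilbert--Schmidt. The trace of \<open>P\<^sup>* P\<close> in any orthonormal basis is the sum of the \<open>\<parallel>P f\<parallel>\<^sup>2\<close>, and it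
  bounds the partial sums of the eigenvalues (\<open>sum_symbol_le_trace\<close>), so it is infinite.

  All objects in the statement are defined by unique existence, so that each of them has
  to be identified before this argument can start.

  \<^item> Fourier analysis. \<open>L\<^sup>2\<close> of the torus is complete, and the exponentials are total in it
    (\<open>AE_zero_of_Fourier_zero\<close>, by Stone--Weierstrass). Bounded multipliers are then well-defined
    bounded operators, two bounded operators that agree on exponentials are equal, and
    vectors can be compared through their Fourier coefficients.

  \<^item> The inverse Laplacian. \<open>H\<^sup>1\<close> is the closure of the graph of the gradient in \<open>L\<^sup>2 \<times> L\<^sup>2 \<times> L\<^sup>2\<close>, and this
    closure is again a graph (\<open>sobolev_graph_functional\<close>). The inner product of \<open>H\<^sup>1\<close> and the Laplace form
    are therefore explicit, and the latter is the integral of \<open>- \<langle>grad u, grad v\<rangle>\<close> (\<open>laplace_form_eq\<close>). The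
    weak Poisson problem has at most one solution, and for eigenfunctions of the Laplacian the solution
    can be written down. This gives \<open>P\<close> on trigonometric polynomials, and then \<open>P_torus_eq\<close>.

  \<^item> The absolute value. A positive square root of a diagonal operator with nonnegative eigenvalues has to act on
    each eigenvector by the square root of the eigenvalue (\<open>positive_sqrt_eigenvector\<close>), which identifies
    \<open>|P\<^sup>2|\<close> (\<open>op_abs_P_squared\<close>).
\<close>

section \<open>The torus as a finite measure space\<close>

lemma space_torus_measure [simp]: "space torus_measure = {0..<2 * pi} \<times> {0..<2 * pi}"
  by (simp add: torus_measure_def space_restrict_space)

lemma sets_torus_measure: "sets torus_measure = sets (restrict_space borel ({0..<2 * pi} \<times> {0..<2 * pi}))"
  by (simp add: torus_measure_def sets_restrict_space)

lemma torus_square_borel [measurable]: "{0..<2 * pi} \<times> {0..<2 * pi} \<in> sets (borel :: (real \<times> real) measure)"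
  by (intro borel_Times) auto

lemma finite_measure_torus: "finite_measure torus_measure"
proof
  have "emeasure torus_measure (space torus_measure)
      = emeasure lborel ({0..<2 * pi} \<times> {0..<2 * pi} :: (real \<times> real) set)"
    unfolding space_torus_measure
    by (subst torus_measure_def, subst emeasure_restrict_space) auto
  also have "\<dots> \<le> emeasure lborel (cbox (0, 0) (2 * pi, 2 * pi) :: (real \<times> real) set)"
    by (rule emeasure_mono) (simp_all add: cbox_Pair_eq Sigma_mono borel_closed closed_Times atLeastLessThan_subseteq_atLeastAtMost_iff)
  also have "\<dots> < \<infinity>"
    by (rule emeasure_lborel_cbox_finite)
  finally show "emeasure torus_measure (space torus_measure) \<noteq> \<infinity>"
    by simp
qed

interpretation torus: finite_measure torus_measure
  by (rule finite_measure_torus)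

section \<open>Completeness of the square-integrable functions\<close>

lemma l2_class_diff:
  "square_integrable f \<Longrightarrow> square_integrable g \<Longrightarrow> l2_class f - l2_class g = l2_class (\<lambda>z. f z - g z)"
  by (subst minus_torus_l2.abs_eq) (auto simp: l2_eq_def)

lemma l2_class_inner:
  "square_integrable f \<Longrightarrow> square_integrable g \<Longrightarrow>
   l2_class f \<bullet> l2_class g = (\<integral>z. f z \<bullet> g z \<partial>torus_measure)"
  by (subst inner_torus_l2.abs_eq) (auto simp: l2_eq_def)

lemma l2_class_norm_sq:
  "square_integrable f \<Longrightarrow> (norm (l2_class f))\<^sup>2 = (\<integral>z. (norm (f z))\<^sup>2 \<partial>torus_measure)"
  by (simp add: power2_norm_eq_inner l2_class_inner)

lemma l2_class_norm_sq_nn: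
  "square_integrable f \<Longrightarrow>
   ennreal ((norm (l2_class f))\<^sup>2) = (\<integral>\<^sup>+z. ennreal ((norm (f z))\<^sup>2) \<partial>torus_measure)"
  by (subst nn_integral_eq_integral) (auto simp: l2_class_norm_sq square_integrable_def)

lemma l2_class_surj: "\<exists>f. square_integrable f \<and> u = l2_class f"
  using Quotient_rep_reflp[OF Quotient_torus_l2, of u] Quotient_abs_rep[OF Quotient_torus_l2, of u]
  by (auto simp: l2_eq_def)

text \<open>
  Riesz--Fischer, pointwise part. With \<open>D\<^sub>n = |F\<^sub>n\<^sub>+\<^sub>1 - F\<^sub>n|\<close>, the geometric decay of the \<open>L\<^sup>2\<close> norms makes even a
  growing weighted sum of the \<open>D\<^sub>n\<^sup>2\<close> integrable, hence finite almost everywhere; since the torus has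
  finite measure, the constants that are needed to pass from \<open>D\<^sub>n\<^sup>2\<close> back to \<open>D\<^sub>n\<close> are integrable too.
  At almost every point the increments are then absolutely summable.
\<close>

lemma AE_convergent_of_L2_fast:
  fixes F :: "nat \<Rightarrow> real \<times> real \<Rightarrow> 'b::euclidean_space"
  assumes F: "\<And>n. square_integrable (F n)"
    and fast: "\<And>n. norm (l2_class (F (Suc n)) - l2_class (F n)) < (1 / 2) ^ n"
  shows "AE z in torus_measure. convergent (\<lambda>n. F n z)"
proof -
  define D where "D n z = norm (F (Suc n) z - F n z)" for n z
  \<comment> \<open>The increment \<open>D n z\<close> is at most \<open>(3 / 4) ^ n\<close>, or else at most \<open>(4 / 3) ^ n * (D n z)\<^sup>2\<close>. The ratio
    \<open>3 / 4\<close> is large enough that \<open>4 / 3\<close> times the factor \<open>1 / 4\<close> gained from the squares stays below 1.\<close>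
  define g where "g n z = (3 / 4) ^ n + (4 / 3) ^ n * (D n z)\<^sup>2" for n z
  have Fm [measurable]: "F n \<in> borel_measurable torus_measure" for n
    using F by (simp add: square_integrable_def)
  have Dm [measurable]: "D n \<in> borel_measurable torus_measure" for n
    unfolding D_def by measurable
  have gm [measurable]: "g n \<in> borel_measurable torus_measure" for n
    unfolding g_def by measurable
  define \<mu> where "\<mu> = measure torus_measure (space torus_measure)"
  have int: "(\<integral>\<^sup>+z. ennreal (g n z) \<partial>torus_measure) \<le> ennreal ((3 / 4) ^ n * \<mu> + (1 / 3) ^ n)" for n
  proof -
    have sq: "square_integrable (\<lambda>z. F (Suc n) z - F n z)"
      by (intro square_integrable_minus F)
    have i: "integrable torus_measure (\<lambda>z. (D n z)\<^sup>2)"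
      using sq by (simp add: square_integrable_def D_def)
    have "(\<integral>z. (D n z)\<^sup>2 \<partial>torus_measure) = (norm (l2_class (F (Suc n)) - l2_class (F n)))\<^sup>2"
      using l2_class_norm_sq[OF sq] by (simp add: D_def l2_class_diff F)
    also have "\<dots> \<le> ((1 / 2) ^ n)\<^sup>2"
      using fast[of n] by (intro power_mono) auto
    finally have le: "(\<integral>z. (D n z)\<^sup>2 \<partial>torus_measure) \<le> (1 / 4) ^ n"
      by (simp add: power2_eq_square power_mult_distrib[symmetric])
    have "(\<integral>\<^sup>+z. ennreal (g n z) \<partial>torus_measure) = ennreal (\<integral>z. g n z \<partial>torus_measure)"
      unfolding g_def by (rule nn_integral_eq_integral) (use i in auto)
    also have "(\<integral>z. g n z \<partial>torus_measure) = (3 / 4) ^ n * \<mu> + (4 / 3) ^ n * (\<integral>z. (D n z)\<^sup>2 \<partial>torus_measure)"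
      unfolding g_def using i by (simp add: \<mu>_def mult.commute)
    also have "\<dots> \<le> (3 / 4) ^ n * \<mu> + (4 / 3) ^ n * (1 / 4) ^ n"
      using le by (intro add_left_mono mult_left_mono) auto
    also have "(4 / 3) ^ n * (1 / 4) ^ n = (1 / 3 :: real) ^ n"
      by (simp add: power_mult_distrib[symmetric])
    finally show ?thesis
      by (simp add: ennreal_leI)
  qed
  have "(\<integral>\<^sup>+z. (\<Sum>n. ennreal (g n z)) \<partial>torus_measure) = (\<Sum>n. \<integral>\<^sup>+z. ennreal (g n z) \<partial>torus_measure)"
    by (rule nn_integral_suminf) measurable
  also have "\<dots> \<le> (\<Sum>n. ennreal ((3 / 4) ^ n * \<mu> + (1 / 3) ^ n))"
    by (intro suminf_le int) auto
  also have "\<dots> < \<infinity>"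
  proof -
    have "summable (\<lambda>n. (3 / 4) ^ n * \<mu> + (1 / 3) ^ n :: real)"
      by (intro summable_add summable_mult2 summable_geometric) auto
    then have "(\<Sum>n. ennreal ((3 / 4) ^ n * \<mu> + (1 / 3) ^ n)) = ennreal (\<Sum>n. (3 / 4) ^ n * \<mu> + (1 / 3) ^ n)"
      by (intro suminf_ennreal2) (auto simp: \<mu>_def)
    then show ?thesis by simp
  qed
  finally have "AE z in torus_measure. (\<Sum>n. ennreal (g n z)) \<noteq> \<infinity>"
    by (intro nn_integral_PInf_AE) auto
  then show ?thesis
  proof eventually_elim
    case (elim z)
    have "summable (\<lambda>n. g n z)"
      by (rule summable_suminf_not_top) (use elim in \<open>auto simp: g_def\<close>)
    moreover have "D n z \<le> g n z" for n
    proof (cases "D n z \<le> (3 / 4) ^ n")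
      case True
      then show ?thesis
        by (simp add: g_def) (smt (verit) mult_nonneg_nonneg zero_le_power zero_le_power2 divide_nonneg_nonneg)
    next
      case False
      have "D n z = (4 / 3) ^ n * ((3 / 4) ^ n * D n z)"
        by (simp add: mult.assoc[symmetric] power_mult_distrib[symmetric])
      also have "\<dots> \<le> (4 / 3) ^ n * (D n z * D n z)"
        using False by (intro mult_left_mono mult_right_mono) (auto simp: D_def)
      finally show ?thesis
        by (simp add: g_def power2_eq_square add_increasing)
    qed
    ultimately have "summable (\<lambda>n. norm (F (Suc n) z - F n z))"
      by (rule_tac summable_comparison_test[of _ "\<lambda>n. g n z"]) (auto simp: D_def)
    then have "summable (\<lambda>n. F (Suc n) z - F n z)"
      by (rule summable_norm_cancel)
    then have "(\<lambda>n. \<Sum>i<n. F (Suc i) z - F i z) \<longlonglongrightarrow> (\<Sum>n. F (Suc n) z - F n z)"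
      by (rule summable_LIMSEQ)
    then have "(\<lambda>n. F n z - F 0 z) \<longlonglongrightarrow> (\<Sum>n. F (Suc n) z - F n z)"
      unfolding sum_lessThan_telescope[of "\<lambda>n. F n z"] .
    from tendsto_add[OF this tendsto_const[of "F 0 z"]] show ?case
      by (auto simp: convergent_def)
  qed
qed

text \<open>
  A Cauchy sequence has a subsequence to which the previous lemma applies; its pointwise limit is
  the \<open>L\<^sup>2\<close> limit by Fatou's lemma. Completeness is used twice below: it gives the Fourier multipliers
  as convergent orthogonal series, and it gives the limits of the gradients that define \<open>H\<^sup>1\<close>.
\<close>

instance torus_l2 :: (euclidean_space) banach
proof
  fix X :: "nat \<Rightarrow> 'a torus_l2"
  assume X: "Cauchy X"
  have "\<exists>N. \<forall>m\<ge>N. \<forall>n\<ge>N. norm (X m - X n) < (1 / 2) ^ k" for k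
    using X by (intro CauchyD) auto
  then obtain N where N: "\<And>k m n. m \<ge> N k \<Longrightarrow> n \<ge> N k \<Longrightarrow> norm (X m - X n) < (1 / 2) ^ k"
    by metis
  \<comment> \<open>Strictly increasing, and \<open>r n\<close> lies beyond the index from which terms are \<open>(1 / 2) ^ n\<close>-close.\<close>
  define r where "r = rec_nat (N 0) (\<lambda>n p. max (Suc p) (N (Suc n)))"
  have r_Suc: "r (Suc n) = max (Suc (r n)) (N (Suc n))" for n
    by (simp add: r_def)
  have r_mono: "strict_mono r"
    by (rule strict_monoI_Suc) (simp add: r_Suc)
  have r_N: "N n \<le> r n" for n
    by (cases n) (auto simp: r_Suc, simp add: r_def)
  have "\<forall>n. \<exists>f. square_integrable f \<and> X (r n) = l2_class f"
    by (simp add: l2_class_surj)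
  then obtain F where F: "\<And>n. square_integrable (F n)" and XF: "\<And>n. X (r n) = l2_class (F n)"
    by metis
  have close: "norm (X (r m) - X (r n)) < (1 / 2) ^ n" if "n \<le> m" for m n
    using that r_N[of n] strict_mono_leD[OF r_mono that] by (intro N) auto
  have conv: "AE z in torus_measure. convergent (\<lambda>n. F n z)"
    by (rule AE_convergent_of_L2_fast[OF F]) (use close[of _ "Suc _"] close in \<open>auto simp: XF[symmetric]\<close>)
  define G where "G z = lim (\<lambda>n. F n z)" for z
  have Fm [measurable]: "F n \<in> borel_measurable torus_measure" for n
    using F by (simp add: square_integrable_def)
  have Gm [measurable]: "G \<in> borel_measurable torus_measure"
    unfolding G_def by (rule borel_measurable_lim_metric) simp
  have fatou: "(\<integral>\<^sup>+z. ennreal ((norm (G z - F n z))\<^sup>2) \<partial>torus_measure) \<le> ennreal (((1 / 2) ^ n)\<^sup>2)" for n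
  proof -
    have "(\<integral>\<^sup>+z. ennreal ((norm (G z - F n z))\<^sup>2) \<partial>torus_measure)
      = (\<integral>\<^sup>+z. liminf (\<lambda>m. ennreal ((norm (F m z - F n z))\<^sup>2)) \<partial>torus_measure)"
      using conv
    proof (intro nn_integral_cong_AE, eventually_elim)
      case (elim z)
      then have "(\<lambda>m. F m z) \<longlonglongrightarrow> G z"
        by (simp add: G_def convergent_LIMSEQ_iff)
      then have "(\<lambda>m. ennreal ((norm (F m z - F n z))\<^sup>2)) \<longlonglongrightarrow> ennreal ((norm (G z - F n z))\<^sup>2)"
        by (intro tendsto_ennrealI tendsto_intros)
      then show ?case
        by (intro lim_imp_Liminf[symmetric]) auto
    qed
    also have "\<dots> \<le> liminf (\<lambda>m. \<integral>\<^sup>+z. ennreal ((norm (F m z - F n z))\<^sup>2) \<partial>torus_measure)"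
      by (rule nn_integral_liminf) measurable
    also have "\<dots> \<le> ennreal (((1 / 2) ^ n)\<^sup>2)"
    proof (rule Liminf_le)
      show "\<forall>\<^sub>F m in sequentially. (\<integral>\<^sup>+z. ennreal ((norm (F m z - F n z))\<^sup>2) \<partial>torus_measure)
          \<le> ennreal (((1 / 2) ^ n)\<^sup>2)"
        using eventually_ge_at_top[of n]
      proof eventually_elim
        case (elim m)
        have "(\<integral>\<^sup>+z. ennreal ((norm (F m z - F n z))\<^sup>2) \<partial>torus_measure) = ennreal ((norm (X (r m) - X (r n)))\<^sup>2)"
          using l2_class_norm_sq_nn[OF square_integrable_minus[OF F F], of m n]
          by (simp add: XF l2_class_diff F)
        also have "\<dots> \<le> ennreal (((1 / 2) ^ n)\<^sup>2)"
          using close[OF elim] by (intro ennreal_leI power_mono) auto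
        finally show ?case .
      qed
    qed simp
    finally show ?thesis .
  qed
  have sqd: "square_integrable (\<lambda>z. G z - F n z)" for n
  proof -
    have "(\<integral>\<^sup>+z. ennreal ((norm (G z - F n z))\<^sup>2) \<partial>torus_measure) < \<infinity>"
      using le_less_trans[OF fatou[of n]] by simp
    then show ?thesis
      unfolding square_integrable_def by (auto intro!: integrableI_bounded)
  qed
  have G: "square_integrable G"
    using square_integrable_add[OF sqd F, of 0 0] by simp
  have "norm (l2_class G - X (r n)) \<le> (1 / 2) ^ n" for n
  proof -
    have "ennreal ((norm (l2_class G - X (r n)))\<^sup>2) \<le> ennreal (((1 / 2) ^ n)\<^sup>2)"
      using fatou[of n] l2_class_norm_sq_nn[OF sqd[of n]] by (simp add: XF l2_class_diff F G)
    then show ?thesis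
      by (simp add: power2_le_iff_abs_le)
  qed
  then have "(\<lambda>n. X (r n)) \<longlonglongrightarrow> l2_class G"
  proof -
    assume le: "\<And>n. norm (l2_class G - X (r n)) \<le> (1 / 2) ^ n"
    have "(\<lambda>n. (1 / 2) ^ n :: real) \<longlonglongrightarrow> 0"
      by (rule LIMSEQ_power_zero) simp
    then have "(\<lambda>n. norm (X (r n) - l2_class G)) \<longlonglongrightarrow> 0"
      by (rule tendsto_0_le[where K = 1]) (use le in \<open>auto simp: norm_minus_commute\<close>)
    then show ?thesis
      by (simp add: tendsto_norm_zero_iff LIM_zero_iff)
  qed
  then have "X \<longlonglongrightarrow> l2_class G"
    using Cauchy_converges_subseq[OF X, of r "l2_class G"] r_mono by (simp add: o_def)
  then show "convergent X"
    by (auto simp: convergent_def)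
qed

section \<open>The characters are total\<close>

text \<open>
  The characters of the torus, without the normalisation of \<open>torus_exp\<close> and indexed by pairs, so that
  the product of two characters is the character of the sum of the indices.
\<close>

definition tchar :: "int \<times> int \<Rightarrow> real \<times> real \<Rightarrow> complex" where
  "tchar x z = cis (of_int (fst x) * fst z + of_int (snd x) * snd z)"

lemma tchar_mult: "tchar x z * tchar y z = tchar (x + y) z"
  by (simp add: tchar_def cis_mult algebra_simps)

lemma tchar_0 [simp]: "tchar 0 z = 1"
  by (simp add: tchar_def zero_prod_def)

lemma norm_tchar [simp]: "norm (tchar x z) = 1"
  by (simp add: tchar_def)

lemma cnj_tchar: "cnj (tchar x z) = tchar (- x) z"
  by (simp add: tchar_def cis_cnj)

lemma continuous_on_tchar [continuous_intros]: "continuous_on A (tchar x)"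
  unfolding tchar_def cis_conv_exp by (intro continuous_intros)

inductive trig_poly :: "(real \<times> real \<Rightarrow> complex) \<Rightarrow> bool" where
  monomial: "trig_poly (\<lambda>z. c * tchar x z)"
| add: "trig_poly f \<Longrightarrow> trig_poly g \<Longrightarrow> trig_poly (\<lambda>z. f z + g z)"

lemma trig_poly_mult: "trig_poly f \<Longrightarrow> trig_poly g \<Longrightarrow> trig_poly (\<lambda>z. f z * g z)"
proof (induction f rule: trig_poly.induct)
  case (monomial c x)
  from monomial show ?case
  proof (induction g rule: trig_poly.induct)
    case (monomial d y)
    have "(\<lambda>z. c * tchar x z * (d * tchar y z)) = (\<lambda>z. (c * d) * tchar (x + y) z)"
      by (simp add: fun_eq_iff tchar_mult[symmetric] ac_simps)
    then show ?case
      by (simp only: trig_poly.monomial)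
  next
    case (add f g)
    then show ?case
      by (simp add: distrib_left trig_poly.add)
  qed
next
  case (add f1 f2)
  then show ?case
    by (simp add: distrib_right trig_poly.add)
qed

text \<open>
  The homeomorphism of the torus onto a product of two circles in \<open>\<complex>\<^sup>2\<close>. Periodic functions become
  functions on a compact subset of a Euclidean space, where the Weierstrass theorem for
  real polynomials applies.
\<close>

definition circles :: "real \<times> real \<Rightarrow> complex \<times> complex" where
  "circles z = (cis (fst z), cis (snd z))"

lemma continuous_on_circles [continuous_intros]: "continuous_on A circles"
  unfolding circles_def cis_conv_exp by (intro continuous_intros)

text \<open>
  The real coordinates on the two circles are \<open>cos\<close> and \<open>sin\<close> of the angles, which are combinations of
  characters; products of characters are characters.
\<close>

lemma trig_poly_of_polynomial:
  "real_polynomial_function p \<Longrightarrow> trig_poly (\<lambda>z. complex_of_real (p (circles z)))"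
proof (induction p rule: real_polynomial_function.induct)
  case (linear f)
  interpret f: bounded_linear f by fact
  have cs: "cis s = cos s *\<^sub>R 1 + sin s *\<^sub>R \<i>" for s
    by (simp add: complex_eq_iff)
  have pr: "(a + b, c + d) = (a, 0) + (b, 0) + (0, c) + (0, d)" for a b c d :: complex
    by simp
  define a b c d where "a = complex_of_real (f (1, 0))" and "b = complex_of_real (f (\<i>, 0))"
    and "c = complex_of_real (f (0, 1))" and "d = complex_of_real (f (0, \<i>))"
  have sc: "(r *\<^sub>R a, 0) = r *\<^sub>R (a, 0 :: complex)" "(0, r *\<^sub>R a) = r *\<^sub>R (0 :: complex, a)"
    for r and a :: complex
    by auto
  have cos_eq: "complex_of_real (cos s) = (cis s + cis (- s)) / 2" for s
    by (simp add: complex_eq_iff)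
  have sin_eq: "complex_of_real (sin s) = (cis s - cis (- s)) / (2 * \<i>)" for s
    by (simp add: complex_eq_iff)
  have "complex_of_real (f (circles z)) =
      (a / 2 + b / (2 * \<i>)) * tchar (1, 0) z + (a / 2 - b / (2 * \<i>)) * tchar (-1, 0) z
    + ((c / 2 + d / (2 * \<i>)) * tchar (0, 1) z + (c / 2 - d / (2 * \<i>)) * tchar (0, -1) z)" for z
  proof -
    have "complex_of_real (f (circles z)) = complex_of_real (cos (fst z)) * a + complex_of_real (sin (fst z)) * b
      + complex_of_real (cos (snd z)) * c + complex_of_real (sin (snd z)) * d"
      unfolding circles_def cs pr sc f.add f.scaleR a_def b_def c_def d_def by simp
    also have "\<dots> = (a / 2 + b / (2 * \<i>)) * tchar (1, 0) z + (a / 2 - b / (2 * \<i>)) * tchar (-1, 0) z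
    + ((c / 2 + d / (2 * \<i>)) * tchar (0, 1) z + (c / 2 - d / (2 * \<i>)) * tchar (0, -1) z)"
      unfolding cos_eq sin_eq tchar_def by (simp add: field_simps)
    finally show ?thesis .
  qed
  then show ?case
    by (simp add: trig_poly.intros)
next
  case (const c)
  show ?case
    using trig_poly.monomial[of c 0] by simp
next
  case (add f g)
  then show ?case
    by (simp add: trig_poly.add)
next
  case (mult f g)
  then show ?case
    by (simp add: trig_poly_mult)
qed

lemma continuous_imp_torus_measurable:
  fixes f :: "real \<times> real \<Rightarrow> 'b::topological_space"
  assumes "continuous_on UNIV f"
  shows "f \<in> borel_measurable torus_measure"
  unfolding torus_measure_def
  by (rule measurable_restrict_space1) (use borel_measurable_continuous_onI[OF assms] in simp)

lemma circles_measurable [measurable]: "circles \<in> borel_measurable torus_measure"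
  by (intro continuous_imp_torus_measurable continuous_intros)

lemma tchar_measurable [measurable]: "tchar x \<in> borel_measurable torus_measure"
  by (intro continuous_imp_torus_measurable continuous_intros)

text \<open>
  A Borel left inverse of \<open>cis\<close> on \<open>[0, 2\<pi>)\<close>. Clipping the argument of \<open>arccos\<close> to its natural
  domain keeps the function continuous on each half plane.
\<close>

definition angle :: "complex \<Rightarrow> real" where
  "angle z = (if 0 \<le> Im z then arccos (max (- 1) (min 1 (Re z)))
              else 2 * pi - arccos (max (- 1) (min 1 (Re z))))"

lemma angle_measurable [measurable]: "angle \<in> borel_measurable borel"
proof -
  have [measurable]: "(\<lambda>x. arccos (max (- 1) (min 1 x))) \<in> borel_measurable borel"
    by (intro borel_measurable_continuous_onI continuous_intros) auto
  show ?thesis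
    unfolding angle_def by measurable
qed

lemma angle_cis: "0 \<le> s \<Longrightarrow> s < 2 * pi \<Longrightarrow> angle (cis s) = s"
proof (cases "s \<le> pi")
  case True
  assume "0 \<le> s"
  with True show ?thesis
    by (simp add: angle_def sin_ge_zero arccos_cos)
next
  case False
  assume s: "0 \<le> s" "s < 2 * pi"
  have "sin s < 0"
    using False s sin_lt_zero by auto
  moreover have "arccos (cos s) = 2 * pi - s"
    using arccos_cos[of "2 * pi - s"] False s by (simp add: cos_diff)
  ultimately show ?thesis
    by (simp add: angle_def)
qed

text \<open>
  The system of characters is total, already for integrable functions. The hypothesis says that \<open>f\<close>
  annihilates all trigonometric polynomials. By Stone--Weierstrass it annihilates all continuous
  functions on the product of the circles, by dominated convergence the indicators of open sets, and
  by a Dynkin argument the indicators of all Borel sets. The map \<open>circles\<close> has a Borel left inverse on the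
  fundamental square, so these sets give all measurable subsets of the torus, and \<open>f\<close> vanishes almost
  everywhere.
\<close>

lemma AE_zero_of_Fourier_zero:
  fixes f :: "real \<times> real \<Rightarrow> real"
  assumes f: "integrable torus_measure f"
    and zero: "\<And>x. (\<integral>z. complex_of_real (f z) * tchar x z \<partial>torus_measure) = 0"
  shows "AE z in torus_measure. f z = 0"
proof -
  have fm [measurable]: "f \<in> borel_measurable torus_measure"
    using f by simp
  have trig: "integrable torus_measure (\<lambda>z. complex_of_real (f z) * g z) \<and>
      (\<integral>z. complex_of_real (f z) * g z \<partial>torus_measure) = 0" if "trig_poly g" for g
    using that
  proof induction
    case (monomial c x)
    have "integrable torus_measure (\<lambda>z. complex_of_real (f z) * tchar x z)"
      by (rule Bochner_Integration.integrable_bound[OF f]) (auto simp: norm_mult)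
    then have "integrable torus_measure (\<lambda>z. c * (complex_of_real (f z) * tchar x z))"
      "(\<integral>z. c * (complex_of_real (f z) * tchar x z) \<partial>torus_measure) = 0"
      by (simp_all add: zero)
    then show ?case
      by (simp add: ac_simps)
  next
    case (add g h)
    then show ?case
      by (simp add: distrib_left)
  qed
  have poly: "integrable torus_measure (\<lambda>z. f z * p (circles z)) \<and>
      (\<integral>z. f z * p (circles z) \<partial>torus_measure) = 0" if "real_polynomial_function p" for p
  proof -
    from trig[OF trig_poly_of_polynomial[OF that]]
    have i: "integrable torus_measure (\<lambda>z. complex_of_real (f z * p (circles z)))"
      and e: "(\<integral>z. complex_of_real (f z * p (circles z)) \<partial>torus_measure) = 0"
      by simp_all
    from i have i': "integrable torus_measure (\<lambda>z. f z * p (circles z))"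
      using integrable_Re[OF i] by simp
    with e show ?thesis by (simp del: of_real_mult)
  qed
  have cont: "(\<integral>z. f z * h (circles z) \<partial>torus_measure) = 0" if h: "continuous_on UNIV h"
    for h :: "complex \<times> complex \<Rightarrow> real"
  proof -
    let ?S = "sphere 0 1 \<times> sphere 0 1 :: (complex \<times> complex) set"
    define N where "N = (\<integral>z. \<bar>f z\<bar> \<partial>torus_measure)"
    have hm [measurable]: "h \<in> borel_measurable borel"
      by (intro borel_measurable_continuous_onI h)
    have S: "circles z \<in> ?S" for z
      by (simp add: circles_def)
    have compS: "compact ?S"
      by (intro compact_Times compact_sphere)
    have "\<bar>\<integral>z. f z * h (circles z) \<partial>torus_measure\<bar> \<le> e * N" if e: "e > 0" for e
    proof -
      obtain p where p: "real_polynomial_function p" and pe: "\<And>x. x \<in> ?S \<Longrightarrow> \<bar>h x - p x\<bar> < e"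
        by (rule Stone_Weierstrass_real_polynomial_function[OF compS continuous_on_subset[OF h] e]) auto
      have pm [measurable]: "p \<in> borel_measurable borel"
        using p by (intro borel_measurable_continuous_onI continuous_on_polymonial_function)
          (simp add: real_polynomial_function_eq)
      have d_le: "\<bar>f z * (h (circles z) - p (circles z))\<bar> \<le> e * \<bar>f z\<bar>" for z
        using pe[OF S[of z]] by (simp add: abs_mult mult.commute[of e] mult_left_mono less_imp_le)
      have ie: "integrable torus_measure (\<lambda>z. e * \<bar>f z\<bar>)"
        using f by simp
      have id: "integrable torus_measure (\<lambda>z. f z * (h (circles z) - p (circles z)))"
        by (rule Bochner_Integration.integrable_bound[OF ie]) (use d_le e in \<open>auto simp: abs_mult\<close>)
      have "(\<integral>z. f z * h (circles z) \<partial>torus_measure)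
          = (\<integral>z. f z * (h (circles z) - p (circles z)) + f z * p (circles z) \<partial>torus_measure)"
        by (simp add: algebra_simps)
      also have "\<dots> = (\<integral>z. f z * (h (circles z) - p (circles z)) \<partial>torus_measure)"
        using poly[OF p] id by (subst Bochner_Integration.integral_add) auto
      also have "\<bar>\<dots>\<bar> \<le> (\<integral>z. \<bar>f z * (h (circles z) - p (circles z))\<bar> \<partial>torus_measure)"
        by (rule integral_abs_bound)
      also have "\<dots> \<le> (\<integral>z. e * \<bar>f z\<bar> \<partial>torus_measure)"
        by (rule integral_mono) (use id ie d_le in auto)
      finally show ?thesis
        by (simp add: N_def)
    qed
    note le = this
    have "N \<ge> 0"
      by (simp add: N_def)
    have "\<bar>\<integral>z. f z * h (circles z) \<partial>torus_measure\<bar> \<le> 0"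
    proof (rule field_le_epsilon)
      fix e :: real assume "e > 0"
      then have "\<bar>\<integral>z. f z * h (circles z) \<partial>torus_measure\<bar> \<le> e / (N + 1) * N"
        using \<open>N \<ge> 0\<close> by (intro le) simp
      also have "\<dots> \<le> e"
        using \<open>N \<ge> 0\<close> \<open>e > 0\<close> by (simp add: field_simps)
      finally show "\<bar>\<integral>z. f z * h (circles z) \<partial>torus_measure\<bar> \<le> 0 + e"
        by simp
    qed
    then show ?thesis by simp
  qed
  have op: "(\<integral>z. f z * indicator U (circles z) \<partial>torus_measure) = 0" if U: "open U" for U
  proof (cases "U = UNIV")
    case True
    then show ?thesis
      using cont[of "\<lambda>_. 1"] by simp
  next
    case False
    then have ne: "- U \<noteq> {}" by auto
    have Um [measurable]: "U \<in> sets borel"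
      using U by simp
    \<comment> \<open>Continuous functions that increase to the indicator of \<open>U\<close>.\<close>
    define h where "h n y = min 1 (real n * infdist y (- U))" for n y
    have hc: "continuous_on UNIV (h n)" for n
      unfolding h_def by (intro continuous_intros)
    have hm [measurable]: "h n \<in> borel_measurable borel" for n
      by (intro borel_measurable_continuous_onI hc)
    have lim: "(\<lambda>n. h n y) \<longlonglongrightarrow> indicator U y" for y
    proof (cases "y \<in> U")
      case True
      have "infdist y (- U) > 0"
        using True U ne by (simp add: infdist_pos_not_in_closed closed_Compl)
      then obtain n0 where n0: "1 < real n0 * infdist y (- U)"
        using reals_Archimedean3 by blast
      have "\<forall>\<^sub>F n in sequentially. h n y = 1"
        using eventually_ge_at_top[of n0]
      proof eventually_elim
        case (elim n)
        then have "real n0 * infdist y (- U) \<le> real n * infdist y (- U)"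
          by (intro mult_right_mono) (auto simp: infdist_nonneg)
        with n0 show ?case by (simp add: h_def)
      qed
      then show ?thesis
        using True by (simp add: tendsto_eventually)
    next
      case False
      then have "h n y = 0" for n
        by (simp add: h_def infdist_zero)
      then show ?thesis
        using False by simp
    qed
    have "(\<lambda>n. \<integral>z. f z * h n (circles z) \<partial>torus_measure) \<longlonglongrightarrow> (\<integral>z. f z * indicator U (circles z) \<partial>torus_measure)"
    proof (rule integral_dominated_convergence[where w = "\<lambda>z. \<bar>f z\<bar>"])
      show "AE z in torus_measure. (\<lambda>n. f z * h n (circles z)) \<longlonglongrightarrow> f z * indicator U (circles z)"
        by (intro AE_I2 tendsto_mult tendsto_const lim)
      show "AE z in torus_measure. norm (f z * h n (circles z)) \<le> \<bar>f z\<bar>" for n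
        by (intro AE_I2) (simp add: abs_mult h_def infdist_nonneg mult_left_le)
    qed (use f in \<open>auto\<close>)
    then show ?thesis
      by (simp add: cont[OF hc] LIMSEQ_const_iff)
  qed
  have pre: "circles -` B \<inter> space torus_measure \<in> sets torus_measure" if "B \<in> sets borel" for B
    using that by measurable
  have sint: "set_integrable torus_measure A f" if "A \<in> sets torus_measure" for A
    unfolding set_integrable_def using integrable_mult_indicator[OF that f] by simp
  have bor: "(LINT z : circles -` B \<inter> space torus_measure | torus_measure. f z) = 0" if "B \<in> sets borel" for B
  proof -
    have sb: "sets borel = sigma_sets UNIV {S :: (complex \<times> complex) set. open S}"
      by (simp add: borel_def)
    have opn: "(LINT z : circles -` U \<inter> space torus_measure | torus_measure. f z) = 0" if "open U" for U
    proof -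
      have "(LINT z : circles -` U \<inter> space torus_measure | torus_measure. f z)
        = (\<integral>z. f z * indicator U (circles z) \<partial>torus_measure)"
        unfolding set_lebesgue_integral_def
        by (intro Bochner_Integration.integral_cong) (auto simp: indicator_def)
      then show ?thesis
        using op[OF that] by simp
    qed
    have "Int_stable {S :: (complex \<times> complex) set. open S}"
      by (auto simp: Int_stable_def)
    moreover have "{S :: (complex \<times> complex) set. open S} \<subseteq> Pow UNIV"
      by simp
    moreover have "B \<in> sigma_sets UNIV {S. open S}"
      using that sb by simp
    ultimately show ?thesis
    proof (induction rule: sigma_sets_induct_disjoint)
      case (basic A)
      then show ?case by (intro opn) simp
    next
      case empty
      show ?case by (simp add: set_lebesgue_integral_def)
    next
      case (compl A)
      let ?A = "circles -` A \<inter> space torus_measure"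
      let ?C = "circles -` (UNIV - A) \<inter> space torus_measure"
      have b: "A \<in> sets borel"
        using compl(1) by (simp add: sb)
      then have "UNIV - A \<in> sets borel"
        by (intro sets.Diff) auto
      with b have A: "?A \<in> sets torus_measure" "?C \<in> sets torus_measure"
        by (blast intro: pre)+
      have "(LINT z : ?A \<union> ?C | torus_measure. f z)
        = (LINT z : ?A | torus_measure. f z) + (LINT z : ?C | torus_measure. f z)"
        by (rule set_integral_Un) (use A in \<open>auto intro!: sint simp del: space_torus_measure\<close>)
      moreover have "?A \<union> ?C = circles -` UNIV \<inter> space torus_measure"
        by auto
      ultimately show ?case
        using compl(2) opn[OF open_UNIV] by simp
    next
      case (union A)
      let ?A = "\<lambda>i. circles -` A i \<inter> space torus_measure"
      have A: "?A i \<in> sets torus_measure" for i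
        using union(2) by (intro pre) (auto simp: sb)
      have dis: "?A i \<inter> ?A j = {}" if "i \<noteq> j" for i j
        using union(1) that unfolding disjoint_family_on_def by blast
      have "(LINT z : (\<Union>i. ?A i) | torus_measure. f z) = (\<Sum>i. LINT z : ?A i | torus_measure. f z)"
        using A by (intro lebesgue_integral_countable_add dis sint sets.countable_UN) blast+
      moreover have "(\<Union>i. ?A i) = circles -` (\<Union>i. A i) \<inter> space torus_measure"
        by auto
      ultimately show ?case
        using union(3) by simp
    qed
  qed
  have all: "(LINT z : A | torus_measure. f z) = 0" if "A \<in> sets torus_measure" for A
  proof -
    \<comment> \<open>The inverse of \<open>circles\<close> on the fundamental square.\<close>
    define unwind where "unwind y = (angle (fst y), angle (snd y))" for y
    have bm [measurable]: "unwind \<in> borel_measurable borel"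
      unfolding unwind_def borel_prod[symmetric] by measurable
    have unwind: "unwind (circles z) = z" if "z \<in> space torus_measure" for z
      using that by (auto simp: unwind_def circles_def angle_cis)
    have "A \<in> (\<inter>) ({0..<2 * pi} \<times> {0..<2 * pi}) ` sets borel"
      using that by (simp only: sets_torus_measure sets_restrict_space)
    then obtain A' where A': "A' \<in> sets borel" "A = space torus_measure \<inter> A'"
      unfolding space_torus_measure by blast
    have "unwind -` A' \<in> sets borel"
      using measurable_sets[OF bm A'(1)] by simp
    moreover have "circles -` (unwind -` A') \<inter> space torus_measure = A"
    proof (intro set_eqI)
      fix z
      show "z \<in> circles -` (unwind -` A') \<inter> space torus_measure \<longleftrightarrow> z \<in> A"
        unfolding A'(2) Int_iff vimage_eq using unwind[of z] by metis
    qed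
    ultimately show ?thesis
      using bor by metis
  qed
  have "AE z in torus_measure. f z = (\<lambda>_. 0) z"
    by (rule density_unique_real) (use f all in \<open>auto simp: set_lebesgue_integral_def\<close>)
  then show ?thesis by simp
qed

section \<open>Calculus of smooth periodic functions\<close>

text \<open>
  The fundamental square differs from the closed square by a null set, so that Fubini's theorem for
  continuous functions on closed boxes computes the integral.
\<close>

lemma torus_integral_continuous:
  fixes f :: "real \<times> real \<Rightarrow> 'b::euclidean_space"
  assumes f: "continuous_on UNIV f"
  shows "integrable torus_measure f"
    and "(\<integral>z. f z \<partial>torus_measure) = integral {0..2 * pi} (\<lambda>s. integral {0..2 * pi} (\<lambda>t. f (s, t)))"
proof -
  let ?Q = "{0..<2 * pi} \<times> {0..<2 * pi} :: (real \<times> real) set"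
  let ?C = "cbox (0, 0) (2 * pi, 2 * pi) :: (real \<times> real) set"
  have QC: "?Q \<subseteq> ?C"
    by (auto simp: cbox_Pair_eq)
  have iC: "set_integrable lborel ?C f"
    unfolding set_integrable_def
    by (intro borel_integrable_compact continuous_on_subset[OF f]) auto
  have iQ: "set_integrable lborel ?Q f"
    by (rule set_integrable_subset[OF iC]) (use QC in auto)
  then show "integrable torus_measure f"
    unfolding torus_measure_def set_integrable_def
    by (subst integrable_restrict_space) auto
  have "(\<integral>z. f z \<partial>torus_measure) = (LINT z:?Q|lborel. f z)"
    unfolding torus_measure_def set_lebesgue_integral_def
    by (subst integral_restrict_space) auto
  also have "\<dots> = integral ?Q f"
    by (rule set_borel_integral_eq_integral[OF iQ])
  also have "\<dots> = integral ?C f"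
  proof (rule integral_spike_set)
    show "negligible {x \<in> ?Q - ?C. f x \<noteq> 0}"
      using QC by (simp add: Diff_eq_empty_iff[THEN iffD2])
    have "box (0, 0) (2 * pi, 2 * pi) \<subseteq> ?Q"
      by (auto simp: box_prod)
    then show "negligible {x \<in> ?C - ?Q. f x \<noteq> 0}"
      by (intro negligible_subset[OF negligible_frontier_interval[of "(0, 0)" "(2 * pi, 2 * pi) :: real \<times> real"]]) auto
  qed
  also have "\<dots> = integral (cbox 0 (2 * pi)) (\<lambda>s. integral (cbox 0 (2 * pi)) (\<lambda>t. f (s, t)))"
    by (intro integral_prod_continuous continuous_on_subset[OF f]) auto
  finally show "(\<integral>z. f z \<partial>torus_measure) = integral {0..2 * pi} (\<lambda>s. integral {0..2 * pi} (\<lambda>t. f (s, t)))"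
    by simp
qed

lemma continuous_square_integrable:
  fixes f :: "real \<times> real \<Rightarrow> 'b::euclidean_space"
  assumes "continuous_on UNIV f"
  shows "square_integrable f"
  unfolding square_integrable_def
  by (intro conjI continuous_imp_torus_measurable torus_integral_continuous(1) continuous_intros assms)

lemma
  assumes "f differentiable (at (s, t))"
  shows has_vector_derivative_partial1: "((\<lambda>x. f (x, t)) has_vector_derivative partial1 f (s, t)) (at s)"
    and has_vector_derivative_partial2: "((\<lambda>y. f (s, y)) has_vector_derivative partial2 f (s, t)) (at t)"
proof -
  obtain D where D: "(f has_derivative D) (at (s, t))"
    using assms by (auto simp: differentiable_def)
  have "((\<lambda>x. (x, t)) has_derivative (\<lambda>x. (x, 0))) (at s)"
    by (auto intro!: derivative_eq_intros)
  then have "((\<lambda>x. f (x, t)) has_derivative (\<lambda>x. D (x, 0))) (at s)"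
    by (rule has_derivative_compose) (use D in simp)
  then have "(\<lambda>x. f (x, t)) differentiable (at s)"
    by (auto simp: differentiable_def)
  then show "((\<lambda>x. f (x, t)) has_vector_derivative partial1 f (s, t)) (at s)"
    by (simp add: partial1_def vector_derivative_works)
  have "((\<lambda>y. (s, y)) has_derivative (\<lambda>y. (0, y))) (at t)"
    by (auto intro!: derivative_eq_intros)
  then have "((\<lambda>y. f (s, y)) has_derivative (\<lambda>y. D (0, y))) (at t)"
    by (rule has_derivative_compose) (use D in simp)
  then have "(\<lambda>y. f (s, y)) differentiable (at t)"
    by (auto simp: differentiable_def)
  then show "((\<lambda>y. f (s, y)) has_vector_derivative partial2 f (s, t)) (at t)"
    by (simp add: partial2_def vector_derivative_works)
qed

lemma partial1_eqI: "((\<lambda>x. f (x, t)) has_vector_derivative D) (at s) \<Longrightarrow> partial1 f (s, t) = D"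
  by (simp add: partial1_def vector_derivative_at)

lemma partial2_eqI: "((\<lambda>y. f (s, y)) has_vector_derivative D) (at t) \<Longrightarrow> partial2 f (s, t) = D"
  by (simp add: partial2_def vector_derivative_at)

lemma
  assumes "\<And>z. f differentiable (at z)" "\<And>z. g differentiable (at z)"
  shows partial1_add: "partial1 (\<lambda>z. f z + g z) = (\<lambda>z. partial1 f z + partial1 g z)"
    and partial2_add: "partial2 (\<lambda>z. f z + g z) = (\<lambda>z. partial2 f z + partial2 g z)"
  using assms
  by (auto intro!: ext partial1_eqI partial2_eqI has_vector_derivative_add
      has_vector_derivative_partial1 has_vector_derivative_partial2)

lemma
  fixes f g :: "real \<times> real \<Rightarrow> real"
  assumes "\<And>z. f differentiable (at z)" "\<And>z. g differentiable (at z)"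
  shows partial1_mult: "partial1 (\<lambda>z. f z * g z) = (\<lambda>z. f z * partial1 g z + partial1 f z * g z)"
    and partial2_mult: "partial2 (\<lambda>z. f z * g z) = (\<lambda>z. f z * partial2 g z + partial2 f z * g z)"
  using assms
  by (auto intro!: ext partial1_eqI partial2_eqI has_vector_derivative_mult
      has_vector_derivative_partial1 has_vector_derivative_partial2)

lemma
  assumes "bounded_linear L" "\<And>z. f differentiable (at z)"
  shows partial1_linear: "partial1 (\<lambda>z. L (f z)) = (\<lambda>z. L (partial1 f z))"
    and partial2_linear: "partial2 (\<lambda>z. L (f z)) = (\<lambda>z. L (partial2 f z))"
  using assms
  by (auto intro!: ext partial1_eqI partial2_eqI bounded_linear.has_vector_derivative[OF assms(1)]
      has_vector_derivative_partial1 has_vector_derivative_partial2)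

lemma Ck_add: "Ck k f \<Longrightarrow> Ck k g \<Longrightarrow> Ck k (\<lambda>z. f z + g z)"
proof (induction k arbitrary: f g)
  case 0
  then show ?case
    by (auto intro: continuous_on_add)
next
  case (Suc k)
  then have "f differentiable (at z)" "g differentiable (at z)" for z
    by (simp_all del: split_paired_All)
  with Suc show ?case
    by (simp add: partial1_add partial2_add)
qed

text \<open>
  Used for real scalar multiples and for real and imaginary parts.
\<close>

lemma Ck_linear: "bounded_linear L \<Longrightarrow> Ck k f \<Longrightarrow> Ck k (\<lambda>z. L (f z))"
proof (induction k arbitrary: f)
  case 0
  then show ?case
    by (auto intro: bounded_linear.continuous_on)
next
  case (Suc k)
  then have d: "f differentiable (at z)" for z
    by (simp del: split_paired_All)
  then have "(\<lambda>z. L (f z)) differentiable (at z)" for z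
    unfolding differentiable_def using bounded_linear.has_derivative[OF Suc.prems(1)] by blast
  with Suc d show ?case
    by (simp add: partial1_linear partial2_linear)
qed

lemma torus_smooth_add: "f \<in> torus_smooth \<Longrightarrow> g \<in> torus_smooth \<Longrightarrow> (\<lambda>z. f z + g z) \<in> torus_smooth"
  by (simp add: torus_smooth_def doubly_periodic_def Ck_add)

lemma torus_smooth_linear: "bounded_linear L \<Longrightarrow> f \<in> torus_smooth \<Longrightarrow> (\<lambda>z. L (f z)) \<in> torus_smooth"
  by (simp add: torus_smooth_def doubly_periodic_def Ck_linear)

lemma torus_smooth_differentiable: "f \<in> torus_smooth \<Longrightarrow> f differentiable (at z)"
proof -
  assume "f \<in> torus_smooth"
  then have "Ck (Suc 0) f"
    unfolding torus_smooth_def by blast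
  then show ?thesis by (simp del: split_paired_All)
qed

lemma torus_smooth_continuous: "f \<in> torus_smooth \<Longrightarrow> continuous_on UNIV f"
proof -
  assume "f \<in> torus_smooth"
  then have "Ck 0 f"
    unfolding torus_smooth_def by blast
  then show ?thesis by simp
qed

lemma torus_smooth_square_integrable:
  fixes f :: "real \<times> real \<Rightarrow> 'b::euclidean_space"
  shows "f \<in> torus_smooth \<Longrightarrow> square_integrable f"
  by (intro continuous_square_integrable torus_smooth_continuous)

lemma
  assumes f: "f \<in> torus_smooth"
  shows torus_smooth_partial1: "partial1 f \<in> torus_smooth"
    and torus_smooth_partial2: "partial2 f \<in> torus_smooth"
proof -
  have "Ck (Suc k) f" for k
    using f unfolding torus_smooth_def by blast
  then have Ck: "Ck k (partial1 f)" "Ck k (partial2 f)" for k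
    by simp_all
  have per: "f (s + 2 * pi, t) = f (s, t)" "f (s, t + 2 * pi) = f (s, t)" for s t
    using f by (auto simp: torus_smooth_def doubly_periodic_def)
  note d = torus_smooth_differentiable[OF f]
  have sh: "((\<lambda>x. x + 2 * pi) has_vector_derivative 1) (at x)" for x :: real
    by (auto intro!: derivative_eq_intros)
  have "partial1 f (s + 2 * pi, t) = partial1 f (s, t)" for s t
    using vector_diff_chain_at[OF sh has_vector_derivative_partial1[OF d]]
    by (intro partial1_eqI[of f t _ s, symmetric]) (simp add: o_def per)
  moreover have "partial1 f (s, t + 2 * pi) = partial1 f (s, t)" for s t
    using has_vector_derivative_partial1[OF d, where s = s and t = "t + 2 * pi"]
    by (intro partial1_eqI[of f t _ s, symmetric]) (simp add: per)
  ultimately show "partial1 f \<in> torus_smooth"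
    by (simp add: torus_smooth_def doubly_periodic_def Ck)
  have "partial2 f (s, t + 2 * pi) = partial2 f (s, t)" for s t
    using vector_diff_chain_at[OF sh has_vector_derivative_partial2[OF d]]
    by (intro partial2_eqI[of f s _ t, symmetric]) (simp add: o_def per)
  moreover have "partial2 f (s + 2 * pi, t) = partial2 f (s, t)" for s t
    using has_vector_derivative_partial2[OF d, where s = "s + 2 * pi" and t = t]
    by (intro partial2_eqI[of f s _ t, symmetric]) (simp add: per)
  ultimately show "partial2 f \<in> torus_smooth"
    by (simp add: torus_smooth_def doubly_periodic_def Ck)
qed

text \<open>
  The fundamental theorem of calculus along one circle; the boundary terms cancel by periodicity.
\<close>

lemma
  fixes f :: "real \<times> real \<Rightarrow> 'b::euclidean_space"
  assumes d: "\<And>z. f differentiable (at z)" and per: "doubly_periodic f"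
  shows integral_partial1_eq_0: "continuous_on UNIV (partial1 f) \<Longrightarrow> (\<integral>z. partial1 f z \<partial>torus_measure) = 0"
    and integral_partial2_eq_0: "continuous_on UNIV (partial2 f) \<Longrightarrow> (\<integral>z. partial2 f z \<partial>torus_measure) = 0"
proof -
  have p: "f (2 * pi, t) = f (0, t)" "f (s, 2 * pi) = f (s, 0)" for s t
    using per[unfolded doubly_periodic_def, rule_format, of 0 t]
      per[unfolded doubly_periodic_def, rule_format, of s 0] by simp_all
  {
    assume c: "continuous_on UNIV (partial1 f)"
    have "integral {0..2 * pi} (\<lambda>s. partial1 f (s, t)) = f (2 * pi, t) - f (0, t)" for t
      by (rule integral_unique, rule fundamental_theorem_of_calculus[where f = "\<lambda>s. f (s, t)"])
        (auto intro: has_vector_derivative_at_within has_vector_derivative_partial1 d)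
    moreover have "integral (cbox 0 (2 * pi)) (\<lambda>s. integral (cbox 0 (2 * pi)) (\<lambda>t. partial1 f (s, t)))
        = integral (cbox 0 (2 * pi)) (\<lambda>t. integral (cbox 0 (2 * pi)) (\<lambda>s. partial1 f (s, t)))"
      by (intro integral_swap_continuous) (simp add: continuous_on_subset[OF c])
    ultimately show "(\<integral>z. partial1 f z \<partial>torus_measure) = 0"
      by (simp add: torus_integral_continuous(2)[OF c] p)
  }
  {
    assume c: "continuous_on UNIV (partial2 f)"
    have "integral {0..2 * pi} (\<lambda>t. partial2 f (s, t)) = f (s, 2 * pi) - f (s, 0)" for s
      by (rule integral_unique, rule fundamental_theorem_of_calculus[where f = "\<lambda>t. f (s, t)"])
        (auto intro: has_vector_derivative_at_within has_vector_derivative_partial2 d)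
    then show "(\<integral>z. partial2 f z \<partial>torus_measure) = 0"
      by (simp add: torus_integral_continuous(2)[OF c] p)
  }
qed

lemma
  fixes f g :: "real \<times> real \<Rightarrow> real"
  assumes f: "f \<in> torus_smooth" and g: "g \<in> torus_smooth"
  shows by_parts1: "(\<integral>z. partial1 f z * g z \<partial>torus_measure) = - (\<integral>z. f z * partial1 g z \<partial>torus_measure)"
    and by_parts2: "(\<integral>z. partial2 f z * g z \<partial>torus_measure) = - (\<integral>z. f z * partial2 g z \<partial>torus_measure)"
proof -
  note d = torus_smooth_differentiable[OF f] torus_smooth_differentiable[OF g]
  note c = f[THEN torus_smooth_continuous] g[THEN torus_smooth_continuous]
    f[THEN torus_smooth_partial1, THEN torus_smooth_continuous]
    g[THEN torus_smooth_partial1, THEN torus_smooth_continuous]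
    f[THEN torus_smooth_partial2, THEN torus_smooth_continuous]
    g[THEN torus_smooth_partial2, THEN torus_smooth_continuous]
  have per: "doubly_periodic (\<lambda>z. f z * g z)"
    using f g by (simp add: torus_smooth_def doubly_periodic_def)
  have diff: "(\<lambda>z. f z * g z) differentiable (at z)" for z
    using d by (intro differentiable_mult)
  have "(\<integral>z. partial1 (\<lambda>z. f z * g z) z \<partial>torus_measure) = 0"
    by (rule integral_partial1_eq_0[OF diff per]) (unfold partial1_mult[OF d], intro continuous_intros c)
  also have "(\<integral>z. partial1 (\<lambda>z. f z * g z) z \<partial>torus_measure)
      = (\<integral>z. f z * partial1 g z \<partial>torus_measure) + (\<integral>z. partial1 f z * g z \<partial>torus_measure)"
    unfolding partial1_mult[OF d]
    by (intro Bochner_Integration.integral_add torus_integral_continuous(1) continuous_intros c)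
  finally show "(\<integral>z. partial1 f z * g z \<partial>torus_measure) = - (\<integral>z. f z * partial1 g z \<partial>torus_measure)"
    by simp
  have "(\<integral>z. partial2 (\<lambda>z. f z * g z) z \<partial>torus_measure) = 0"
    by (rule integral_partial2_eq_0[OF diff per]) (unfold partial2_mult[OF d], intro continuous_intros c)
  also have "(\<integral>z. partial2 (\<lambda>z. f z * g z) z \<partial>torus_measure)
      = (\<integral>z. f z * partial2 g z \<partial>torus_measure) + (\<integral>z. partial2 f z * g z \<partial>torus_measure)"
    unfolding partial2_mult[OF d]
    by (intro Bochner_Integration.integral_add torus_integral_continuous(1) continuous_intros c)
  finally show "(\<integral>z. partial2 f z * g z \<partial>torus_measure) = - (\<integral>z. f z * partial2 g z \<partial>torus_measure)"
    by simp
qed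

text \<open>
  The set where two continuous functions differ is open, and a nonempty open set is not a null set.
  The operator \<open>d_star\<close> is defined through a smooth representative, so this makes it computable.
\<close>

lemma smooth_representative_unique:
  fixes f g :: "real \<times> real \<Rightarrow> 'b::euclidean_space"
  assumes f: "f \<in> torus_smooth" and g: "g \<in> torus_smooth" and eq: "l2_class f = l2_class g"
  shows "f = g"
proof -
  have ls: "l2_eq f f" "l2_eq g g"
    using f g by (auto simp: l2_eq_def torus_smooth_square_integrable)
  have "l2_eq f g"
    using Quotient_rel[OF Quotient_torus_l2, of f g] ls eq by blast
  then have ae: "AE z in torus_measure. f z = g z"
    by (simp add: l2_eq_def)
  let ?Q = "{0..<2 * pi} \<times> {0..<2 * pi} :: (real \<times> real) set"
  have ae': "AE z in lborel. z \<in> ?Q \<longrightarrow> f z = g z"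
    using ae unfolding torus_measure_def by (subst (asm) AE_restrict_space_iff) auto
  \<comment> \<open>Equality spreads from the open square to its closure by continuity, and from there to the plane by
    periodicity.\<close>
  have inside: "f z = g z" if z: "z \<in> box (0, 0) (2 * pi, 2 * pi)" for z
  proof (rule ccontr)
    assume ne: "f z \<noteq> g z"
    define U where "U = {w. f w \<noteq> g w} \<inter> box (0, 0) (2 * pi, 2 * pi)"
    have "open U"
      unfolding U_def
      by (intro open_Int open_box open_Collect_neq torus_smooth_continuous f g)
    moreover have "z \<in> U"
      using ne z by (simp add: U_def)
    moreover have "U \<in> null_sets lborel"
    proof -
      have "AE w in lborel. w \<notin> U"
        using ae' by eventually_elim (auto simp: U_def box_prod)
      then show ?thesis
        using \<open>open U\<close> by (subst (asm) AE_iff_null_sets[symmetric]) auto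
    qed
    then have "negligible U"
      by (simp add: negligible_iff_null_sets null_sets_completionI)
    ultimately show False
      using open_not_negligible by blast
  qed
  have closed: "f z = g z" if z: "z \<in> cbox (0, 0) (2 * pi, 2 * pi)" for z
  proof -
    have "closed {w. f w = g w}"
      by (intro closed_Collect_eq torus_smooth_continuous f g)
    moreover have "box (0, 0) (2 * pi, 2 * pi) \<subseteq> {w. f w = g w}"
      using inside by auto
    ultimately have "closure (box (0, 0) (2 * pi, 2 * pi)) \<subseteq> {w. f w = g w}"
      by (intro closure_minimal)
    moreover have "(pi, pi) \<in> box (0, 0) (2 * pi, 2 * pi)"
      by (simp add: box_prod)
    then have "box (0, 0) (2 * pi, 2 * pi :: real) \<noteq> ({} :: (real \<times> real) set)"
      by blast
    ultimately show ?thesis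
      using z by (auto simp: closure_box)
  qed
  have shift: "h (s + of_int k * (2 * pi), t + of_int m * (2 * pi)) = h (s, t)"
    if h: "h \<in> torus_smooth" for h :: "real \<times> real \<Rightarrow> 'b" and k m s t
  proof -
    have p1: "h (s + 2 * pi, t) = h (s, t)" and p2: "h (s, t + 2 * pi) = h (s, t)" for s t
      using h by (auto simp: torus_smooth_def doubly_periodic_def)
    have "h (s + of_int k * (2 * pi), t) = h (s, t)" for s t
    proof (induction k rule: int_induct[of _ 0])
      case (step1 i)
      then show ?case
        using p1[of "s + of_int i * (2 * pi)" t] by (simp add: algebra_simps)
    next
      case (step2 i)
      then show ?case
        using p1[of "s + of_int (i - 1) * (2 * pi)" t] by (simp add: algebra_simps)
    qed simp
    moreover have "h (s, t + of_int m * (2 * pi)) = h (s, t)" for s t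
    proof (induction m rule: int_induct[of _ 0])
      case (step1 i)
      then show ?case
        using p2[of s "t + of_int i * (2 * pi)"] by (simp add: algebra_simps)
    next
      case (step2 i)
      then show ?case
        using p2[of s "t + of_int (i - 1) * (2 * pi)"] by (simp add: algebra_simps)
    qed simp
    ultimately show ?thesis
      by simp
  qed
  show "f = g"
  proof
    fix z :: "real \<times> real"
    obtain s t where z: "z = (s, t)" by (cases z)
    have red: "\<exists>k::int. 0 \<le> s + of_int k * (2 * pi) \<and> s + of_int k * (2 * pi) \<le> 2 * pi" for s
    proof -
      have "of_int \<lfloor>s / (2 * pi)\<rfloor> * (2 * pi) \<le> s"
        using of_int_floor_le[of "s / (2 * pi)"] pi_gt_zero by (subst (asm) pos_le_divide_eq) auto
      moreover have "s \<le> (of_int \<lfloor>s / (2 * pi)\<rfloor> + 1) * (2 * pi)"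
        using real_of_int_floor_add_one_ge[of "s / (2 * pi)"] pi_gt_zero
        by (subst (asm) pos_divide_le_eq) auto
      ultimately show ?thesis
        by (intro exI[of _ "- \<lfloor>s / (2 * pi)\<rfloor>"]) (simp add: algebra_simps)
    qed
    obtain k m :: int where "0 \<le> s + of_int k * (2 * pi)" "s + of_int k * (2 * pi) \<le> 2 * pi"
      "0 \<le> t + of_int m * (2 * pi)" "t + of_int m * (2 * pi) \<le> 2 * pi"
      using red[of s] red[of t] by blast
    then have "f (s + of_int k * (2 * pi), t + of_int m * (2 * pi))
        = g (s + of_int k * (2 * pi), t + of_int m * (2 * pi))"
      by (intro closed) (auto simp: cbox_Pair_eq)
    then show "f z = g z"
      by (simp add: z shift[OF f] shift[OF g])
  qed
qed

subsection \<open>Characters\<close>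

lemma has_vector_derivative_cis:
  "(u has_real_derivative u') (at x) \<Longrightarrow>
   ((\<lambda>x. c * cis (u x)) has_vector_derivative (c * (\<i> * of_real u')) * cis (u x)) (at x)"
proof -
  assume u: "(u has_real_derivative u') (at x)"
  have "((\<lambda>y. exp (\<i> * of_real y)) has_vector_derivative \<i> * exp (\<i> * of_real (u x))) (at (u x))"
    by (auto intro!: derivative_eq_intros has_vector_derivative_real_field)
  from vector_diff_chain_at[OF u[unfolded has_real_derivative_iff_has_vector_derivative] this]
  have "((\<lambda>x. cis (u x)) has_vector_derivative u' *\<^sub>R (\<i> * cis (u x))) (at x)"
    by (simp add: o_def cis_conv_exp)
  from has_vector_derivative_mult_right[OF this, of c] show ?thesis
    by (simp add: scaleR_conv_of_real ac_simps)
qed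

lemma
  shows partial1_tchar: "partial1 (\<lambda>z. c * tchar x z) = (\<lambda>z. (c * (\<i> * of_int (fst x))) * tchar x z)"
    and partial2_tchar: "partial2 (\<lambda>z. c * tchar x z) = (\<lambda>z. (c * (\<i> * of_int (snd x))) * tchar x z)"
proof -
  have "((\<lambda>s. of_int (fst x) * s + of_int (snd x) * t) has_real_derivative of_int (fst x)) (at s)" for s t :: real
    by (auto intro!: derivative_eq_intros)
  from has_vector_derivative_cis[OF this, of c]
  show "partial1 (\<lambda>z. c * tchar x z) = (\<lambda>z. (c * (\<i> * of_int (fst x))) * tchar x z)"
    by (auto intro!: ext partial1_eqI simp: tchar_def)
  have "((\<lambda>t. of_int (fst x) * s + of_int (snd x) * t) has_real_derivative of_int (snd x)) (at t)" for s t :: real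
    by (auto intro!: derivative_eq_intros)
  from has_vector_derivative_cis[OF this, of c]
  show "partial2 (\<lambda>z. c * tchar x z) = (\<lambda>z. (c * (\<i> * of_int (snd x))) * tchar x z)"
    by (auto intro!: ext partial2_eqI simp: tchar_def)
qed

lemma tchar_differentiable: "(\<lambda>z. c * tchar x z) differentiable (at z)"
proof -
  have "tchar x = (\<lambda>z. of_real (cos (of_int (fst x) * fst z + of_int (snd x) * snd z))
      + \<i> * of_real (sin (of_int (fst x) * fst z + of_int (snd x) * snd z)))"
    by (auto simp: tchar_def fun_eq_iff complex_eq_iff)
  then show ?thesis
    unfolding differentiable_def by (auto intro!: derivative_eq_intros exI)
qed

lemma tchar_smooth: "(\<lambda>z. c * tchar x z) \<in> torus_smooth"
proof -
  have "Ck k (\<lambda>z. c * tchar x z)" for k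
  proof (induction k arbitrary: c)
    case 0
    show ?case by (auto intro!: continuous_intros)
  next
    case (Suc k)
    then show ?case
      by (simp only: Ck.simps partial1_tchar partial2_tchar) (intro conjI allI tchar_differentiable; simp)
  qed
  moreover have "tchar x (s + 2 * pi, t) = tchar x (s, t)" for s t
  proof -
    have "tchar x (s + 2 * pi, t) = tchar x (s, t) * cis (2 * pi * of_int (fst x))"
      by (simp add: tchar_def cis_mult algebra_simps)
    then show ?thesis by (simp add: cis_multiple_2pi)
  qed
  moreover have "tchar x (s, t + 2 * pi) = tchar x (s, t)" for s t
  proof -
    have "tchar x (s, t + 2 * pi) = tchar x (s, t) * cis (2 * pi * of_int (snd x))"
      by (simp add: tchar_def cis_mult algebra_simps)
    then show ?thesis by (simp add: cis_multiple_2pi)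
  qed
  ultimately show ?thesis
    by (simp add: torus_smooth_def doubly_periodic_def)
qed

lemma laplacian_tchar:
  "laplacian (\<lambda>z. c * tchar x z) = (\<lambda>z. (- of_int ((fst x)\<^sup>2 + (snd x)\<^sup>2) * c) * tchar x z)"
  unfolding laplacian_def partial1_tchar partial2_tchar
  by (simp add: fun_eq_iff algebra_simps power2_eq_square)

text \<open>
  A nontrivial character is, up to a nonzero factor, one of its own partial derivatives, and these have
  integral zero.
\<close>

lemma integral_tchar: "(\<integral>z. tchar x z \<partial>torus_measure) = (if x = 0 then 4 * pi\<^sup>2 else 0)"
proof (cases "x = 0")
  case True
  then have "tchar x = (\<lambda>_. 1)"
    by (simp add: fun_eq_iff)
  then show ?thesis
    using True torus_integral_continuous(2)[of "\<lambda>_. 1 :: complex"]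
    by (simp add: power2_eq_square scaleR_conv_of_real)
next
  case False
  have sm: "(\<lambda>z. 1 * tchar x z) \<in> torus_smooth"
    by (rule tchar_smooth)
  have per: "doubly_periodic (\<lambda>z. 1 * tchar x z)"
    using sm by (simp add: torus_smooth_def)
  have "(\<integral>z. (1 * (\<i> * of_int (fst x))) * tchar x z \<partial>torus_measure) = 0"
    using integral_partial1_eq_0[OF torus_smooth_differentiable[OF sm] per]
      torus_smooth_continuous[OF torus_smooth_partial1[OF sm]]
    unfolding partial1_tchar by blast
  moreover have "(\<integral>z. (1 * (\<i> * of_int (snd x))) * tchar x z \<partial>torus_measure) = 0"
    using integral_partial2_eq_0[OF torus_smooth_differentiable[OF sm] per]
      torus_smooth_continuous[OF torus_smooth_partial2[OF sm]]
    unfolding partial2_tchar by blast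
  ultimately show ?thesis
    using False by (auto simp: prod_eq_iff)
qed

section \<open>The complex inner product\<close>

lemma integrable_cnj_mult:
  assumes f: "square_integrable f" and g: "square_integrable g"
  shows "integrable torus_measure (\<lambda>z. cnj (f z) * g z :: complex)"
proof (rule Bochner_Integration.integrable_bound)
  have [measurable]: "f \<in> borel_measurable torus_measure" "g \<in> borel_measurable torus_measure"
    using f g by (auto simp: square_integrable_def)
  have [measurable]: "cnj \<in> borel_measurable borel"
    by (intro borel_measurable_continuous_onI continuous_intros)
  show "(\<lambda>z. cnj (f z) * g z) \<in> borel_measurable torus_measure"
    by measurable
  show "integrable torus_measure (\<lambda>z. (norm (f z))\<^sup>2 + (norm (g z))\<^sup>2)"
    using f g by (auto simp: square_integrable_def)
  have "norm (cnj a * b) \<le> (norm a)\<^sup>2 + (norm b)\<^sup>2" for a b :: complex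
    using sum_squares_bound[of "norm a" "norm b"] mult_nonneg_nonneg[OF norm_ge_zero[of a] norm_ge_zero[of b]]
    unfolding norm_mult complex_mod_cnj by linarith
  then show "AE z in torus_measure. norm (cnj (f z) * g z) \<le> norm ((norm (f z))\<^sup>2 + (norm (g z))\<^sup>2)"
    by (intro AE_I2) (simp add: abs_of_nonneg)
qed

lemma cinner_class:
  "square_integrable f \<Longrightarrow> square_integrable g \<Longrightarrow>
   cinner (l2_class f) (l2_class g) = (\<integral>z. cnj (f z) * g z \<partial>torus_measure)"
  by (subst cinner.abs_eq) (auto simp: l2_eq_def)

lemma inner_eq_Re_cinner: "f \<bullet> g = Re (cinner f g)"
proof transfer
  fix f g :: "real \<times> real \<Rightarrow> complex"
  assume "l2_eq f f" "l2_eq g g"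
  then have "integrable torus_measure (\<lambda>z. cnj (f z) * g z)"
    by (simp add: l2_eq_def integrable_cnj_mult)
  from integral_Re[OF this] show "(\<integral>z. f z \<bullet> g z \<partial>torus_measure) = Re (\<integral>z. cnj (f z) * g z \<partial>torus_measure)"
    by (simp add: inner_complex_def)
qed

lemma cinner_add_right: "cinner f (g + h) = cinner f g + cinner f h"
  by transfer (auto simp: l2_eq_def distrib_left integrable_cnj_mult)

lemma cinner_cscale_right: "cinner f (c *\<^sub>C g) = c * cinner f g"
proof transfer
  fix f g :: "real \<times> real \<Rightarrow> complex" and c
  assume "l2_eq f f" "l2_eq g g"
  show "(\<integral>z. cnj (f z) * (c * g z) \<partial>torus_measure) = c * (\<integral>z. cnj (f z) * g z \<partial>torus_measure)"
    unfolding mult.left_commute[of _ c] by (rule integral_mult_right_zero)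
qed

lemma cnj_cinner: "cnj (cinner f g) = cinner g f"
  by transfer (simp only: Bochner_Integration.integral_cnj[symmetric] complex_cnj_mult complex_cnj_cnj mult.commute)

lemma cinner_add_left: "cinner (f + g) h = cinner f h + cinner g h"
  using arg_cong[OF cinner_add_right[of h f g], of cnj] by (simp add: cnj_cinner)

lemma cinner_cscale_left: "cinner (c *\<^sub>C f) g = cnj c * cinner f g"
  using arg_cong[OF cinner_cscale_right[of g c f], of cnj] by (simp add: cnj_cinner)

lemma cinner_self: "cinner f f = of_real ((norm f)\<^sup>2)"
  using cnj_cinner[of f f] by (simp add: complex_eq_iff power2_norm_eq_inner inner_eq_Re_cinner)

lemma scaleR_eq_cscale: "r *\<^sub>R f = complex_of_real r *\<^sub>C f"
  by transfer (auto simp: l2_eq_def square_integrable_scaleR scaleR_conv_of_real square_integrable_mult_left)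

lemma norm_cscale: "norm (c *\<^sub>C f) = cmod c * norm f"
proof -
  have "complex_of_real ((norm (c *\<^sub>C f))\<^sup>2) = of_real ((cmod c * norm f)\<^sup>2)"
  proof -
    have "complex_of_real ((norm (c *\<^sub>C f))\<^sup>2) = (c * cnj c) * cinner f f"
      unfolding cinner_self[symmetric] by (simp add: cinner_cscale_left cinner_cscale_right)
    also have "\<dots> = of_real ((cmod c)\<^sup>2 * (norm f)\<^sup>2)"
      unfolding complex_norm_square[symmetric] cinner_self by (simp only: of_real_mult)
    finally show ?thesis
      by (simp only: power_mult_distrib)
  qed
  then have "(norm (c *\<^sub>C f))\<^sup>2 = (cmod c * norm f)\<^sup>2"
    by (simp only: of_real_eq_iff)
  then show ?thesis
    by (simp add: power2_eq_iff_nonneg)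
qed

text \<open>
  Rotating \<open>g\<close> by the phase of \<open>cinner f g\<close> reduces this to the Cauchy--Schwarz inequality of
  the real inner product.
\<close>

lemma norm_cinner_le: "cmod (cinner f g) \<le> norm f * norm g"
proof (cases "cinner f g = 0")
  case True
  then show ?thesis by simp
next
  case False
  \<comment> \<open>The unimodular factor that makes \<open>u * cinner f g\<close> equal to the modulus of \<open>cinner f g\<close>.\<close>
  define u where "u = cnj (cinner f g) / cmod (cinner f g)"
  have "cmod (cinner f g) = Re (u * cinner f g)"
  proof -
    have "u * cinner f g = (cinner f g * cnj (cinner f g)) / cmod (cinner f g)"
      by (simp add: u_def)
    also have "\<dots> = complex_of_real ((cmod (cinner f g))\<^sup>2 / cmod (cinner f g))"
      unfolding complex_norm_square[symmetric] by (simp only: of_real_divide)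
    finally show ?thesis
      using False by (simp add: power2_eq_square)
  qed
  also have "\<dots> = f \<bullet> (u *\<^sub>C g)"
    by (simp add: inner_eq_Re_cinner cinner_cscale_right)
  also have "\<dots> \<le> norm f * norm (u *\<^sub>C g)"
    by (rule norm_cauchy_schwarz)
  also have "norm (u *\<^sub>C g) = norm g"
    using False by (simp add: norm_cscale u_def norm_divide)
  finally show ?thesis .
qed

lemma bounded_linear_cinner_right: "bounded_linear (cinner f)"
  by (rule bounded_linear_intro[where K = "norm f"])
    (simp_all add: cinner_add_right scaleR_eq_cscale cinner_cscale_right scaleR_conv_of_real
      norm_cinner_le mult.commute[of _ "norm f"])

lemma bounded_linear_cinner_left: "bounded_linear (\<lambda>f. cinner f g)"
  by (rule bounded_linear_intro[where K = "norm g"])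
    (simp_all add: cinner_add_left scaleR_eq_cscale cinner_cscale_left scaleR_conv_of_real norm_cinner_le)

lemma cinner_diff_right: "cinner f (g - h) = cinner f g - cinner f h"
  by (rule linear_diff[OF bounded_linear.linear[OF bounded_linear_cinner_right]])

lemma cinner_zero [simp]: "cinner f 0 = 0" "cinner 0 f = 0"
  using linear_0[OF bounded_linear.linear[OF bounded_linear_cinner_right]]
    linear_0[OF bounded_linear.linear[OF bounded_linear_cinner_left]] by blast+

lemma l2_eqI: "(\<And>h. cinner h f = cinner h g) \<Longrightarrow> f = g"
proof -
  assume "\<And>h. cinner h f = cinner h g"
  then have "cinner (f - g) (f - g) = 0"
    by (simp add: cinner_diff_right)
  then show ?thesis
    by (simp add: cinner_self)
qed

section \<open>Orthogonal series\<close>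

lemma norm_sum_orthogonal:
  fixes v :: "'i \<Rightarrow> 'a::real_inner"
  assumes "finite F" "\<And>x y. x \<in> F \<Longrightarrow> y \<in> F \<Longrightarrow> x \<noteq> y \<Longrightarrow> v x \<bullet> v y = 0"
  shows "(norm (\<Sum>x\<in>F. v x))\<^sup>2 = (\<Sum>x\<in>F. (norm (v x))\<^sup>2)"
  using assms by (intro norm_sum_Pythagorean) (auto simp: pairwise_def orthogonal_def)

text \<open>
  By Pythagoras, the distance of two finite partial sums is controlled by the tail of the series of
  squared norms, so the partial sums form a Cauchy net.
\<close>

lemma orthogonal_series_summable:
  fixes v :: "'i \<Rightarrow> 'a::{real_inner, banach}"
  assumes orth: "\<And>x y. x \<noteq> y \<Longrightarrow> v x \<bullet> v y = 0"
    and sq: "(\<lambda>x. (norm (v x))\<^sup>2) summable_on UNIV"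
  shows "v summable_on UNIV"
proof -
  have pyth: "(norm (sum v F))\<^sup>2 = (\<Sum>x\<in>F. (norm (v x))\<^sup>2)" if "finite F" for F
    using that orth by (intro norm_sum_orthogonal) auto
  define Q where "Q F = (\<Sum>x\<in>F. (norm (v x))\<^sup>2)" for F
  define T where "T = (\<Sum>\<^sub>\<infinity>x. (norm (v x))\<^sup>2)"
  have QT: "(Q \<longlongrightarrow> T) (finite_subsets_at_top UNIV)"
    using has_sum_infsum[OF sq] unfolding has_sum_def Q_def[abs_def] T_def .
  have "cauchy_filter (filtermap (sum v) (finite_subsets_at_top UNIV))"
    unfolding cauchy_filter_metric_filtermap
  proof (intro allI impI)
    fix e :: real
    assume e: "e > 0"
    have "\<forall>\<^sub>F F in finite_subsets_at_top UNIV. dist (Q F) T < (e / 2)\<^sup>2 / 2"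
      using e by (intro tendstoD[OF QT]) simp
    then obtain F0 where F0: "finite F0"
      and near: "\<And>F. finite F \<Longrightarrow> F0 \<subseteq> F \<Longrightarrow> dist (Q F) T < (e / 2)\<^sup>2 / 2"
      by (auto simp: eventually_finite_subsets_at_top)
    have close: "norm (sum v F - sum v F0) < e / 2" if F: "finite F" "F0 \<subseteq> F" for F
    proof -
      have "sum v F - sum v F0 = sum v (F - F0)"
        using F by (simp add: sum_diff)
      then have "(norm (sum v F - sum v F0))\<^sup>2 = Q (F - F0)"
        using F by (simp add: pyth Q_def)
      also have "\<dots> = Q F - Q F0"
        using F by (simp add: Q_def sum_diff)
      also have "\<dots> < (e / 2)\<^sup>2"
        using near[OF F] near[OF F0 order_refl] unfolding dist_real_def abs_less_iff by linarith
      finally show ?thesis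
        using e by (auto dest: power2_less_imp_less)
    qed
    show "\<exists>P. eventually P (finite_subsets_at_top UNIV) \<and>
        (\<forall>x y. P x \<and> P y \<longrightarrow> dist (sum v x) (sum v y) < e)"
    proof (intro exI conjI allI impI)
      show "\<forall>\<^sub>F F in finite_subsets_at_top UNIV. finite F \<and> F0 \<subseteq> F"
        using F0 by (auto simp: eventually_finite_subsets_at_top)
      fix F G
      assume "(finite F \<and> F0 \<subseteq> F) \<and> (finite G \<and> F0 \<subseteq> G)"
      then have "norm (sum v F - sum v F0) < e / 2" "norm (sum v G - sum v F0) < e / 2"
        using close by auto
      then show "dist (sum v F) (sum v G) < e"
        unfolding dist_norm by (rule norm_triangle_half_l)
    qed
  qed
  moreover have "complete (UNIV :: 'a set)"
    by (simp add: complete_UNIV)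
  moreover have "filtermap (sum v) (finite_subsets_at_top UNIV) \<noteq> bot"
    by (simp add: filtermap_bot_iff)
  ultimately obtain l where "filtermap (sum v) (finite_subsets_at_top UNIV) \<le> nhds l"
    using cauchy_filter_complete_converges[of "filtermap (sum v) (finite_subsets_at_top UNIV)" UNIV]
    by auto
  then show ?thesis
    by (auto simp: summable_on_def has_sum_def filterlim_def)
qed

definition texp :: "int \<times> int \<Rightarrow> complex torus_l2" where
  "texp x = torus_exp (fst x) (snd x)"

lemma texp_class: "texp x = l2_class (\<lambda>z. 1 / (2 * pi) * tchar x z)"
  unfolding texp_def torus_exp_def
  by (rule arg_cong[where f = l2_class]) (auto simp: tchar_def cis_conv_exp exp_add[symmetric] algebra_simps)

lemma cscale_texp: "c *\<^sub>C texp x = l2_class (\<lambda>z. c / (2 * pi) * tchar x z)"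
proof -
  have "l2_eq (\<lambda>z. 1 / (2 * pi) * tchar x z) (\<lambda>z. 1 / (2 * pi) * tchar x z)"
    unfolding l2_eq_def by (intro conjI torus_smooth_square_integrable tchar_smooth AE_I2 refl)
  from cscale.abs_eq[OF this] show ?thesis
    by (simp add: texp_class)
qed

lemma cinner_texp: "cinner (texp x) (texp y) = (if x = y then 1 else 0)"
proof -
  have sq: "square_integrable (\<lambda>z. 1 / (2 * pi) * tchar x z)" for x
    by (intro torus_smooth_square_integrable tchar_smooth)
  have "cinner (texp x) (texp y) = (\<integral>z. 1 / (4 * pi\<^sup>2) * tchar (y - x) z \<partial>torus_measure)"
    unfolding texp_class cinner_class[OF sq sq]
    by (intro Bochner_Integration.integral_cong refl)
      (simp add: cnj_tchar tchar_mult power2_eq_square)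
  also have "\<dots> = 1 / (4 * pi\<^sup>2) * (\<integral>z. tchar (y - x) z \<partial>torus_measure)"
    by (rule integral_mult_right_zero)
  finally show ?thesis
    by (simp add: integral_tchar)
qed

text \<open>
  The real and the imaginary part of \<open>f\<close> are combinations of \<open>f\<close> and its conjugate, so their
  Fourier coefficients vanish too, and the totality result for real functions applies to both.
\<close>

lemma eq_0_of_fourier_eq_0:
  assumes zero: "\<And>x. cinner (texp x) f = 0"
  shows "f = 0"
proof -
  obtain F where F: "square_integrable F" and f: "f = l2_class F"
    using l2_class_surj by blast
  have Fm [measurable]: "F \<in> borel_measurable torus_measure"
    using F by (simp add: square_integrable_def)
  have int: "integrable torus_measure (\<lambda>z. F z * tchar x z)" for x
  proof -
    have "integrable torus_measure (\<lambda>z. cnj (1 * tchar (- x) z) * F z)"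
      by (intro integrable_cnj_mult torus_smooth_square_integrable tchar_smooth F)
    then show ?thesis
      by (simp add: cnj_tchar mult.commute)
  qed
  have F0: "(\<integral>z. F z * tchar x z \<partial>torus_measure) = 0" for x
  proof -
    have "0 = (\<integral>z. cnj (1 / (2 * pi) * tchar (- x) z) * F z \<partial>torus_measure)"
      using zero[of "- x"] unfolding f texp_class
      by (subst (asm) cinner_class[OF torus_smooth_square_integrable[OF tchar_smooth] F]) simp
    also have "\<dots> = (\<integral>z. 1 / (2 * pi) * (F z * tchar x z) \<partial>torus_measure)"
      by (intro Bochner_Integration.integral_cong refl) (simp add: cnj_tchar)
    also have "\<dots> = 1 / (2 * pi) * (\<integral>z. F z * tchar x z \<partial>torus_measure)"
      by (rule integral_mult_right_zero)
    finally show ?thesis by simp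
  qed
  have cF0: "(\<integral>z. cnj (F z) * tchar x z \<partial>torus_measure) = 0" for x
    using arg_cong[OF F0[of "- x"], of cnj]
    unfolding Bochner_Integration.integral_cnj[symmetric] by (simp add: cnj_tchar)
  have int': "integrable torus_measure (\<lambda>z. cnj (F z) * tchar x z)" for x
    using integrable_cnj[of torus_measure "\<lambda>z. F z * tchar (- x) z"] int[of "- x"]
    by (simp add: cnj_tchar)
  have iF: "integrable torus_measure F"
    using int[of 0] by simp
  have "AE z in torus_measure. Re (F z) = 0"
  proof (rule AE_zero_of_Fourier_zero)
    fix x
    have "(\<integral>z. complex_of_real (Re (F z)) * tchar x z \<partial>torus_measure)
        = (\<integral>z. 1 / 2 * (F z * tchar x z + cnj (F z) * tchar x z) \<partial>torus_measure)"
      by (intro Bochner_Integration.integral_cong refl)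
        (simp add: complex_add_cnj distrib_right[symmetric])
    then show "(\<integral>z. complex_of_real (Re (F z)) * tchar x z \<partial>torus_measure) = 0"
      by (simp add: int int' F0 cF0)
  qed (use iF in simp)
  moreover have "AE z in torus_measure. Im (F z) = 0"
  proof (rule AE_zero_of_Fourier_zero)
    fix x
    have pt: "complex_of_real (Im a) * t = 1 / (2 * \<i>) * (a * t - cnj a * t)" for a t
    proof -
      have "a * t - cnj a * t = (2 * \<i>) * (complex_of_real (Im a) * t)"
        by (simp add: complex_eq_iff algebra_simps)
      then show ?thesis by simp
    qed
    have "(\<integral>z. complex_of_real (Im (F z)) * tchar x z \<partial>torus_measure)
        = (\<integral>z. 1 / (2 * \<i>) * (F z * tchar x z - cnj (F z) * tchar x z) \<partial>torus_measure)"
      by (intro Bochner_Integration.integral_cong refl pt)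
    also have "\<dots> = 1 / (2 * \<i>) * (\<integral>z. F z * tchar x z - cnj (F z) * tchar x z \<partial>torus_measure)"
      by (rule integral_mult_right_zero)
    finally show "(\<integral>z. complex_of_real (Im (F z)) * tchar x z \<partial>torus_measure) = 0"
      by (simp add: int int' F0 cF0)
  qed (use iF in simp)
  ultimately have "AE z in torus_measure. F z = 0"
    by eventually_elim (simp add: complex_eq_iff)
  then have "l2_eq F (\<lambda>_. 0)"
    by (simp add: l2_eq_def F square_integrable_0)
  then show ?thesis
    unfolding f zero_torus_l2_def by (metis Quotient_rel_abs Quotient_torus_l2)
qed

lemma eq_of_fourier_eq: "(\<And>x. cinner (texp x) f = cinner (texp x) g) \<Longrightarrow> f = g"
  using eq_0_of_fourier_eq_0[of "f - g"] by (simp add: cinner_diff_right)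

text \<open>
  Stated for families, so that it covers the characters as well as a finite part of an arbitrary
  orthonormal basis (the identity family).
\<close>

definition orthonormal_on :: "'i set \<Rightarrow> ('i \<Rightarrow> complex torus_l2) \<Rightarrow> bool" where
  "orthonormal_on F v \<longleftrightarrow> (\<forall>x\<in>F. \<forall>y\<in>F. cinner (v x) (v y) = (if x = y then 1 else 0))"

lemma cinner_sum_right: "cinner f (\<Sum>x\<in>F. g x) = (\<Sum>x\<in>F. cinner f (g x))"
  by (rule linear_sum[OF bounded_linear.linear[OF bounded_linear_cinner_right]])

text \<open>
  Both facts come from the orthogonal projection of \<open>f\<close> to the span of the family: Pythagoras splits
  \<open>f\<close> into the projection and the rest, and the rest is orthogonal to every difference of
  the projection and another combination.
\<close>

lemma
  assumes F: "finite F" and v: "orthonormal_on F v"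
  shows bessel_inequality: "(\<Sum>x\<in>F. (cmod (cinner (v x) f))\<^sup>2) \<le> (norm f)\<^sup>2"
    and projection_best_approximation: "(norm f)\<^sup>2 - (\<Sum>x\<in>F. (cmod (cinner (v x) f))\<^sup>2) \<le> (norm (f - (\<Sum>x\<in>F. a x *\<^sub>C v x)))\<^sup>2"
proof -
  let ?p = "\<Sum>x\<in>F. cinner (v x) f *\<^sub>C v x" and ?h = "\<Sum>x\<in>F. a x *\<^sub>C v x"
  have vp: "cinner (v y) (\<Sum>x\<in>F. b x *\<^sub>C v x) = b y" if "y \<in> F" for y b
    using F v that by (simp add: orthonormal_on_def cinner_sum_right cinner_cscale_right if_distrib[of "(*) _"] cong: if_cong)
  have orth: "cinner (f - ?p) (\<Sum>x\<in>F. b x *\<^sub>C v x) = 0" for b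
  proof -
    have "cinner (f - ?p) (v x) = 0" if "x \<in> F" for x
    proof -
      have "cinner (v x) (f - ?p) = 0"
        using vp[OF that, of "\<lambda>x. cinner (v x) f"] by (simp add: cinner_diff_right)
      then show ?thesis
        using cnj_cinner[of "v x" "f - ?p"] by simp
    qed
    then show ?thesis
      by (simp add: cinner_sum_right cinner_cscale_right)
  qed
  have pp: "(norm ?p)\<^sup>2 = (\<Sum>x\<in>F. (cmod (cinner (v x) f))\<^sup>2)"
  proof -
    have vn: "(norm (v x))\<^sup>2 = 1" if "x \<in> F" for x
    proof -
      have "complex_of_real ((norm (v x))\<^sup>2) = 1"
        using v that by (simp add: cinner_self[symmetric] orthonormal_on_def del: of_real_power)
      then show ?thesis
        by (simp only: of_real_eq_1_iff)
    qed
    have "(norm ?p)\<^sup>2 = (\<Sum>x\<in>F. (norm (cinner (v x) f *\<^sub>C v x))\<^sup>2)"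
      using v by (intro norm_sum_orthogonal F)
        (simp add: orthonormal_on_def inner_eq_Re_cinner cinner_cscale_left cinner_cscale_right)
    then show ?thesis
      by (simp add: norm_cscale power_mult_distrib vn)
  qed
  have split: "(norm (u + w))\<^sup>2 = (norm u)\<^sup>2 + (norm w)\<^sup>2" if "cinner u w = 0" for u w
    using that by (simp add: power2_norm_eq_inner inner_add_left inner_add_right inner_commute[of w u])
      (simp add: inner_eq_Re_cinner)
  have diff: "?p - ?h = (\<Sum>x\<in>F. (cinner (v x) f - a x) *\<^sub>C v x)"
    by (simp add: sum_subtractf cvs.scale_left_diff_distrib)
  have f_split: "(norm f)\<^sup>2 = (norm (f - ?p))\<^sup>2 + (norm ?p)\<^sup>2"
    using split[OF orth[of "\<lambda>x. cinner (v x) f"]] by simp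
  then show "(\<Sum>x\<in>F. (cmod (cinner (v x) f))\<^sup>2) \<le> (norm f)\<^sup>2"
    using pp by simp
  have "(norm (f - ?h))\<^sup>2 = (norm (f - ?p))\<^sup>2 + (norm (?p - ?h))\<^sup>2"
  proof -
    have "cinner (f - ?p) (?p - ?h) = 0"
      unfolding diff by (rule orth)
    from split[OF this] show ?thesis
      by simp
  qed
  then show "(norm f)\<^sup>2 - (\<Sum>x\<in>F. (cmod (cinner (v x) f))\<^sup>2) \<le> (norm (f - ?h))\<^sup>2"
    using f_split pp by simp
qed

lemma orthonormal_texp: "orthonormal_on F texp"
  by (simp add: orthonormal_on_def cinner_texp)

lemma fourier_summable: "(\<lambda>x. (cmod (cinner (texp x) f))\<^sup>2) summable_on UNIV"
proof (rule nonneg_bdd_above_summable_on)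
  show "bdd_above (sum (\<lambda>x. (cmod (cinner (texp x) f))\<^sup>2) ` {F. F \<subseteq> UNIV \<and> finite F})"
    by (rule bdd_aboveI2[of _ _ "(norm f)\<^sup>2"]) (simp add: bessel_inequality orthonormal_texp)
qed simp

section \<open>Fourier multipliers\<close>

text \<open>
  Meaningful for bounded \<open>c\<close>, where the series converges. On trigonometric polynomials the Laplacian,
  its inverse and the partial derivatives all have this form.
\<close>

definition multiplier :: "(int \<times> int \<Rightarrow> complex) \<Rightarrow> complex torus_l2 \<Rightarrow> complex torus_l2" where
  "multiplier c f = (\<Sum>\<^sub>\<infinity>x. (c x * cinner (texp x) f) *\<^sub>C texp x)"

lemma norm_texp [simp]: "norm (texp x) = 1"
  using cinner_self[of "texp x"] by (simp add: cinner_texp power2_eq_1_iff of_real_eq_1_iff[symmetric] del: of_real_power)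
    (smt (verit) norm_ge_zero of_real_eq_1_iff power2_eq_1_iff)

lemma multiplier_has_sum:
  assumes c: "\<And>x. cmod (c x) \<le> B"
  shows "((\<lambda>x. (c x * cinner (texp x) f) *\<^sub>C texp x) has_sum multiplier c f) UNIV"
  unfolding multiplier_def
proof (rule has_sum_infsum, rule orthogonal_series_summable)
  show "((c x * cinner (texp x) f) *\<^sub>C texp x) \<bullet> ((c y * cinner (texp y) f) *\<^sub>C texp y) = 0" if "x \<noteq> y" for x y
    using that by (simp add: inner_eq_Re_cinner cinner_cscale_left cinner_cscale_right cinner_texp)
  show "(\<lambda>x. (norm ((c x * cinner (texp x) f) *\<^sub>C texp x))\<^sup>2) summable_on UNIV"
  proof (rule summable_on_comparison_test)
    show "(\<lambda>x. B\<^sup>2 * (cmod (cinner (texp x) f))\<^sup>2) summable_on UNIV"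
      by (intro summable_on_cmult_right fourier_summable)
    show "(norm ((c x * cinner (texp x) f) *\<^sub>C texp x))\<^sup>2 \<le> B\<^sup>2 * (cmod (cinner (texp x) f))\<^sup>2" for x
      using c[of x] by (simp add: norm_cscale norm_mult power_mult_distrib mult_right_mono power_mono)
  qed auto
qed

lemma fourier_multiplier:
  assumes c: "\<And>x. cmod (c x) \<le> B"
  shows "cinner (texp y) (multiplier c f) = c y * cinner (texp y) f"
proof -
  have "((\<lambda>x. cinner (texp y) ((c x * cinner (texp x) f) *\<^sub>C texp x)) has_sum cinner (texp y) (multiplier c f)) UNIV"
    by (rule has_sum_bounded_linear[OF bounded_linear_cinner_right multiplier_has_sum[OF c]])
  moreover have "((\<lambda>x. cinner (texp y) ((c x * cinner (texp x) f) *\<^sub>C texp x)) has_sum c y * cinner (texp y) f) UNIV"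
    by (rule has_sum_finite_neutralI[of "{y}"]) (auto simp: cinner_cscale_right cinner_texp)
  ultimately show ?thesis
    by (rule has_sum_unique)
qed

text \<open>
  The Fourier expansion of \<open>f\<close>: the series has the same coefficients as \<open>f\<close>, and by totality the
  coefficients determine the sum.
\<close>

lemma multiplier_1: "multiplier (\<lambda>_. 1) f = f"
  by (rule eq_of_fourier_eq) (simp add: fourier_multiplier[of _ 1])

lemma multiplier_comp:
  assumes "\<And>x. cmod (c x) \<le> B" "\<And>x. cmod (d x) \<le> B'"
  shows "multiplier c (multiplier d f) = multiplier (\<lambda>x. c x * d x) f"
proof (rule eq_of_fourier_eq)
  have "cmod (c x * d x) \<le> B * B'" for x
    using assms order_trans[OF norm_ge_zero assms(1)] unfolding norm_mult by (intro mult_mono) auto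
  then show "cinner (texp x) (multiplier c (multiplier d f)) = cinner (texp x) (multiplier (\<lambda>x. c x * d x) f)" for x
    by (simp add: fourier_multiplier[of c B] fourier_multiplier[of d B'] assms
        fourier_multiplier[of "\<lambda>x. c x * d x" "B * B'"])
qed

lemma multiplier_texp:
  assumes "\<And>x. cmod (c x) \<le> B"
  shows "multiplier c (texp y) = c y *\<^sub>C texp y"
  by (rule eq_of_fourier_eq) (simp add: fourier_multiplier[OF assms] cinner_cscale_right cinner_texp)

lemma parseval: "((\<lambda>x. cinner f (texp x) * cinner (texp x) g) has_sum cinner f g) UNIV"
proof -
  have "((\<lambda>x. cinner f ((1 * cinner (texp x) g) *\<^sub>C texp x)) has_sum cinner f (multiplier (\<lambda>_. 1) g)) UNIV"
    by (rule has_sum_bounded_linear[OF bounded_linear_cinner_right multiplier_has_sum[of _ 1]]) simp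
  then show ?thesis
    by (simp add: multiplier_1 cinner_cscale_right mult.commute)
qed

lemma parseval_norm: "((\<lambda>x. (cmod (cinner (texp x) f))\<^sup>2) has_sum (norm f)\<^sup>2) UNIV"
proof -
  have eq: "Re (cinner f (texp x) * cinner (texp x) f) = (cmod (cinner (texp x) f))\<^sup>2" for x
  proof -
    have "cinner f (texp x) * cinner (texp x) f = of_real ((cmod (cinner (texp x) f))\<^sup>2)"
      by (simp add: cnj_cinner[symmetric, of "texp x" f] complex_norm_square mult.commute del: of_real_power)
    then show ?thesis by simp
  qed
  have "((\<lambda>x. Re (cinner f (texp x) * cinner (texp x) f)) has_sum Re (cinner f f)) UNIV"
    by (rule has_sum_bounded_linear[OF bounded_linear_Re parseval])
  then show ?thesis
    unfolding eq by (simp add: cinner_self)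
qed

lemma multiplier_adjoint:
  assumes c: "\<And>x. cmod (c x) \<le> B"
  shows "cinner (multiplier c f) g = cinner f (multiplier (\<lambda>x. cnj (c x)) g)"
proof (rule has_sum_unique)
  have "cinner (multiplier c f) (texp x) = cnj (c x) * cinner f (texp x)" for x
    using arg_cong[OF fourier_multiplier[OF c, where y = x and f = f], of cnj] by (simp add: cnj_cinner)
  then show "((\<lambda>x. cinner f (texp x) * cinner (texp x) (multiplier (\<lambda>x. cnj (c x)) g)) has_sum cinner (multiplier c f) g) UNIV"
    using parseval[of "multiplier c f" g] c
    by (simp add: fourier_multiplier[of "\<lambda>x. cnj (c x)" B] ac_simps)
qed (rule parseval)

text \<open>
  Linearity can be read off from the Fourier coefficients; the norm bound is Parseval's identity.
\<close>

lemma bounded_clinear_multiplier: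
  assumes c: "\<And>x. cmod (c x) \<le> B"
  shows "bounded_clinear (multiplier c)"
proof -
  note fm = fourier_multiplier[OF c]
  have "norm (multiplier c f) \<le> norm f * B" for f
  proof -
    have B: "0 \<le> B"
      using order_trans[OF norm_ge_zero c] .
    have "(norm (multiplier c f))\<^sup>2 \<le> B\<^sup>2 * (norm f)\<^sup>2"
    proof (rule has_sum_mono[OF parseval_norm])
      show "((\<lambda>x. B\<^sup>2 * (cmod (cinner (texp x) f))\<^sup>2) has_sum B\<^sup>2 * (norm f)\<^sup>2) UNIV"
        by (intro has_sum_cmult_right parseval_norm)
      show "(cmod (cinner (texp x) (multiplier c f)))\<^sup>2 \<le> B\<^sup>2 * (cmod (cinner (texp x) f))\<^sup>2" for x
        using c[of x] by (simp add: fm norm_mult power_mult_distrib mult_right_mono power_mono)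
    qed
    then have "(norm (multiplier c f))\<^sup>2 \<le> (norm f * B)\<^sup>2"
      by (simp add: power_mult_distrib mult.commute)
    then show ?thesis
      by (rule power2_le_imp_le) (simp add: B)
  qed
  moreover have "multiplier c (f + g) = multiplier c f + multiplier c g" for f g
    by (rule eq_of_fourier_eq) (simp add: fm cinner_add_right distrib_left)
  moreover have cs: "multiplier c (a *\<^sub>C f) = a *\<^sub>C multiplier c f" for a f
    by (rule eq_of_fourier_eq) (simp add: fm cinner_cscale_right)
  ultimately show ?thesis
    unfolding bounded_clinear_def
    by (intro conjI allI bounded_linear_intro[where K = B]) (auto simp: scaleR_eq_cscale)
qed

lemma trig_span_alt: "trig_span = cspan (range texp)"
proof -
  have "{torus_exp k m |k m. True} = range texp"
    by (auto simp: texp_def image_iff) (metis fst_conv snd_conv)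
  then show ?thesis
    by (simp add: trig_span_def)
qed

text \<open>
  The partial sums of the Fourier expansion lie in the span.
\<close>

lemma trig_span_dense: "closure trig_span = UNIV"
proof (intro subset_antisym subset_UNIV subsetI)
  fix f :: "complex torus_l2"
  have "((\<lambda>x. (1 * cinner (texp x) f) *\<^sub>C texp x) has_sum f) UNIV"
    using multiplier_has_sum[of "\<lambda>_. 1" 1 f] by (simp add: multiplier_1)
  then have lim: "(sum (\<lambda>x. (1 * cinner (texp x) f) *\<^sub>C texp x) \<longlongrightarrow> f) (finite_subsets_at_top UNIV)"
    by (simp add: has_sum_def)
  have "sum (\<lambda>x. (1 * cinner (texp x) f) *\<^sub>C texp x) F \<in> trig_span" for F
    unfolding trig_span_alt by (intro cvs.span_sum cvs.span_scale cvs.span_base) auto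
  then show "f \<in> closure trig_span"
    by (intro Lim_in_closed_set[OF closed_closure _ _ lim] always_eventually allI closure_subset[THEN subsetD]) auto
qed

section \<open>The Sobolev space as a graph\<close>

lemma l2_class_add:
  "square_integrable f \<Longrightarrow> square_integrable g \<Longrightarrow> l2_class f + l2_class g = l2_class (\<lambda>z. f z + g z)"
  by (subst plus_torus_l2.abs_eq) (auto simp: l2_eq_def)

lemma l2_class_scaleR:
  "square_integrable f \<Longrightarrow> r *\<^sub>R l2_class f = l2_class (\<lambda>z. r *\<^sub>R f z)"
  by (subst scaleR_torus_l2.abs_eq) (auto simp: l2_eq_def)

text \<open>
  Smooth functions separate the elements of \<open>L\<^sup>2\<close>; the real and imaginary parts of the characters suffice
  as test functions. This is what makes weak derivatives unique.
\<close>

lemma real_eq_0_of_smooth_test: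
  fixes a :: "real torus_l2"
  assumes zero: "\<And>f. f \<in> torus_smooth \<Longrightarrow> a \<bullet> l2_class f = 0"
  shows "a = 0"
proof -
  obtain F where F: "square_integrable F" and a: "a = l2_class F"
    using l2_class_surj by blast
  have "square_integrable (\<lambda>_. 1 :: real)"
    by (intro continuous_square_integrable continuous_intros)
  from integrable_inner_square_integrable[OF F this]
  have iF: "integrable torus_measure F"
    by simp
  then have [measurable]: "F \<in> borel_measurable torus_measure"
    by simp
  have test: "(\<integral>z. F z * L (tchar x z) \<partial>torus_measure) = 0" if "bounded_linear L" for L :: "complex \<Rightarrow> real" and x
  proof -
    have sm: "(\<lambda>z. L (1 * tchar x z)) \<in> torus_smooth"
      by (intro torus_smooth_linear[OF that] tchar_smooth)
    from zero[OF sm] show ?thesis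
      by (simp add: a l2_class_inner F torus_smooth_square_integrable[OF sm, simplified])
  qed
  have "AE z in torus_measure. F z = 0"
  proof (rule AE_zero_of_Fourier_zero[OF iF])
    fix x
    have i: "integrable torus_measure (\<lambda>z. complex_of_real (F z) * tchar x z)"
      by (rule Bochner_Integration.integrable_bound[OF iF]) (auto simp: norm_mult)
    show "(\<integral>z. complex_of_real (F z) * tchar x z \<partial>torus_measure) = 0"
      using integral_Re[OF i] integral_Im[OF i] test[OF bounded_linear_Re, of x] test[OF bounded_linear_Im, of x]
      by (simp add: complex_eq_iff)
  qed
  then have "l2_eq F (\<lambda>_. 0)"
    by (simp add: l2_eq_def F square_integrable_0)
  then show ?thesis
    unfolding a zero_torus_l2_def by (metis Quotient_rel_abs Quotient_torus_l2)
qed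

text \<open>
  The \<open>H\<^sup>1\<close> inner product of smooth functions is the \<open>L\<^sup>2\<close> inner product of their jets. The completion that
  defines \<open>H\<^sup>1\<close> is therefore the closure of the jets in the Hilbert space \<open>L\<^sup>2 \<times> L\<^sup>2 \<times> L\<^sup>2\<close>.
\<close>

definition jet :: "(real \<times> real \<Rightarrow> real) \<Rightarrow> real torus_l2 \<times> real torus_l2 \<times> real torus_l2" where
  "jet f = (l2_class f, l2_class (partial1 f), l2_class (partial2 f))"

lemma fst_jet [simp]: "fst (jet f) = l2_class f"
  by (simp add: jet_def)

lemma jet_add: "f \<in> torus_smooth \<Longrightarrow> g \<in> torus_smooth \<Longrightarrow> jet (\<lambda>z. f z + g z) = jet f + jet g"
  by (simp add: jet_def l2_class_add torus_smooth_square_integrable torus_smooth_partial1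
      torus_smooth_partial2 partial1_add partial2_add torus_smooth_differentiable)

lemma torus_smooth_scaleR: "f \<in> torus_smooth \<Longrightarrow> (\<lambda>z. r *\<^sub>R f z) \<in> torus_smooth"
  by (rule torus_smooth_linear[OF bounded_linear_scaleR_right])

lemma jet_scaleR: "f \<in> torus_smooth \<Longrightarrow> jet (\<lambda>z. r *\<^sub>R f z) = r *\<^sub>R jet f"
  using partial1_linear[OF bounded_linear_scaleR_right[of r], of f]
    partial2_linear[OF bounded_linear_scaleR_right[of r], of f]
  by (simp add: jet_def l2_class_scaleR torus_smooth_square_integrable torus_smooth_partial1
      torus_smooth_partial2 torus_smooth_differentiable del: real_scaleR_def)

lemma jet_diff:
  assumes "f \<in> torus_smooth" "g \<in> torus_smooth"
  shows "jet (\<lambda>z. f z - g z) = jet f - jet g"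
  using jet_add[OF assms(1) torus_smooth_scaleR[OF assms(2)], of "-1"] jet_scaleR[OF assms(2), of "-1"]
  by simp

lemma torus_smooth_mult_integrable:
  fixes f g :: "real \<times> real \<Rightarrow> real"
  assumes "f \<in> torus_smooth" "g \<in> torus_smooth"
  shows "integrable torus_measure (\<lambda>z. f z * g z)"
  using assms[THEN torus_smooth_continuous]
  by (rule torus_integral_continuous(1)[OF continuous_on_mult])

lemma inner_jet: "f \<in> torus_smooth \<Longrightarrow> g \<in> torus_smooth \<Longrightarrow> jet f \<bullet> jet g = h1_inner_smooth f g"
  by (simp add: jet_def h1_inner_smooth_def l2_class_inner torus_smooth_square_integrable
      torus_smooth_partial1 torus_smooth_partial2 torus_smooth_mult_integrable)

lemma norm_jet: "f \<in> torus_smooth \<Longrightarrow> norm (jet f) = h1_norm_smooth f"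
  by (simp add: h1_norm_smooth_def norm_eq_sqrt_inner inner_jet)

definition sobolev_graph :: "(real torus_l2 \<times> real torus_l2 \<times> real torus_l2) set" where
  "sobolev_graph = closure (jet ` torus_smooth)"

text \<open>
  Identities that are continuous in the jet need only be checked on smooth functions.
\<close>

lemma sobolev_graph_closed_induct:
  assumes "z \<in> sobolev_graph" "closed {z. P z}" "\<And>f. f \<in> torus_smooth \<Longrightarrow> P (jet f)"
  shows "P z"
proof -
  have "closure (jet ` torus_smooth) \<subseteq> {z. P z}"
    using assms by (intro closure_minimal) auto
  then show ?thesis
    using assms(1) by (auto simp: sobolev_graph_def)
qed

lemma sobolev_graph_iff:
  "z \<in> sobolev_graph \<longleftrightarrow> (\<exists>U. range U \<subseteq> torus_smooth \<and> (\<lambda>n. jet (U n)) \<longlonglongrightarrow> z)"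
proof
  assume "z \<in> sobolev_graph"
  then obtain W where W: "\<forall>n. W n \<in> jet ` torus_smooth" and lim: "W \<longlonglongrightarrow> z"
    by (auto simp: sobolev_graph_def closure_sequential)
  have "\<forall>n. \<exists>f. f \<in> torus_smooth \<and> W n = jet f"
    using W by auto
  then obtain U where U: "\<forall>n. U n \<in> torus_smooth \<and> W n = jet (U n)"
    by (rule choice[THEN exE])
  then have "W = (\<lambda>n. jet (U n))"
    by (simp add: fun_eq_iff)
  with U lim show "\<exists>U. range U \<subseteq> torus_smooth \<and> (\<lambda>n. jet (U n)) \<longlonglongrightarrow> z"
    by (intro exI[of _ U]) auto
next
  assume "\<exists>U. range U \<subseteq> torus_smooth \<and> (\<lambda>n. jet (U n)) \<longlonglongrightarrow> z"
  then obtain U where U: "range U \<subseteq> torus_smooth" and lim: "(\<lambda>n. jet (U n)) \<longlonglongrightarrow> z"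
    by (elim exE conjE)
  then show "z \<in> sobolev_graph"
    unfolding sobolev_graph_def closure_sequential by (intro exI[of _ "\<lambda>n. jet (U n)"]) auto
qed

lemma sobolev_graph_jet: "f \<in> torus_smooth \<Longrightarrow> jet f \<in> sobolev_graph"
  unfolding sobolev_graph_def by (intro closure_subset[THEN subsetD] imageI)

lemma sobolev_graph_add:
  assumes "z \<in> sobolev_graph" "w \<in> sobolev_graph"
  shows "z + w \<in> sobolev_graph"
proof -
  obtain U where U: "range U \<subseteq> torus_smooth" "(\<lambda>n. jet (U n)) \<longlonglongrightarrow> z"
    using assms(1) unfolding sobolev_graph_iff by (elim exE conjE)
  obtain V where V: "range V \<subseteq> torus_smooth" "(\<lambda>n. jet (V n)) \<longlonglongrightarrow> w"
    using assms(2) unfolding sobolev_graph_iff by (elim exE conjE)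
  have s: "U n \<in> torus_smooth" "V n \<in> torus_smooth" for n
    using U(1) V(1) by auto
  show ?thesis
    unfolding sobolev_graph_iff
  proof (intro exI conjI)
    show "range (\<lambda>n z. U n z + V n z) \<subseteq> torus_smooth"
      by (intro image_subsetI torus_smooth_add s)
    show "(\<lambda>n. jet (\<lambda>z. U n z + V n z)) \<longlonglongrightarrow> z + w"
      unfolding jet_add[OF s] by (intro tendsto_add U V)
  qed
qed

lemma sobolev_graph_scaleR:
  assumes "z \<in> sobolev_graph"
  shows "r *\<^sub>R z \<in> sobolev_graph"
proof -
  obtain U where U: "range U \<subseteq> torus_smooth" "(\<lambda>n. jet (U n)) \<longlonglongrightarrow> z"
    using assms unfolding sobolev_graph_iff by (elim exE conjE)
  have s: "U n \<in> torus_smooth" for n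
    using U(1) by auto
  show ?thesis
    unfolding sobolev_graph_iff
  proof (intro exI conjI)
    show "range (\<lambda>n z. r *\<^sub>R U n z) \<subseteq> torus_smooth"
      by (intro image_subsetI torus_smooth_scaleR s)
    show "(\<lambda>n. jet (\<lambda>z. r *\<^sub>R U n z)) \<longlonglongrightarrow> r *\<^sub>R z"
      unfolding jet_scaleR[OF s] by (intro tendsto_scaleR tendsto_const U)
  qed
qed

text \<open>
  Integration by parts against a fixed smooth function survives limits of jets.
\<close>

lemma sobolev_graph_weak_derivative:
  assumes z: "z \<in> sobolev_graph" and f: "f \<in> torus_smooth"
  shows "fst (snd z) \<bullet> l2_class f = - (fst z \<bullet> l2_class (partial1 f)) \<and>
         snd (snd z) \<bullet> l2_class f = - (fst z \<bullet> l2_class (partial2 f))"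
  using z
proof (rule sobolev_graph_closed_induct)
  show "closed {z. fst (snd z) \<bullet> l2_class f = - (fst z \<bullet> l2_class (partial1 f)) \<and>
         snd (snd z) \<bullet> l2_class f = - (fst z \<bullet> l2_class (partial2 f))}"
    by (intro closed_Collect_conj closed_Collect_eq continuous_intros)
next
  fix g :: "real \<times> real \<Rightarrow> real"
  assume g: "g \<in> torus_smooth"
  show "fst (snd (jet g)) \<bullet> l2_class f = - (fst (jet g) \<bullet> l2_class (partial1 f)) \<and>
         snd (snd (jet g)) \<bullet> l2_class f = - (fst (jet g) \<bullet> l2_class (partial2 f))"
    using by_parts1[OF g f] by_parts2[OF g f]
    by (simp add: jet_def l2_class_inner f g torus_smooth_square_integrable torus_smooth_partial1
        torus_smooth_partial2)
qed

text \<open>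
  The gradient is closable: an element of the graph is determined by its function component, because
  the other components are its weak derivatives. Hence \<open>H\<^sup>1\<close> embeds in \<open>L\<^sup>2\<close>, and limits of \<open>H\<^sup>1\<close> inner
  products do not depend on the approximating sequences.
\<close>

lemma sobolev_graph_functional:
  assumes "z \<in> sobolev_graph" "w \<in> sobolev_graph" "fst z = fst w"
  shows "z = w"
proof -
  have d: "z - w \<in> sobolev_graph"
    using sobolev_graph_add[OF assms(1) sobolev_graph_scaleR[OF assms(2), of "-1"]] by simp
  have "fst (snd (z - w)) = 0" "snd (snd (z - w)) = 0"
    by (rule real_eq_0_of_smooth_test; use sobolev_graph_weak_derivative[OF d] assms(3) in simp)+
  with assms(3) show ?thesis
    by (simp add: prod_eq_iff)
qed

definition sobolev_jet :: "real torus_l2 \<Rightarrow> real torus_l2 \<times> real torus_l2 \<times> real torus_l2" where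
  "sobolev_jet u = (THE z. z \<in> sobolev_graph \<and> fst z = u)"

lemma sobolev_jet_eq: "z \<in> sobolev_graph \<Longrightarrow> sobolev_jet (fst z) = z"
  unfolding sobolev_jet_def by (rule the_equality) (auto intro: sobolev_graph_functional)

text \<open>
  A sequence that is Cauchy in the \<open>H\<^sup>1\<close> norm has jets that are Cauchy in \<open>L\<^sup>2 \<times> L\<^sup>2 \<times> L\<^sup>2\<close>, and these
  converge by completeness.
\<close>

lemma h1_approx_iff:
  "h1_approx U u \<longleftrightarrow> range U \<subseteq> torus_smooth \<and> (\<exists>z. (\<lambda>n. jet (U n)) \<longlonglongrightarrow> z \<and> fst z = u)"
proof (cases "range U \<subseteq> torus_smooth")
  case True
  then have U: "U n \<in> torus_smooth" for n
    by auto
  have nd: "h1_norm_smooth (\<lambda>z. U m z - U n z) = norm (jet (U m) - jet (U n))" for m n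
  proof -
    have "(\<lambda>z. U m z - U n z) \<in> torus_smooth"
      using torus_smooth_add[OF U torus_smooth_scaleR[OF U], of m "-1" n] by simp
    from norm_jet[OF this] show ?thesis
      by (simp add: jet_diff U)
  qed
  have "(\<forall>e>0. \<exists>N. \<forall>m\<ge>N. \<forall>n\<ge>N. h1_norm_smooth (\<lambda>z. U m z - U n z) < e) \<longleftrightarrow> Cauchy (\<lambda>n. jet (U n))"
    by (simp add: nd Cauchy_def dist_norm)
  moreover have "Cauchy (\<lambda>n. jet (U n)) \<and> (\<lambda>n. l2_class (U n)) \<longlonglongrightarrow> u \<longleftrightarrow>
      (\<exists>z. (\<lambda>n. jet (U n)) \<longlonglongrightarrow> z \<and> fst z = u)"
  proof safe
    assume "Cauchy (\<lambda>n. jet (U n))" and lim: "(\<lambda>n. l2_class (U n)) \<longlonglongrightarrow> u"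
    then obtain z where z: "(\<lambda>n. jet (U n)) \<longlonglongrightarrow> z"
      using Cauchy_convergent_iff convergent_def by blast
    from tendsto_fst[OF this] have "(\<lambda>n. l2_class (U n)) \<longlonglongrightarrow> fst z"
      by simp
    with lim have "fst z = u"
      by (metis LIMSEQ_unique)
    with z show "\<exists>z. (\<lambda>n. jet (U n)) \<longlonglongrightarrow> z \<and> fst z = u"
      by blast
  next
    fix z
    assume z: "(\<lambda>n. jet (U n)) \<longlonglongrightarrow> z"
    show "Cauchy (\<lambda>n. jet (U n))"
      using z by (rule LIMSEQ_imp_Cauchy)
    show "(\<lambda>n. l2_class (U n)) \<longlonglongrightarrow> fst z"
      using tendsto_fst[OF z] by simp
  qed
  ultimately show ?thesis
    using True by (simp add: h1_approx_def)
qed (simp add: h1_approx_def)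

lemma H1_iff: "u \<in> H1 \<longleftrightarrow> (\<exists>z\<in>sobolev_graph. fst z = u)"
  unfolding H1_def h1_approx_iff sobolev_graph_iff Bex_def mem_Collect_eq by metis

lemma sobolev_jet:
  assumes "u \<in> H1"
  shows "sobolev_jet u \<in> sobolev_graph" "fst (sobolev_jet u) = u"
  using assms sobolev_jet_eq by (auto simp: H1_iff)

lemma h1_approx_sobolev_jet:
  assumes "h1_approx U u"
  shows "U n \<in> torus_smooth" "(\<lambda>n. jet (U n)) \<longlonglongrightarrow> sobolev_jet u"
proof -
  obtain z where U: "range U \<subseteq> torus_smooth" and z: "(\<lambda>n. jet (U n)) \<longlonglongrightarrow> z" "fst z = u"
    using assms by (auto simp: h1_approx_iff)
  then show "U n \<in> torus_smooth"
    by auto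
  have "z \<in> sobolev_graph"
    using U z(1) unfolding sobolev_graph_iff by (intro exI conjI)
  then show "(\<lambda>n. jet (U n)) \<longlonglongrightarrow> sobolev_jet u"
    using z sobolev_jet_eq[of z] by simp
qed

lemma H1_class: "f \<in> torus_smooth \<Longrightarrow> l2_class f \<in> H1"
  using sobolev_graph_jet fst_jet unfolding H1_iff by blast

lemma sobolev_jet_class: "f \<in> torus_smooth \<Longrightarrow> sobolev_jet (l2_class f) = jet f"
  using sobolev_jet_eq[OF sobolev_graph_jet] by simp

lemma
  assumes "u \<in> H1" "v \<in> H1"
  shows H1_add: "u + v \<in> H1"
    and sobolev_jet_add: "sobolev_jet (u + v) = sobolev_jet u + sobolev_jet v"
proof -
  have g: "sobolev_jet u + sobolev_jet v \<in> sobolev_graph"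
    by (intro sobolev_graph_add sobolev_jet assms)
  moreover have "fst (sobolev_jet u + sobolev_jet v) = u + v"
    by (simp add: sobolev_jet assms)
  ultimately show "u + v \<in> H1"
    unfolding H1_iff by blast
  show "sobolev_jet (u + v) = sobolev_jet u + sobolev_jet v"
    using sobolev_jet_eq[OF g] by (simp add: sobolev_jet assms)
qed

lemma
  assumes "u \<in> H1"
  shows H1_scaleR: "r *\<^sub>R u \<in> H1"
    and sobolev_jet_scaleR: "sobolev_jet (r *\<^sub>R u) = r *\<^sub>R sobolev_jet u"
proof -
  have g: "r *\<^sub>R sobolev_jet u \<in> sobolev_graph"
    by (intro sobolev_graph_scaleR sobolev_jet assms)
  moreover have "fst (r *\<^sub>R sobolev_jet u) = r *\<^sub>R u"
    by (simp add: sobolev_jet assms)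
  ultimately show "r *\<^sub>R u \<in> H1"
    unfolding H1_iff by blast
  show "sobolev_jet (r *\<^sub>R u) = r *\<^sub>R sobolev_jet u"
    using sobolev_jet_eq[OF g] by (simp add: sobolev_jet assms)
qed

lemma
  assumes "u \<in> H1" "v \<in> H1"
  shows H1_diff: "u - v \<in> H1"
    and sobolev_jet_diff: "sobolev_jet (u - v) = sobolev_jet u - sobolev_jet v"
  using H1_add[OF assms(1) H1_scaleR[OF assms(2)], of "-1"]
    sobolev_jet_add[OF assms(1) H1_scaleR[OF assms(2)], of "-1"] sobolev_jet_scaleR[OF assms(2), of "-1"]
  by simp_all

text \<open>
  Whatever the approximating sequences, their jets converge to the jets of \<open>u\<close> and \<open>v\<close>.
\<close>

lemma h1_inner_eq:
  assumes "u \<in> H1" "v \<in> H1"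
  shows "h1_inner u v = sobolev_jet u \<bullet> sobolev_jet v"
proof -
  have lim: "(\<lambda>n. h1_inner_smooth (U n) (V n)) \<longlonglongrightarrow> sobolev_jet u \<bullet> sobolev_jet v"
    if "h1_approx U u" "h1_approx V v" for U V
    using tendsto_inner[OF h1_approx_sobolev_jet(2)[OF that(1)] h1_approx_sobolev_jet(2)[OF that(2)]]
    by (simp add: inner_jet h1_approx_sobolev_jet(1)[OF that(1)] h1_approx_sobolev_jet(1)[OF that(2)])
  obtain U V where UV: "h1_approx U u" "h1_approx V v"
    using assms by (auto simp: H1_def)
  show ?thesis
    unfolding h1_inner_def
  proof (rule the_equality)
    fix c
    assume "\<forall>U V. h1_approx U u \<and> h1_approx V v \<longrightarrow> (\<lambda>n. h1_inner_smooth (U n) (V n)) \<longlonglongrightarrow> c"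
    with UV have "(\<lambda>n. h1_inner_smooth (U n) (V n)) \<longlonglongrightarrow> c"
      by blast
    then show "c = sobolev_jet u \<bullet> sobolev_jet v"
      using lim[OF UV] by (rule LIMSEQ_unique)
  qed (use lim in blast)
qed

lemma h1_norm_eq: "u \<in> H1 \<Longrightarrow> h1_norm u = norm (sobolev_jet u)"
  by (simp add: h1_norm_def h1_inner_eq norm_eq_sqrt_inner)

section \<open>The Laplace form\<close>

text \<open>
  The classical Dirichlet form with the opposite sign: \<open>- \<integral>\<langle>grad u, grad v\<rangle>\<close> extends \<open>\<integral>\<Delta>u \<cdot> v\<close>. The value 0 outside \<open>H\<^sup>1\<close> is
  the one that \<open>extends_laplace_form\<close> prescribes.
\<close>

definition dirichlet_form :: "real torus_l2 \<Rightarrow> real torus_l2 \<Rightarrow> real" where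
  "dirichlet_form u v = (if u \<in> H1 \<and> v \<in> H1 then - (snd (sobolev_jet u) \<bullet> snd (sobolev_jet v)) else 0)"

lemma dirichlet_form_smooth:
  assumes f: "f \<in> torus_smooth" and g: "g \<in> torus_smooth"
  shows "dirichlet_form (l2_class f) (l2_class g) = (\<integral>z. laplacian f z * g z \<partial>torus_measure)"
proof -
  note f1 = torus_smooth_partial1[OF f] and f2 = torus_smooth_partial2[OF f]
  note g1 = torus_smooth_partial1[OF g] and g2 = torus_smooth_partial2[OF g]
  have "(\<integral>z. laplacian f z * g z \<partial>torus_measure)
      = (\<integral>z. partial1 (partial1 f) z * g z + partial2 (partial2 f) z * g z \<partial>torus_measure)"
    by (simp add: laplacian_def distrib_right)
  also have "\<dots> = (\<integral>z. partial1 (partial1 f) z * g z \<partial>torus_measure) + (\<integral>z. partial2 (partial2 f) z * g z \<partial>torus_measure)"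
    by (intro Bochner_Integration.integral_add torus_integral_continuous(1) continuous_on_mult
        torus_smooth_continuous torus_smooth_partial1 torus_smooth_partial2 f g)
  also have "\<dots> = - ((\<integral>z. partial1 f z * partial1 g z \<partial>torus_measure) + (\<integral>z. partial2 f z * partial2 g z \<partial>torus_measure))"
    by (simp add: by_parts1[OF f1 g] by_parts2[OF f2 g])
  finally show ?thesis
    by (simp add: dirichlet_form_def H1_class f g sobolev_jet_class jet_def l2_class_inner
        torus_smooth_square_integrable f1 f2 g1 g2)
qed

lemma abs_dirichlet_form_le:
  assumes "u \<in> H1" "v \<in> H1"
  shows "\<bar>dirichlet_form u v\<bar> \<le> h1_norm u * h1_norm v"
proof -
  have "\<bar>dirichlet_form u v\<bar> \<le> norm (snd (sobolev_jet u)) * norm (snd (sobolev_jet v))"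
    using assms Cauchy_Schwarz_ineq2 by (simp add: dirichlet_form_def)
  also have "\<dots> \<le> norm (sobolev_jet u) * norm (sobolev_jet v)"
    by (intro mult_mono norm_ge_zero) (metis norm_snd_le prod.collapse)+
  finally show ?thesis
    using assms by (simp add: h1_norm_eq)
qed

lemma extends_laplace_form_dirichlet: "extends_laplace_form dirichlet_form"
  unfolding extends_laplace_form_def
proof (intro conjI)
  show "\<exists>C. \<forall>u\<in>H1. \<forall>v\<in>H1. \<bar>dirichlet_form u v\<bar> \<le> C * h1_norm u * h1_norm v"
    by (intro exI[of _ 1]) (simp add: abs_dirichlet_form_le)
qed (auto simp: dirichlet_form_smooth, auto simp: dirichlet_form_def H1_add H1_scaleR sobolev_jet_add
    sobolev_jet_scaleR inner_add_left inner_add_right)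

text \<open>
  The boundedness of an extension makes it continuous along \<open>H\<^sup>1\<close> approximations, so it is determined
  by its values on smooth functions.
\<close>

lemma extends_laplace_form_tendsto:
  assumes b: "extends_laplace_form b" and U: "h1_approx U u" and V: "h1_approx V v"
  shows "(\<lambda>n. b (l2_class (U n)) (l2_class (V n))) \<longlonglongrightarrow> b u v"
proof -
  obtain C where C: "\<And>u v. u \<in> H1 \<Longrightarrow> v \<in> H1 \<Longrightarrow> \<bar>b u v\<bar> \<le> C * h1_norm u * h1_norm v"
    using b unfolding extends_laplace_form_def by blast
  have add: "b (u + v) w = b u w + b v w" "b w (u + v) = b w u + b w v"
    if "u \<in> H1" "v \<in> H1" "w \<in> H1" for u v w
    using b that unfolding extends_laplace_form_def by blast+
  have uv: "u \<in> H1" "v \<in> H1"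
    using U V by (auto simp: H1_def)
  note Us = h1_approx_sobolev_jet(1)[OF U] and Vs = h1_approx_sobolev_jet(1)[OF V]
  note UH = H1_class[OF Us] and VH = H1_class[OF Vs]
  have le: "\<bar>b (l2_class (U n)) (l2_class (V n)) - b u v\<bar>
      \<le> C * norm (jet (U n) - sobolev_jet u) * norm (jet (V n))
        + C * norm (sobolev_jet u) * norm (jet (V n) - sobolev_jet v)" for n
  proof -
    have "b (l2_class (U n)) (l2_class (V n)) - b u v
        = b (l2_class (U n) - u) (l2_class (V n)) + b u (l2_class (V n) - v)"
      using add(1)[OF H1_diff[OF UH[of n] uv(1)] uv(1) VH[of n]] add(2)[OF H1_diff[OF VH[of n] uv(2)] uv(2) uv(1)]
      by simp
    also have "\<bar>\<dots>\<bar> \<le> \<bar>b (l2_class (U n) - u) (l2_class (V n))\<bar> + \<bar>b u (l2_class (V n) - v)\<bar>"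
      by (rule abs_triangle_ineq)
    also have "\<dots> \<le> C * h1_norm (l2_class (U n) - u) * h1_norm (l2_class (V n))
        + C * h1_norm u * h1_norm (l2_class (V n) - v)"
      by (intro add_mono C H1_diff UH VH uv)
    finally show ?thesis
      by (simp add: h1_norm_eq H1_diff UH VH uv sobolev_jet_diff sobolev_jet_class Us Vs)
  qed
  have "(\<lambda>n. C * norm (jet (U n) - sobolev_jet u) * norm (jet (V n))
        + C * norm (sobolev_jet u) * norm (jet (V n) - sobolev_jet v))
      \<longlonglongrightarrow> C * norm (sobolev_jet u - sobolev_jet u) * norm (sobolev_jet v)
        + C * norm (sobolev_jet u) * norm (sobolev_jet v - sobolev_jet v)"
    by (intro tendsto_intros h1_approx_sobolev_jet(2)[OF U] h1_approx_sobolev_jet(2)[OF V])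
  then have null: "(\<lambda>n. C * norm (jet (U n) - sobolev_jet u) * norm (jet (V n))
        + C * norm (sobolev_jet u) * norm (jet (V n) - sobolev_jet v)) \<longlonglongrightarrow> 0"
    by simp
  have "(\<lambda>n. b (l2_class (U n)) (l2_class (V n)) - b u v) \<longlonglongrightarrow> 0"
    by (rule Lim_null_comparison[OF _ null]) (use le in simp)
  then show ?thesis
    by (simp add: LIM_zero_iff)
qed

lemma laplace_form_eq: "laplace_form = dirichlet_form"
  unfolding laplace_form_def
proof (rule the_equality)
  show "extends_laplace_form dirichlet_form"
    by (rule extends_laplace_form_dirichlet)
next
  fix b
  assume b: "extends_laplace_form b"
  show "b = dirichlet_form"
  proof (intro ext)
    fix u v
    show "b u v = dirichlet_form u v"
    proof (cases "u \<in> H1 \<and> v \<in> H1")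
      case True
      then obtain U V where UV: "h1_approx U u" "h1_approx V v"
        by (auto simp: H1_def)
      have "b (l2_class (U n)) (l2_class (V n)) = dirichlet_form (l2_class (U n)) (l2_class (V n))" for n
        using b extends_laplace_form_dirichlet h1_approx_sobolev_jet(1)[OF UV(1)] h1_approx_sobolev_jet(1)[OF UV(2)]
        unfolding extends_laplace_form_def by simp
      then show ?thesis
        using extends_laplace_form_tendsto[OF b UV]
          extends_laplace_form_tendsto[OF extends_laplace_form_dirichlet UV] LIMSEQ_unique by auto
    next
      case False
      then show ?thesis
        using b unfolding extends_laplace_form_def dirichlet_form_def by auto
    qed
  qed
qed

lemma dirichlet_form_commute: "dirichlet_form u v = dirichlet_form v u"
  by (simp add: dirichlet_form_def inner_commute)

lemma torus_smooth_laplacian: "f \<in> torus_smooth \<Longrightarrow> laplacian f \<in> torus_smooth"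
  unfolding laplacian_def by (intro torus_smooth_add torus_smooth_partial1 torus_smooth_partial2)

text \<open>
  If one argument is smooth, both derivatives can be moved onto it. This turns all conditions on the
  eigenfunctions below into conditions on \<open>L\<^sup>2\<close> inner products.
\<close>

lemma dirichlet_form_weak:
  assumes f: "f \<in> torus_smooth" and v: "v \<in> H1"
  shows "dirichlet_form (l2_class f) v = l2_class (laplacian f) \<bullet> v"
proof -
  have "- (snd (jet f) \<bullet> snd (sobolev_jet v)) = l2_class (laplacian f) \<bullet> fst (sobolev_jet v)"
    using sobolev_jet(1)[OF v]
  proof (rule sobolev_graph_closed_induct)
    show "closed {z. - (snd (jet f) \<bullet> snd z) = l2_class (laplacian f) \<bullet> fst z}"
      by (intro closed_Collect_eq continuous_intros)
    fix g :: "real \<times> real \<Rightarrow> real"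
    assume g: "g \<in> torus_smooth"
    show "- (snd (jet f) \<bullet> snd (jet g)) = l2_class (laplacian f) \<bullet> fst (jet g)"
      using dirichlet_form_smooth[OF f g]
      by (simp add: dirichlet_form_def H1_class f g sobolev_jet_class l2_class_inner
          torus_smooth_square_integrable torus_smooth_laplacian)
  qed
  then show ?thesis
    using v by (simp add: dirichlet_form_def H1_class f sobolev_jet_class sobolev_jet)
qed

lemma h1_inner_dirichlet:
  assumes "u \<in> H1" "v \<in> H1"
  shows "h1_inner u v = u \<bullet> v - dirichlet_form u v"
  using assms by (simp add: h1_inner_eq dirichlet_form_def inner_prod_def sobolev_jet)

section \<open>The inverse Laplace operator on trigonometric polynomials\<close>

text \<open>
  The condition whose unique solution \<open>u\<close> is \<open>D\<^sup>-\<^sup>1 h\<close>, as a relation: additivity is immediate for the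
  relation, and existence has to be shown for trigonometric polynomials only.
\<close>

definition solves_poisson :: "real torus_l2 \<Rightarrow> real torus_l2 \<Rightarrow> bool" where
  "solves_poisson h u \<longleftrightarrow> u \<in> laplace_kernel_perp \<and> (\<forall>v\<in>laplace_kernel_perp. laplace_form u v = h \<bullet> v)"

lemma laplace_kernel_perp_H1: "u \<in> laplace_kernel_perp \<Longrightarrow> u \<in> H1"
  by (simp add: laplace_kernel_perp_def)

lemma laplace_kernel_H1: "u \<in> laplace_kernel \<Longrightarrow> u \<in> H1"
  by (simp add: laplace_kernel_def)

lemma
  assumes "u \<in> laplace_kernel_perp" "v \<in> laplace_kernel_perp"
  shows laplace_kernel_perp_add: "u + v \<in> laplace_kernel_perp"
    and laplace_kernel_perp_diff: "u - v \<in> laplace_kernel_perp"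
  using assms
  by (auto simp: laplace_kernel_perp_def H1_add H1_diff h1_inner_eq sobolev_jet_add sobolev_jet_diff
      laplace_kernel_H1 inner_add_left inner_diff_left)

lemma
  assumes "u \<in> H1" "v \<in> H1" "w \<in> H1"
  shows dirichlet_form_add_left: "dirichlet_form (u + v) w = dirichlet_form u w + dirichlet_form v w"
    and dirichlet_form_diff_left: "dirichlet_form (u - v) w = dirichlet_form u w - dirichlet_form v w"
  using assms by (simp_all add: dirichlet_form_def H1_add H1_diff sobolev_jet_add sobolev_jet_diff
      inner_add_left inner_diff_left)

lemma solves_poisson_add:
  "solves_poisson h u \<Longrightarrow> solves_poisson h' u' \<Longrightarrow> solves_poisson (h + h') (u + u')"
  by (auto simp: solves_poisson_def laplace_form_eq laplace_kernel_perp_add dirichlet_form_add_left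
      laplace_kernel_perp_H1 inner_add_left)

text \<open>
  The difference \<open>w\<close> of two solutions satisfies \<open>B(w, w) = 0\<close>, so its gradient vanishes. Then \<open>w\<close> lies in
  the kernel of \<open>B\<close> and also in its orthogonal complement, hence \<open>w = 0\<close>.
\<close>

lemma solves_poisson_unique:
  assumes "solves_poisson h u" "solves_poisson h u'"
  shows "u = u'"
proof -
  define w where "w = u - u'"
  have w: "w \<in> laplace_kernel_perp"
    using assms by (simp add: w_def solves_poisson_def laplace_kernel_perp_diff)
  note wH = laplace_kernel_perp_H1[OF w]
  have "dirichlet_form w w = 0"
    using assms w unfolding w_def
    by (subst dirichlet_form_diff_left)
      (auto simp: solves_poisson_def laplace_form_eq laplace_kernel_perp_H1 laplace_kernel_perp_diff)
  then have "snd (sobolev_jet w) = 0"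
    using wH by (simp add: dirichlet_form_def)
  then have "w \<in> laplace_kernel"
    using wH by (simp add: laplace_kernel_def laplace_form_eq dirichlet_form_def)
  with w have "h1_inner w w = 0"
    by (simp add: laplace_kernel_perp_def)
  then have "w = 0"
    using sobolev_jet(2)[OF wH] by (simp add: h1_inner_eq wH)
  then show ?thesis
    by (simp add: w_def)
qed

lemma inv_laplace_real_eq: "solves_poisson h u \<Longrightarrow> inv_laplace_real h = u"
  unfolding inv_laplace_real_def solves_poisson_def[symmetric]
  by (rule the_equality) (auto intro: solves_poisson_unique)

text \<open>
  Eigenfunctions for a nonzero eigenvalue are orthogonal to the kernel: for \<open>w\<close> in the kernel,
  \<open>0 = B(p, w) = \<langle>\<Delta>p, w\<rangle> = \<mu> \<langle>p, w\<rangle>\<close>. The equation itself is the weak form of the Laplacian.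
\<close>

lemma solves_poisson_eigenfunction:
  assumes p: "p \<in> torus_smooth" and lap: "laplacian p = (\<lambda>z. \<mu> * p z)" and \<mu>: "\<mu> \<noteq> 0"
  shows "solves_poisson (l2_class (laplacian p)) (l2_class p)"
  unfolding solves_poisson_def
proof
  have pl: "l2_class (laplacian p) = \<mu> *\<^sub>R l2_class p"
    unfolding lap by (simp add: l2_class_scaleR torus_smooth_square_integrable p)
  show "l2_class p \<in> laplace_kernel_perp"
    unfolding laplace_kernel_perp_def
  proof (intro CollectI conjI ballI H1_class p)
    fix w assume w: "w \<in> laplace_kernel"
    have wH: "w \<in> H1"
      using w by (rule laplace_kernel_H1)
    have 0: "dirichlet_form (l2_class p) w = 0"
      using w by (subst dirichlet_form_commute) (simp add: laplace_kernel_def laplace_form_eq H1_class p)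
    then have "l2_class p \<bullet> w = 0"
      using \<mu> by (simp add: dirichlet_form_weak[OF p wH] pl)
    with 0 show "h1_inner (l2_class p) w = 0"
      by (simp add: h1_inner_dirichlet H1_class p wH)
  qed
  show "\<forall>v\<in>laplace_kernel_perp. laplace_form (l2_class p) v = l2_class (laplacian p) \<bullet> v"
    by (simp add: laplace_form_eq dirichlet_form_weak p laplace_kernel_perp_H1)
qed

lemma l2_class_0: "l2_class (\<lambda>_. 0) = 0"
  by (simp add: zero_torus_l2_def)

text \<open>
  A harmonic \<open>f\<close> lies in the kernel of \<open>B\<close>, hence it is orthogonal in \<open>H\<^sup>1\<close>, and then also in \<open>L\<^sup>2\<close>, to
  the complement on which the equation is tested. This covers the constant mode.
\<close>

lemma solves_poisson_harmonic:
  fixes f :: "real \<times> real \<Rightarrow> real"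
  assumes f: "f \<in> torus_smooth" and lap: "laplacian f = (\<lambda>_. 0)"
  shows "solves_poisson (l2_class f) 0"
proof -
  have dz: "dirichlet_form (l2_class f) v = 0" if "v \<in> H1" for v
    using dirichlet_form_weak[OF f that] by (simp add: lap l2_class_0)
  then have K: "l2_class f \<in> laplace_kernel"
    by (simp add: laplace_kernel_def laplace_form_eq H1_class f)
  have H0: "0 \<in> H1"
    using H1_scaleR[OF H1_class[OF f], of 0] by simp
  have J0: "sobolev_jet 0 = 0"
    using sobolev_jet_scaleR[OF H1_class[OF f], of 0] by simp
  have "0 \<in> laplace_kernel_perp"
    by (simp add: laplace_kernel_perp_def H0 h1_inner_eq laplace_kernel_H1 J0)
  moreover have "l2_class f \<bullet> v = 0" if v: "v \<in> laplace_kernel_perp" for v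
  proof -
    have "h1_inner v (l2_class f) = 0"
      using v K by (simp add: laplace_kernel_perp_def)
    then show ?thesis
      using dz[OF laplace_kernel_perp_H1[OF v]]
      by (simp add: h1_inner_dirichlet laplace_kernel_perp_H1[OF v] H1_class f dirichlet_form_commute[of v] inner_commute)
  qed
  ultimately show ?thesis
    by (simp add: solves_poisson_def laplace_form_eq dirichlet_form_def J0)
qed

section \<open>The operator as a Fourier multiplier\<close>

text \<open>
  The eigenvalue of \<open>d\<^sup>* \<circ> D\<^sup>-\<^sup>1\<close> on the exponential with frequency \<open>x = (k, m)\<close>: the factor \<open>\<i> (k + m)\<close> comes from
  \<open>d\<^sup>*\<close> and \<open>- 1 / (k\<^sup>2 + m\<^sup>2)\<close> from the inverse Laplacian. At \<open>x = 0\<close> division by zero gives 0, which is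
  the correct value, as \<open>D\<^sup>-\<^sup>1\<close> annihilates constants.
\<close>

definition P_symbol :: "int \<times> int \<Rightarrow> complex" where
  "P_symbol x = - \<i> * of_int (fst x + snd x) / of_int ((fst x)\<^sup>2 + (snd x)\<^sup>2)"

lemma norm_P_symbol: "cmod (P_symbol x) = \<bar>real_of_int (fst x + snd x)\<bar> / real_of_int ((fst x)\<^sup>2 + (snd x)\<^sup>2)"
proof -
  have "cmod (P_symbol x) = cmod (of_int (fst x + snd x)) / cmod (of_int ((fst x)\<^sup>2 + (snd x)\<^sup>2))"
    unfolding P_symbol_def by (simp only: norm_divide norm_mult norm_minus_cancel norm_ii mult_1)
  then show ?thesis
    by (simp only: norm_of_int) simp
qed

lemma norm_P_symbol_le: "cmod (P_symbol x) \<le> 1"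
proof -
  have sq: "\<bar>k\<bar> \<le> k\<^sup>2" for k :: int
    using self_le_power[of "\<bar>k\<bar>" 2] by (cases "k = 0") (auto simp: power2_eq_square)
  have "\<bar>fst x + snd x\<bar> \<le> (fst x)\<^sup>2 + (snd x)\<^sup>2"
    using sq[of "fst x"] sq[of "snd x"] by linarith
  then have "\<bar>real_of_int (fst x + snd x)\<bar> \<le> real_of_int ((fst x)\<^sup>2 + (snd x)\<^sup>2)"
    by linarith
  then show ?thesis
    unfolding norm_P_symbol by (intro divide_le_eq_1[THEN iffD2]) linarith
qed

lemma cnj_P_symbol: "cnj (P_symbol x) = - P_symbol x"
  by (simp add: P_symbol_def)

lemma l2_eq_refl: "square_integrable f \<Longrightarrow> l2_eq f f"
  by (simp add: l2_eq_def)

lemma laplacian_linear: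
  assumes L: "bounded_linear L" and f: "f \<in> torus_smooth"
  shows "laplacian (\<lambda>z. L (f z)) = (\<lambda>z. L (laplacian f z))"
  using assms torus_smooth_partial1[OF f] torus_smooth_partial2[OF f]
  by (simp add: laplacian_def partial1_linear partial2_linear torus_smooth_differentiable
      linear_add[OF bounded_linear.linear])

text \<open>
  The smooth function \<open>p\<close> represents \<open>D\<^sup>-\<^sup>1 q\<close>, and the Fourier multiplier acts on \<open>q\<close> as \<open>d\<^sup>* \<circ> D\<^sup>-\<^sup>1\<close> should.
  As this is additive in \<open>(q, p)\<close>, it extends from single exponentials to their span.
\<close>

definition inverts_laplacian :: "(real \<times> real \<Rightarrow> complex) \<Rightarrow> (real \<times> real \<Rightarrow> complex) \<Rightarrow> bool" where
  "inverts_laplacian q p \<longleftrightarrow> q \<in> torus_smooth \<and> p \<in> torus_smooth \<and>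
     solves_poisson (l2_class (\<lambda>z. Re (q z))) (l2_class (\<lambda>z. Re (p z))) \<and>
     solves_poisson (l2_class (\<lambda>z. Im (q z))) (l2_class (\<lambda>z. Im (p z))) \<and>
     multiplier P_symbol (l2_class q) = l2_class (\<lambda>z. partial1 p z + partial2 p z)"

lemma multiplier_P_add: "multiplier P_symbol (f + g) = multiplier P_symbol f + multiplier P_symbol g"
  using bounded_clinear_multiplier[OF norm_P_symbol_le]
  by (auto simp: bounded_clinear_def linear_add[OF bounded_linear.linear])

lemma inverts_laplacian_add:
  assumes "inverts_laplacian q p" "inverts_laplacian q' p'"
  shows "inverts_laplacian (\<lambda>z. q z + q' z) (\<lambda>z. p z + p' z)"
proof -
  have sm: "q \<in> torus_smooth" "p \<in> torus_smooth" "q' \<in> torus_smooth" "p' \<in> torus_smooth"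
    using assms by (auto simp: inverts_laplacian_def)
  have comp: "l2_class (\<lambda>z. L (f z + g z)) = l2_class (\<lambda>z. L (f z)) + l2_class (\<lambda>z. L (g z))"
    if "bounded_linear L" "f \<in> torus_smooth" "g \<in> torus_smooth"
    for L :: "complex \<Rightarrow> real" and f g :: "real \<times> real \<Rightarrow> complex"
    using that by (simp add: l2_class_add torus_smooth_square_integrable torus_smooth_linear
        linear_add[OF bounded_linear.linear])
  have "multiplier P_symbol (l2_class (\<lambda>z. q z + q' z))
      = multiplier P_symbol (l2_class q) + multiplier P_symbol (l2_class q')"
    using sm by (simp add: l2_class_add[symmetric] torus_smooth_square_integrable multiplier_P_add)
  also have "\<dots> = l2_class (\<lambda>z. partial1 p z + partial2 p z) + l2_class (\<lambda>z. partial1 p' z + partial2 p' z)"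
    using assms by (simp add: inverts_laplacian_def)
  also have "\<dots> = l2_class (\<lambda>z. (partial1 p z + partial2 p z) + (partial1 p' z + partial2 p' z))"
    by (intro l2_class_add torus_smooth_square_integrable torus_smooth_add torus_smooth_partial1
        torus_smooth_partial2 sm)
  also have "\<dots> = l2_class (\<lambda>z. partial1 (\<lambda>z. p z + p' z) z + partial2 (\<lambda>z. p z + p' z) z)"
    using sm by (simp add: partial1_add partial2_add torus_smooth_differentiable ac_simps)
  finally show ?thesis
    using assms solves_poisson_add torus_smooth_add
    unfolding inverts_laplacian_def comp[OF bounded_linear_Re sm(1,3)] comp[OF bounded_linear_Re sm(2,4)]
      comp[OF bounded_linear_Im sm(1,3)] comp[OF bounded_linear_Im sm(2,4)]
    by blast
qed

text \<open>
  The character for \<open>x\<close> is an eigenfunction of the Laplacian with eigenvalue \<open>- (k\<^sup>2 + m\<^sup>2)\<close>, and so are its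
  real and imaginary parts. For \<open>x = 0\<close> the quotient is 0 by convention, which is again the solution.
\<close>

lemma inverts_laplacian_tchar:
  "inverts_laplacian (\<lambda>z. c * tchar x z) (\<lambda>z. - c / of_int ((fst x)\<^sup>2 + (snd x)\<^sup>2) * tchar x z)"
proof -
  define n :: int where "n = (fst x)\<^sup>2 + (snd x)\<^sup>2"
  define q where "q z = c * tchar x z" for z
  define p where "p z = - c / of_int n * tchar x z" for z
  have q: "q \<in> torus_smooth" and p: "p \<in> torus_smooth"
    unfolding q_def[abs_def] p_def[abs_def] by (rule tchar_smooth)+
  have n0: "n = 0 \<longleftrightarrow> x = 0"
    by (auto simp: n_def prod_eq_iff sum_power2_eq_zero_iff)
  have lap: "laplacian p = (\<lambda>z. (- of_int n) * p z)" "laplacian q = (\<lambda>z. (- of_int n) * q z)"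
    unfolding p_def[abs_def] q_def[abs_def] laplacian_tchar n_def[symmetric] by (simp_all add: fun_eq_iff)
  have "solves_poisson (l2_class (\<lambda>z. L (q z))) (l2_class (\<lambda>z. L (p z)))" if L: "bounded_linear L" for L :: "complex \<Rightarrow> real"
  proof (cases "n = 0")
    case True
    have "solves_poisson (l2_class (\<lambda>z. L (q z))) 0"
      using True by (intro solves_poisson_harmonic torus_smooth_linear[OF L] q)
        (simp add: laplacian_linear[OF L q] lap linear_0[OF bounded_linear.linear[OF L]])
    moreover have "l2_class (\<lambda>z. L (p z)) = 0"
      using True by (simp add: p_def l2_class_0 linear_0[OF bounded_linear.linear[OF L]])
    ultimately show ?thesis
      by simp
  next
    case False
    have Lr: "L (of_int m * w) = of_int m * L w" for m w
      using linear_scale[OF bounded_linear.linear[OF L], of "of_int m" w] by (simp add: scaleR_conv_of_real)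
    have "laplacian (\<lambda>z. L (p z)) = (\<lambda>z. of_int (- n) * L (p z))"
      unfolding laplacian_linear[OF L p] lap Lr[symmetric] by simp
    moreover have "laplacian (\<lambda>z. L (p z)) = (\<lambda>z. L (q z))"
      unfolding laplacian_linear[OF L p] lap using False by (simp add: p_def q_def)
    ultimately show ?thesis
      using solves_poisson_eigenfunction[OF torus_smooth_linear[OF L p], of "of_int (- n)"] False by simp
  qed
  note sp = this[OF bounded_linear_Re] this[OF bounded_linear_Im]
  have "l2_class q = (c * (2 * pi)) *\<^sub>C texp x"
    unfolding cscale_texp q_def[abs_def] by simp
  then have "multiplier P_symbol (l2_class q) = (c * (2 * pi)) *\<^sub>C multiplier P_symbol (texp x)"
    using bounded_clinear_multiplier[OF norm_P_symbol_le] by (simp add: bounded_clinear_def)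
  also have "\<dots> = (c * (2 * pi) * P_symbol x) *\<^sub>C texp x"
    by (simp only: multiplier_texp[OF norm_P_symbol_le] cvs.scale_scale)
  also have "\<dots> = l2_class (\<lambda>z. (c * P_symbol x) * tchar x z)"
    unfolding cscale_texp by simp
  also have "(\<lambda>z. (c * P_symbol x) * tchar x z) = (\<lambda>z. partial1 p z + partial2 p z)"
    unfolding p_def[abs_def] partial1_tchar partial2_tchar
    by (simp add: fun_eq_iff P_symbol_def n_def[symmetric] add_divide_distrib algebra_simps del: of_int_add of_int_power)
      (simp add: algebra_simps add_divide_distrib)
  finally show ?thesis
    using sp q p unfolding inverts_laplacian_def p_def[abs_def] q_def[abs_def] n_def by blast
qed

lemma trig_span_inverts_laplacian:
  assumes "f \<in> trig_span"
  shows "\<exists>q p. f = l2_class q \<and> inverts_laplacian q p"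
  using assms unfolding trig_span_alt
proof (induction rule: cvs.span_induct_alt)
  case base
  have "0 = l2_class (\<lambda>z. 0 * tchar 0 z)"
    by (simp add: l2_class_0)
  then show ?case
    using inverts_laplacian_tchar[of 0 0] by blast
next
  case (step c e f)
  then obtain x q p where e: "e = texp x" and f: "f = l2_class q" and qp: "inverts_laplacian q p"
    by blast
  note i = inverts_laplacian_tchar[of "c / (2 * pi)" x]
  have "c *\<^sub>C e + f = l2_class (\<lambda>z. c / (2 * pi) * tchar x z + q z)"
    using qp by (simp only: e f cscale_texp inverts_laplacian_def l2_class_add torus_smooth_square_integrable tchar_smooth)
  with inverts_laplacian_add[OF i qp] show ?case
    by blast
qed

lemma l2_Re_class: "square_integrable q \<Longrightarrow> l2_Re (l2_class q) = l2_class (\<lambda>z. Re (q z))"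
  by (rule l2_Re.abs_eq) (rule l2_eq_refl)

lemma l2_Im_class: "square_integrable q \<Longrightarrow> l2_Im (l2_class q) = l2_class (\<lambda>z. Im (q z))"
  by (rule l2_Im.abs_eq) (rule l2_eq_refl)

lemma l2_complex_class: "square_integrable r \<Longrightarrow> l2_complex (l2_class r) = l2_class (\<lambda>z. complex_of_real (r z))"
  by (rule l2_complex.abs_eq) (rule l2_eq_refl)

lemma cscale_class: "square_integrable f \<Longrightarrow> c *\<^sub>C l2_class f = l2_class (\<lambda>z. c * f z)"
  by (rule cscale.abs_eq) (rule l2_eq_refl)

lemma d_star_inv_laplace:
  assumes "f \<in> trig_span"
  shows "d_star (inv_laplace f) = multiplier P_symbol f"
proof -
  obtain q p where f: "f = l2_class q" and qp: "inverts_laplacian q p"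
    using trig_span_inverts_laplacian[OF assms] by blast
  have q: "q \<in> torus_smooth" and p: "p \<in> torus_smooth"
    using qp by (auto simp: inverts_laplacian_def)
  have cs: "(\<lambda>z. complex_of_real (Re (p z))) \<in> torus_smooth" "(\<lambda>z. complex_of_real (Im (p z))) \<in> torus_smooth"
    by (intro torus_smooth_linear[OF bounded_linear_of_real] torus_smooth_linear[OF bounded_linear_Re]
        torus_smooth_linear[OF bounded_linear_Im] p)+
  have "inv_laplace f = l2_complex (l2_class (\<lambda>z. Re (p z))) + \<i> *\<^sub>C l2_complex (l2_class (\<lambda>z. Im (p z)))"
  proof -
    have "inv_laplace_real (l2_class (\<lambda>z. Re (q z))) = l2_class (\<lambda>z. Re (p z))"
      "inv_laplace_real (l2_class (\<lambda>z. Im (q z))) = l2_class (\<lambda>z. Im (p z))"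
      using qp by (auto simp: inverts_laplacian_def intro: inv_laplace_real_eq)
    then show ?thesis
      using q by (simp add: inv_laplace_def f l2_Re_class l2_Im_class torus_smooth_square_integrable)
  qed
  also have "\<dots> = l2_class (\<lambda>z. complex_of_real (Re (p z)) + \<i> * complex_of_real (Im (p z)))"
    by (simp add: l2_complex_class cscale_class l2_class_add torus_smooth_square_integrable cs
        torus_smooth_linear[OF bounded_linear_Re] torus_smooth_linear[OF bounded_linear_Im] p
        torus_smooth_linear[OF bounded_linear_mult_right])
  also have "(\<lambda>z. complex_of_real (Re (p z)) + \<i> * complex_of_real (Im (p z))) = p"
    by (simp add: complex_eq[symmetric])
  finally have inv: "inv_laplace f = l2_class p" .
  have "(THE p'. p' \<in> torus_smooth \<and> l2_class p' = l2_class p) = p"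
    using p by (intro the_equality) (auto intro: smooth_representative_unique)
  then show ?thesis
    using qp by (simp add: d_star_def inv[unfolded f] f inverts_laplacian_def)
qed

text \<open>
  The span of the exponentials is dense.
\<close>

lemma bounded_clinear_eqI_texp:
  assumes S: "bounded_clinear S" and T: "bounded_clinear T"
    and eq: "\<And>x. S (texp x) = T (texp x)"
  shows "S = T"
proof
  fix f
  have Sb: "bounded_linear S" and Tb: "bounded_linear T"
    using S T by (auto simp: bounded_clinear_def)
  have "trig_span \<subseteq> {f. S f = T f}"
  proof
    fix f assume "f \<in> trig_span"
    then have "S f = T f"
      unfolding trig_span_alt
    proof (induction rule: cvs.span_induct_alt)
      case base
      show ?case
        using linear_0[OF bounded_linear.linear[OF Sb]] linear_0[OF bounded_linear.linear[OF Tb]] by simp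
    next
      case (step c x y)
      then show ?case
        using S T eq linear_add[OF bounded_linear.linear[OF Sb]] linear_add[OF bounded_linear.linear[OF Tb]]
        by (auto simp: bounded_clinear_def)
    qed
    then show "f \<in> {f. S f = T f}" by simp
  qed
  moreover have "closed {f. S f = T f}"
    by (intro closed_Collect_eq linear_continuous_on Sb Tb)
  ultimately have "closure trig_span \<subseteq> {f. S f = T f}"
    by (rule closure_minimal)
  then show "S f = T f"
    by (auto simp: trig_span_dense)
qed

text \<open>
  The multiplier is a bounded extension of \<open>d\<^sup>* \<circ> D\<^sup>-\<^sup>1\<close> from the trigonometric polynomials, and
  by density the only one.
\<close>

lemma P_torus_eq: "P_torus = multiplier P_symbol"
  unfolding P_torus_def
proof (rule the_equality)
  show "bounded_clinear (multiplier P_symbol) \<and> (\<forall>f\<in>trig_span. multiplier P_symbol f = d_star (inv_laplace f))"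
    by (simp add: bounded_clinear_multiplier[OF norm_P_symbol_le] d_star_inv_laplace)
next
  fix T
  assume T: "bounded_clinear T \<and> (\<forall>f\<in>trig_span. T f = d_star (inv_laplace f))"
  have "texp x \<in> trig_span" for x
    unfolding trig_span_alt by (intro cvs.span_base) auto
  with T show "T = multiplier P_symbol"
    by (intro bounded_clinear_eqI_texp bounded_clinear_multiplier[OF norm_P_symbol_le])
      (auto simp: d_star_inv_laplace)
qed

section \<open>Absolute values of multipliers\<close>

lemma cadjoint_multiplier:
  assumes c: "\<And>x. cmod (c x) \<le> B"
  shows "cadjoint (multiplier c) = multiplier (\<lambda>x. cnj (c x))"
  unfolding cadjoint_def
proof (rule the_equality)
  show "bounded_clinear (multiplier (\<lambda>x. cnj (c x))) \<and>
      (\<forall>f g. cinner (multiplier c f) g = cinner f (multiplier (\<lambda>x. cnj (c x)) g))"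
    using c by (auto intro!: bounded_clinear_multiplier[of _ B] multiplier_adjoint[of _ B])
next
  fix T
  assume T: "bounded_clinear T \<and> (\<forall>f g. cinner (multiplier c f) g = cinner f (T g))"
  show "T = multiplier (\<lambda>x. cnj (c x))"
  proof (intro ext l2_eqI)
    fix g h
    show "cinner h (T g) = cinner h (multiplier (\<lambda>x. cnj (c x)) g)"
      using T multiplier_adjoint[of c B h g] c by simp
  qed
qed

text \<open>
  The multiplier with symbol \<open>|s|\<^sup>2\<close> is \<open>T\<^sup>* T\<close>, where \<open>T\<close> is the multiplier with symbol \<open>s\<close>.
\<close>

lemma positive_op_multiplier_sq:
  assumes s: "\<And>x. cmod (s x) \<le> B"
  shows "positive_op (multiplier (\<lambda>x. of_real ((cmod (s x))\<^sup>2)))"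
    and "cinner f (multiplier (\<lambda>x. of_real ((cmod (s x))\<^sup>2)) f) = of_real ((norm (multiplier s f))\<^sup>2)"
proof -
  have eq: "(\<lambda>x. of_real ((cmod (s x))\<^sup>2)) = (\<lambda>x. cnj (s x) * s x)"
    unfolding complex_norm_square by (simp add: mult.commute)
  have cs: "cmod (cnj (s x)) \<le> B" for x
    using s by simp
  have sq: "cmod (cnj (s x) * s x) \<le> B * B" for x
    using s[of x] norm_ge_zero[of "s x"] unfolding norm_mult complex_mod_cnj
    by (intro mult_mono) linarith+
  have inner: "cinner f (multiplier (\<lambda>x. of_real ((cmod (s x))\<^sup>2)) f) = of_real ((norm (multiplier s f))\<^sup>2)" for f
  proof -
    have "cinner f (multiplier (\<lambda>x. cnj (s x) * s x) f) = cinner f (multiplier (\<lambda>x. cnj (s x)) (multiplier s f))"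
      by (simp only: multiplier_comp[OF cs s])
    also have "\<dots> = cinner (multiplier s f) (multiplier s f)"
      by (rule multiplier_adjoint[OF s, symmetric])
    finally show ?thesis
      unfolding eq by (simp only: cinner_self)
  qed
  show "positive_op (multiplier (\<lambda>x. of_real ((cmod (s x))\<^sup>2)))"
    unfolding positive_op_def inner unfolding eq
    by (auto intro!: bounded_clinear_multiplier[OF sq])
  show "cinner f (multiplier (\<lambda>x. of_real ((cmod (s x))\<^sup>2)) f) = of_real ((norm (multiplier s f))\<^sup>2)"
    by (rule inner)
qed

text \<open>
  This yields uniqueness of positive square roots of diagonal operators without functional calculus.
  For \<open>r > 0\<close>, the vector \<open>g = S e - r e\<close> satisfies \<open>S g = - r g\<close>, which positivity of \<open>S\<close> permits only for \<open>g = 0\<close>.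
  For \<open>r = 0\<close> the hypothesis is \<open>S (S e) = 0\<close>, and positivity at \<open>S e - t e\<close> for small \<open>t > 0\<close> forces \<open>S e = 0\<close>.
\<close>

lemma positive_sqrt_eigenvector:
  assumes S: "positive_op S" and SS: "S (S e) = of_real (r\<^sup>2) *\<^sub>C e" and r: "0 \<le> r"
  shows "S e = of_real r *\<^sub>C e"
proof -
  have Sb: "bounded_linear S" and Sc: "\<And>c f. S (c *\<^sub>C f) = c *\<^sub>C S f"
    and pos: "\<And>f. 0 \<le> Re (cinner f (S f))"
    using S by (auto simp: positive_op_def bounded_clinear_def)
  note Sadd = linear_add[OF bounded_linear.linear[OF Sb]] and Sdiff = linear_diff[OF bounded_linear.linear[OF Sb]]
  show ?thesis
  proof (cases "r = 0")
    case False
    define g where "g = S e - of_real r *\<^sub>C e"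
    have "S g = - (of_real r *\<^sub>C g)"
      by (simp add: g_def Sdiff Sc SS cvs.scale_right_diff_distrib power2_eq_square)
    then have "cinner g (S g) = - (of_real r * of_real ((norm g)\<^sup>2))"
      using cinner_diff_right[of g 0 "of_real r *\<^sub>C g"] by (simp add: cinner_cscale_right cinner_self)
    then have "Re (cinner g (S g)) = - (r * (norm g)\<^sup>2)"
      by simp
    with pos[of g] have "r * (norm g)\<^sup>2 \<le> 0"
      by simp
    then have "(norm g)\<^sup>2 \<le> 0"
      using r False by (simp add: mult_le_0_iff)
    then show ?thesis
      by (simp add: g_def)
  next
    case True
    define N where "N = (norm (S e))\<^sup>2"
    define a where "a = Re (cinner e (S e))"
    have a: "0 \<le> a"
      unfolding a_def by (rule pos)
    have SS0: "S (S e) = 0"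
      using SS True by simp
    have q: "0 \<le> t * (t * a - N)" if "t \<ge> 0" for t :: real
    proof -
      let ?f = "S e - of_real t *\<^sub>C e"
      have Sf: "S ?f = of_real (- t) *\<^sub>C S e"
        by (simp add: Sdiff Sc SS0)
      have "cinner (S e - of_real t *\<^sub>C e) (S e) = of_real N - of_real t * cinner e (S e)"
        using cinner_add_left[of "S e - of_real t *\<^sub>C e" "of_real t *\<^sub>C e" "S e"]
        by (simp add: cinner_cscale_left cinner_self N_def)
      then have "cinner ?f (S ?f) = of_real (- t) * (of_real N - of_real t * cinner e (S e))"
        unfolding Sf cinner_cscale_right by simp
      then have "Re (cinner ?f (S ?f)) = Re (of_real (- t) * (of_real N - of_real t * cinner e (S e)))"
        by (rule arg_cong)
      also have "\<dots> = t * (t * a - N)"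
        by (simp add: a_def algebra_simps)
      finally have "Re (cinner ?f (S ?f)) = t * (t * a - N)" .
      then show ?thesis
        using pos[of ?f] by simp
    qed
    have "N = 0"
    proof (rule ccontr)
      assume "N \<noteq> 0"
      then have N: "N > 0"
        by (simp add: N_def)
      \<comment> \<open>Any positive \<open>t\<close> with \<open>t * a < N\<close> would do; adding 1 avoids a case distinction on \<open>a = 0\<close>.\<close>
      define t where "t = N / (a + 1)"
      have t: "t > 0"
        using N a by (simp add: t_def)
      have "t * (a + 1) = N"
        using a by (simp add: t_def)
      then have "t * a - N = - t"
        by (simp add: algebra_simps)
      then show False
        using q[of t] t by (simp add: mult_le_0_iff)
    qed
    then show ?thesis
      using True by (simp add: N_def)
  qed
qed

lemma op_sqrt_multiplier:
  assumes s: "\<And>x. cmod (s x) \<le> B"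
  defines "R \<equiv> multiplier (\<lambda>x. of_real ((cmod (s x))\<^sup>2))"
  shows "op_sqrt (R \<circ> R) = R"
  unfolding op_sqrt_def
proof (rule the_equality)
  show "positive_op R \<and> R \<circ> R = R \<circ> R"
    unfolding R_def by (intro conjI refl positive_op_multiplier_sq(1)[OF s])
next
  fix S
  assume S: "positive_op S \<and> S \<circ> S = R \<circ> R"
  have b: "cmod (of_real ((cmod (s x))\<^sup>2)) \<le> B\<^sup>2" for x
    using s[of x] by (simp add: norm_power power_mono)
  have R_texp: "R (texp x) = of_real ((cmod (s x))\<^sup>2) *\<^sub>C texp x" for x
    unfolding R_def by (rule multiplier_texp[OF b])
  have Rc: "bounded_clinear R"
    unfolding R_def by (rule bounded_clinear_multiplier[OF b])
  show "S = R"
  proof (rule bounded_clinear_eqI_texp[OF _ Rc])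
    show "bounded_clinear S"
      using S by (simp add: positive_op_def)
    fix x
    have "S (S (texp x)) = R (R (texp x))"
      using S by (simp add: fun_eq_iff)
    also have "\<dots> = of_real (((cmod (s x))\<^sup>2)\<^sup>2) *\<^sub>C texp x"
      using Rc by (simp add: R_texp bounded_clinear_def power2_eq_square)
    finally have SS: "S (S (texp x)) = of_real (((cmod (s x))\<^sup>2)\<^sup>2) *\<^sub>C texp x" .
    show "S (texp x) = R (texp x)"
      unfolding R_texp by (rule positive_sqrt_eigenvector) (use S SS in simp_all)
  qed
qed

text \<open>
  The symbol of \<open>P\<close> is purely imaginary, so \<open>P\<^sup>* = - P\<close> and \<open>P\<^sup>2 = - P\<^sup>* P\<close>. Hence \<open>|P\<^sup>2| = P\<^sup>* P\<close>, with
  symbol \<open>|P_symbol|\<^sup>2\<close>.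
\<close>

lemma op_abs_P_squared: "op_abs (P_torus \<circ> P_torus) = multiplier (\<lambda>x. of_real ((cmod (P_symbol x))\<^sup>2))"
proof -
  note b = norm_P_symbol_le
  let ?R = "multiplier (\<lambda>x. of_real ((cmod (P_symbol x))\<^sup>2))"
  have sq: "of_real ((cmod (P_symbol x))\<^sup>2) = - (P_symbol x * P_symbol x)" for x
    by (simp only: complex_norm_square cnj_P_symbol) simp
  have b2: "cmod (P_symbol x * P_symbol x) \<le> 1" for x
    using b[of x] by (simp add: norm_mult mult_le_one)
  have PP: "P_torus \<circ> P_torus = multiplier (\<lambda>x. P_symbol x * P_symbol x)"
    unfolding P_torus_eq by (simp add: fun_eq_iff multiplier_comp[OF b b])
  have "cadjoint (P_torus \<circ> P_torus) = multiplier (\<lambda>x. P_symbol x * P_symbol x)"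
    unfolding PP cadjoint_multiplier[OF b2] by (simp add: cnj_P_symbol)
  then have "cadjoint (P_torus \<circ> P_torus) \<circ> (P_torus \<circ> P_torus)
      = multiplier (\<lambda>x. (P_symbol x * P_symbol x) * (P_symbol x * P_symbol x))"
    unfolding PP by (simp add: fun_eq_iff multiplier_comp[OF b2 b2])
  also have "\<dots> = ?R \<circ> ?R"
    unfolding sq using b2 by (simp add: fun_eq_iff multiplier_comp[of _ 1 _ 1])
  finally show ?thesis
    by (simp only: op_abs_def op_sqrt_multiplier[OF b])
qed

section \<open>Divergence of the trace\<close>

text \<open>
  A combination of finitely many basis vectors comes within \<open>1 / 2\<close> of \<open>e\<close>, and the projection of \<open>e\<close> to
  their span comes at least as close. Any bound below 1 would serve in place of \<open>1 / 2\<close>.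
\<close>

lemma orthonormal_basis_captures:
  assumes S: "orthonormal_basis S" and e: "norm e = 1"
  shows "\<exists>G. finite G \<and> G \<subseteq> S \<and> 1 / 2 \<le> (\<Sum>f\<in>G. (cmod (cinner f e))\<^sup>2)"
proof -
  have "e \<in> closure (cspan S)"
    using S by (simp add: orthonormal_basis_def)
  then obtain h where h: "h \<in> cspan S" and he: "dist h e < 1 / 2"
    unfolding closure_approachable by (metis half_gt_zero zero_less_one)
  obtain G a where G: "finite G" "G \<subseteq> S" and ha: "h = (\<Sum>f\<in>G. a f *\<^sub>C f)"
    using h unfolding cvs.span_explicit mem_Collect_eq by (elim exE conjE) (rule that)
  have "orthonormal_on G (\<lambda>f. f)"
    using S subsetD[OF G(2)] by (simp add: orthonormal_basis_def orthonormal_on_def)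
  from projection_best_approximation[OF G(1) this, of e a]
  have "1 - (\<Sum>f\<in>G. (cmod (cinner f e))\<^sup>2) \<le> (norm (e - h))\<^sup>2"
    by (simp add: e ha)
  also have "\<dots> \<le> (1 / 2)\<^sup>2"
    using he by (intro power_mono) (auto simp: dist_norm norm_minus_commute)
  finally have "1 / 2 \<le> (\<Sum>f\<in>G. (cmod (cinner f e))\<^sup>2)"
    by (simp add: power2_eq_square)
  with G show ?thesis
    by blast
qed

text \<open>
  One inequality in the independence of the trace from the basis. Let \<open>T\<close> be the multiplier.
  For finitely many frequencies, finitely many basis vectors \<open>f\<close> capture at least half of
  the squared norm of each exponential. The double sum of \<open>|\<langle>e\<^sub>x, T f\<rangle>|\<^sup>2 = |s x|\<^sup>2 |\<langle>e\<^sub>x, f\<rangle>|\<^sup>2\<close> is then at least half of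
  the sum of the \<open>|s x|\<^sup>2\<close>, and by Bessel's inequality at most the sum of the \<open>\<parallel>T f\<parallel>\<^sup>2\<close>.
\<close>

lemma sum_symbol_le_trace:
  assumes s: "\<And>x. cmod (s x) \<le> B" and S: "orthonormal_basis S" and F: "finite F"
    and sum: "(\<lambda>f. (norm (multiplier s f))\<^sup>2) summable_on S"
  shows "(\<Sum>x\<in>F. (cmod (s x))\<^sup>2) \<le> 2 * (\<Sum>\<^sub>\<infinity>f\<in>S. (norm (multiplier s f))\<^sup>2)"
proof -
  have "\<exists>G. finite G \<and> G \<subseteq> S \<and> 1 / 2 \<le> (\<Sum>f\<in>G. (cmod (cinner f (texp x)))\<^sup>2)" for x
    using orthonormal_basis_captures[OF S norm_texp] .
  then obtain G where G: "\<And>x. finite (G x)" "\<And>x. G x \<subseteq> S"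
      "\<And>x. 1 / 2 \<le> (\<Sum>f\<in>G x. (cmod (cinner f (texp x)))\<^sup>2)"
    by metis
  define H where "H = (\<Union>x\<in>F. G x)"
  have H: "finite H" "H \<subseteq> S"
    unfolding H_def by (intro finite_UN_I F G(1), intro UN_least G(2))
  have half: "1 / 2 \<le> (\<Sum>f\<in>H. (cmod (cinner (texp x) f))\<^sup>2)" if "x \<in> F" for x
  proof -
    have "(\<Sum>f\<in>G x. (cmod (cinner f (texp x)))\<^sup>2) \<le> (\<Sum>f\<in>H. (cmod (cinner f (texp x)))\<^sup>2)"
      using that H by (intro sum_mono2) (auto simp: H_def)
    moreover have "cmod (cinner f (texp x)) = cmod (cinner (texp x) f)" for f
      using cnj_cinner[of f "texp x"] complex_mod_cnj by metis
    ultimately show ?thesis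
      using G(3)[of x] by simp
  qed
  have "(\<Sum>x\<in>F. (cmod (s x))\<^sup>2) * (1 / 2) = (\<Sum>x\<in>F. (cmod (s x))\<^sup>2 * (1 / 2))"
    by (rule sum_distrib_right)
  also have "\<dots> \<le> (\<Sum>x\<in>F. (cmod (s x))\<^sup>2 * (\<Sum>f\<in>H. (cmod (cinner (texp x) f))\<^sup>2))"
    by (intro sum_mono mult_left_mono half) auto
  also have "\<dots> = (\<Sum>x\<in>F. \<Sum>f\<in>H. (cmod (cinner (texp x) (multiplier s f)))\<^sup>2)"
    by (simp add: sum_distrib_left fourier_multiplier[OF s] norm_mult power_mult_distrib)
  also have "\<dots> = (\<Sum>f\<in>H. \<Sum>x\<in>F. (cmod (cinner (texp x) (multiplier s f)))\<^sup>2)"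
    by (rule sum.swap)
  also have "\<dots> \<le> (\<Sum>f\<in>H. (norm (multiplier s f))\<^sup>2)"
    by (intro sum_mono bessel_inequality F orthonormal_texp)
  also have "\<dots> \<le> (\<Sum>\<^sub>\<infinity>f\<in>S. (norm (multiplier s f))\<^sup>2)"
    by (rule finite_sum_le_infsum[OF sum H]) simp
  finally show ?thesis
    by simp
qed

text \<open>
  On the sector \<open>1 \<le> m \<le> k\<close> the mixed term of \<open>(k + m)\<^sup>2\<close> is nonnegative, so the squared symbol is at least
  \<open>1 / (k\<^sup>2 + m\<^sup>2) \<ge> 1 / (2 k\<^sup>2)\<close>. There are \<open>k\<close> values of \<open>m\<close> for each \<open>k\<close>, and the sum over the sector
  dominates half of the harmonic series.
\<close>

lemma P_symbol_not_square_summable: "\<exists>F. finite F \<and> C < (\<Sum>x\<in>F. (cmod (P_symbol x))\<^sup>2)"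
proof -
  have "\<forall>\<^sub>F n in sequentially. 2 * C < harm n"
    using harm_at_top unfolding filterlim_at_top_dense by blast
  then obtain n where n: "2 * C < harm n"
    by (auto simp: eventually_sequentially)
  define D where "D = Sigma {1..n} (\<lambda>k. {1..k})"
  define \<iota> where "\<iota> = (\<lambda>(k, m). (int k, int m))"
  have inj: "inj_on \<iota> D"
    by (auto simp: inj_on_def \<iota>_def)
  have low: "1 / (2 * (real k)\<^sup>2) \<le> (cmod (P_symbol (int k, int m)))\<^sup>2" if "1 \<le> m" "m \<le> k" for k m :: nat
  proof -
    define d where "d = (real k)\<^sup>2 + (real m)\<^sup>2"
    have k: "0 < real k"
      using that by simp
    have d0: "0 < d"
      using k by (simp add: d_def add_pos_nonneg)
    have "(real m)\<^sup>2 \<le> (real k)\<^sup>2"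
      using that by (intro power_mono) auto
    then have "d \<le> 2 * (real k)\<^sup>2"
      by (simp add: d_def)
    then have "1 / (2 * (real k)\<^sup>2) \<le> 1 / d"
      using d0 by (intro divide_left_mono mult_pos_pos) (use d0 k in simp_all)
    also have "\<dots> = d / d\<^sup>2"
      using d0 by (simp add: power2_eq_square)
    also have "\<dots> \<le> (real k + real m)\<^sup>2 / d\<^sup>2"
      by (intro divide_right_mono) (auto simp: d_def power2_sum)
    also have "\<dots> = (cmod (P_symbol (int k, int m)))\<^sup>2"
      unfolding norm_P_symbol by (simp add: power_divide d_def)
    finally show ?thesis .
  qed
  have "harm n / 2 = (\<Sum>k=1..n. \<Sum>m=1..k. 1 / (2 * (real k)\<^sup>2))"
    unfolding harm_def sum_divide_distrib
    by (intro sum.cong refl) (simp add: power2_eq_square field_simps)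
  also have "\<dots> \<le> (\<Sum>k=1..n. \<Sum>m=1..k. (cmod (P_symbol (int k, int m)))\<^sup>2)"
    by (intro sum_mono low) auto
  also have "\<dots> = (\<Sum>y\<in>D. (cmod (P_symbol (\<iota> y)))\<^sup>2)"
    unfolding D_def by (subst sum.Sigma) (auto simp: \<iota>_def intro!: sum.cong)
  also have "\<dots> = (\<Sum>x\<in>\<iota> ` D. (cmod (P_symbol x))\<^sup>2)"
    using inj by (simp add: sum.reindex)
  finally have "C < (\<Sum>x\<in>\<iota> ` D. (cmod (P_symbol x))\<^sup>2)"
    using n by simp
  moreover have "finite (\<iota> ` D)"
    by (simp add: D_def)
  ultimately show ?thesis
    by blast
qed

theorem proposition4p5:
  shows "\<not> trace_class (P_torus \<circ> P_torus)"
proof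
  assume "trace_class (P_torus \<circ> P_torus)"
  then obtain S where S: "orthonormal_basis S"
    and "(\<lambda>f. cinner f (op_abs (P_torus \<circ> P_torus) f)) summable_on S"
    by (auto simp: trace_class_def)
  then have "(\<lambda>f. complex_of_real ((norm (multiplier P_symbol f))\<^sup>2)) summable_on S"
    by (simp only: op_abs_P_squared positive_op_multiplier_sq(2)[OF norm_P_symbol_le])
  from summable_on_Re[OF this] have sum: "(\<lambda>f. (norm (multiplier P_symbol f))\<^sup>2) summable_on S"
    by simp
  obtain F where "finite F"
    "2 * (\<Sum>\<^sub>\<infinity>f\<in>S. (norm (multiplier P_symbol f))\<^sup>2) < (\<Sum>x\<in>F. (cmod (P_symbol x))\<^sup>2)"
    using P_symbol_not_square_summable by blast
  with sum_symbol_le_trace[OF norm_P_symbol_le S _ sum, of F] show False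
    by simp
qed

end
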